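(* Suppose $E$ is an interior weight on $\Omega$ (with $K$ the support of $\mathcal L_A(E)$) and $0\le V\in C^\infty(\Omega\setminus K)$. Then the following are equivalent: (i) For all $u\in H_0^1(\Omega)$, $$\int_\Omega|\nabla u|_A^2\,dx\ \ge\ \frac14\int_\Omega\frac{|\nabla E|_A^2}{E^2}u^2\,dx+\int_\Omega Vu^2\,dx.$$ (ii) For all $t\neq\frac12$ and all $u\in X_t$, $$\int_\Omega E^{2t}|\nabla u|_A^2\,dx\ \ge\ \left(t-\tfrac12\right)^2\int_\Omega|\nabla E|_A^2E^{2t-2}u^2\,dx+\int_\Omega VE^{2t}u^2\,dx.$$ (iii) For all $u\in X_{1/2}$, $$\int_\Omega E|\nabla u|_A^2\,dx\ \ge\ \int_\Omega VEu^2\,dx.$$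
   Context: $\Omega\subset\mathbb{R}^n$ is a bounded connected domain with smooth boundary. $A(x)=(a^{i,j}(x))$ is an $n\times n$ symmetric, uniformly positive definite matrix with $a^{i,j}\in C^\infty(\overline\Omega)$. For $\xi\in\mathbb{R}^n$, $|\xi|_A^2:=A(x)\xi\cdot\xi$, and $\mathcal L_A(E):=-\mathrm{div}(A\nabla E)$ (in the distributional sense). $E$ is called an interior weight on $\Omega$ if $E>0$ in $\Omega$; $\mathcal L_A(E)$ is a nonnegative nonzero finite measure in $\Omega$, denoted $\mu$; and, with $K\subset\Omega$ denoting the (compact) support of $\mu$, $E\in C^\infty(\overline\Omega\setminus K)$, $E=\infty$ on $K$, and $\dim_{box}(K)<n-2$. For compact $K\subset\mathbb{R}^n$, $\dim_{box}(K):=n-\lim_{r\searrow0}\frac{\log(\mathcal H^n(K_r))}{\log r}$ provided the limit exists, where $K_r:=\{x\in\Omega:\mathrm{dist}(x,K)<r\}$ and $\mathcal H^n$ is $n$-dimensional Hausdorff measure. For $t\in\mathbb{R}$, $X_t$ is the completion of $C_c^{0,1}(\Omega\setminus K)$ (Lipschitz functions with compact support in $\Omega\setminus K$) with respect to the norm $\|u\|_t$, where $\|u\|_t^2:=\int_\Omega E^{2t}|\nabla u|_A^2\,dx$. *)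

theory Defs
  imports "HOL-Analysis.Analysis"
begin

subsection \<open>Smooth functions\<close>

definition grad :: "(real ^ 'n \<Rightarrow> real) \<Rightarrow> real ^ 'n \<Rightarrow> real ^ 'n" where
  "grad f x = (\<chi> i. frechet_derivative f (at x) (axis i 1))"

primrec iterated_pderiv ::
  "'a::euclidean_space list \<Rightarrow> ('a \<Rightarrow> 'b::real_normed_vector) \<Rightarrow> 'a \<Rightarrow> 'b" where
  "iterated_pderiv [] f = f"
| "iterated_pderiv (v # vs) f = iterated_pderiv vs (\<lambda>x. frechet_derivative f (at x) v)"

text \<open>\<open>f \<in> C\<^sup>\<infinity>(S)\<close> for an open set \<open>S\<close>: the iterated partial derivatives of all orders
  are differentiable (hence also continuous) on \<open>S\<close>.\<close>

definition smooth_on :: "'a::euclidean_space set \<Rightarrow> ('a \<Rightarrow> 'b::real_normed_vector) \<Rightarrow> bool" where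
  "smooth_on S f \<longleftrightarrow>
     (\<forall>vs\<in>lists Basis. \<forall>x\<in>S. iterated_pderiv vs f differentiable (at x))"

text \<open>\<open>f \<in> C\<^sup>\<infinity>(T)\<close> where \<open>S\<close> is open and \<open>S \<subseteq> T \<subseteq> closure S\<close>: \<open>f\<close> is continuous on \<open>T\<close>,
  smooth on \<open>S\<close>, and all its partial derivatives extend continuously from \<open>S\<close> to \<open>T\<close>.\<close>

definition smooth_upto ::
  "'a::euclidean_space set \<Rightarrow> 'a set \<Rightarrow> ('a \<Rightarrow> 'b::real_normed_vector) \<Rightarrow> bool" where
  "smooth_upto S T f \<longleftrightarrow> continuous_on T f \<and> smooth_on S f \<and>
     (\<forall>vs\<in>lists Basis. \<exists>g. continuous_on T g \<and> (\<forall>x\<in>S. g x = iterated_pderiv vs f x))"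

definition compact_support_in :: "'a::topological_space set \<Rightarrow> ('a \<Rightarrow> real) \<Rightarrow> bool" where
  "compact_support_in S f \<longleftrightarrow> (\<exists>C. compact C \<and> C \<subseteq> S \<and> (\<forall>x. x \<notin> C \<longrightarrow> f x = 0))"

text \<open>Compactly supported functions are extended by zero to the whole space.\<close>

definition Cc_smooth :: "(real ^ 'n) set \<Rightarrow> (real ^ 'n \<Rightarrow> real) set" where
  "Cc_smooth S = {f. smooth_on UNIV f \<and> compact_support_in S f}"

definition Cc_lipschitz :: "(real ^ 'n) set \<Rightarrow> (real ^ 'n \<Rightarrow> real) set" where
  "Cc_lipschitz S = {f. (\<exists>L. L-lipschitz_on UNIV f) \<and> compact_support_in S f}"


subsection \<open>The domain and the coefficient matrix\<close>

text \<open>Near each boundary point, after choosing one coordinate \<open>i\<close> and an orientation \<open>\<sigma>\<close>, the set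
  is the region above the graph of a smooth function of the remaining \<open>n - 1\<close> coordinates;
  such a function is a function on the whole space which does not depend on the coordinate \<open>i\<close>.\<close>

definition smooth_boundary :: "(real ^ 'n) set \<Rightarrow> bool" where
  "smooth_boundary \<Omega> \<longleftrightarrow>
     (\<forall>p\<in>frontier \<Omega>. \<exists>r>0. \<exists>i. \<exists>\<sigma>\<in>{-1, 1}. \<exists>\<gamma> :: real ^ 'n \<Rightarrow> real.
        smooth_on UNIV \<gamma> \<and>
        (\<forall>x y. (\<forall>j. j \<noteq> i \<longrightarrow> x $ j = y $ j) \<longrightarrow> \<gamma> x = \<gamma> y) \<and>
        \<Omega> \<inter> ball p r = {x \<in> ball p r. \<sigma> * x $ i > \<gamma> x})"

definition smooth_bounded_domain :: "(real ^ 'n) set \<Rightarrow> bool" where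
  "smooth_bounded_domain \<Omega> \<longleftrightarrow>
     \<Omega> \<noteq> {} \<and> open \<Omega> \<and> connected \<Omega> \<and> bounded \<Omega> \<and> smooth_boundary \<Omega>"

definition normA_sq :: "(real ^ 'n \<Rightarrow> real ^ 'n ^ 'n) \<Rightarrow> real ^ 'n \<Rightarrow> real ^ 'n \<Rightarrow> real" where
  "normA_sq A x \<xi> = (A x *v \<xi>) \<bullet> \<xi>"

definition elliptic_matrix :: "(real ^ 'n) set \<Rightarrow> (real ^ 'n \<Rightarrow> real ^ 'n ^ 'n) \<Rightarrow> bool" where
  "elliptic_matrix \<Omega> A \<longleftrightarrow>
     (\<forall>x\<in>\<Omega>. transpose (A x) = A x) \<and>
     (\<exists>c>0. \<forall>x\<in>\<Omega>. \<forall>\<xi>. c * (norm \<xi>)\<^sup>2 \<le> normA_sq A x \<xi>) \<and>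
     (\<forall>i j. smooth_upto \<Omega> (closure \<Omega>) (\<lambda>x. A x $ i $ j))"


subsection \<open>Weak gradients and the Sobolev space of functions vanishing on the boundary\<close>

definition locally_integrable ::
  "(real ^ 'n) set \<Rightarrow> (real ^ 'n \<Rightarrow> 'b::{banach, second_countable_topology}) \<Rightarrow> bool" where
  "locally_integrable U f \<longleftrightarrow> (\<forall>C. compact C \<and> C \<subseteq> U \<longrightarrow> set_integrable lebesgue C f)"

definition weak_gradient ::
  "(real ^ 'n) set \<Rightarrow> (real ^ 'n \<Rightarrow> real) \<Rightarrow> (real ^ 'n \<Rightarrow> real ^ 'n) \<Rightarrow> bool" where
  "weak_gradient U u G \<longleftrightarrow> locally_integrable U u \<and> locally_integrable U G \<and>
     (\<forall>\<phi>\<in>Cc_smooth U. \<forall>i.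
        (LINT x:U|lebesgue. u x * grad \<phi> x $ i) = - (LINT x:U|lebesgue. G x $ i * \<phi> x))"

definition L2 :: "(real ^ 'n) set \<Rightarrow> (real ^ 'n \<Rightarrow> 'b::real_normed_vector) \<Rightarrow> bool" where
  "L2 U f \<longleftrightarrow> set_borel_measurable lebesgue U f \<and>
     (\<integral>\<^sup>+x\<in>U. ennreal ((norm (f x))\<^sup>2) \<partial>lebesgue) < \<infinity>"

text \<open>\<open>H\<^sub>0\<^sup>1(\<Omega>)\<close>, the closure of \<open>C\<^sub>c\<^sup>\<infinity>(\<Omega>)\<close> in \<open>H\<^sup>1(\<Omega>)\<close>.\<close>

definition H10 :: "(real ^ 'n) set \<Rightarrow> (real ^ 'n \<Rightarrow> real) set" where
  "H10 \<Omega> = {u. L2 \<Omega> u \<and> (\<exists>G. weak_gradient \<Omega> u G \<and> L2 \<Omega> G \<and>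
     (\<exists>\<phi>. (\<forall>k. \<phi> k \<in> Cc_smooth \<Omega>) \<and>
        (\<lambda>k. \<integral>\<^sup>+x\<in>\<Omega>. ennreal ((\<phi> k x - u x)\<^sup>2 + (norm (grad (\<phi> k) x - G x))\<^sup>2) \<partial>lebesgue)
          \<longlonglongrightarrow> 0))}"


subsection \<open>Hausdorff measure and box dimension\<close>

text \<open>\<open>m\<close>-dimensional Hausdorff (outer) measure for \<open>m \<ge> 1\<close>, with the normalisation that makes it
  agree with Lebesgue measure when \<open>m\<close> is the dimension of the space.  Boundedness of the covering
  sets is required since \<^const>\<open>diameter\<close> is unspecified on unbounded sets.\<close>

definition hausdorff_measure :: "nat \<Rightarrow> 'a::metric_space set \<Rightarrow> ennreal" where
  "hausdorff_measure m S = (SUP \<delta>\<in>{0<..}.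
     INF U\<in>{U :: nat \<Rightarrow> 'a set. S \<subseteq> (\<Union>i. U i) \<and> (\<forall>i. bounded (U i) \<and> diameter (U i) \<le> \<delta>)}.
       \<Sum>i. ennreal (unit_ball_vol (real m) * (diameter (U i) / 2) ^ m))"

text \<open>\<open>has_box_dim \<Omega> K d\<close>: the limit defining the box dimension of \<open>K\<close> exists and the dimension
  is \<open>d\<close>.  Only used for nonempty \<open>K\<close>.\<close>

definition has_box_dim :: "(real ^ 'n) set \<Rightarrow> (real ^ 'n) set \<Rightarrow> real \<Rightarrow> bool" where
  "has_box_dim \<Omega> K d \<longleftrightarrow>
     ((\<lambda>r. ln (enn2real (hausdorff_measure CARD('n) {x \<in> \<Omega>. infdist x K < r})) / ln r)
        \<longlongrightarrow> real CARD('n) - d) (at_right 0)"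


subsection \<open>Interior weights\<close>

text \<open>\<open>- div (A \<nabla> \<phi>)\<close>, for smooth \<open>\<phi>\<close>.\<close>

definition L_op ::
  "(real ^ 'n \<Rightarrow> real ^ 'n ^ 'n) \<Rightarrow> (real ^ 'n \<Rightarrow> real) \<Rightarrow> real ^ 'n \<Rightarrow> real" where
  "L_op A \<phi> x =
     - (\<Sum>i\<in>UNIV. frechet_derivative (\<lambda>y. (A y *v grad \<phi> y) $ i) (at x) (axis i 1))"

text \<open>\<open>- div (A \<nabla> E) = \<mu>\<close> in the sense of distributions on \<open>\<Omega>\<close>; as \<open>A\<close> is symmetric, the operator
  that falls on the test function is \<^const>\<open>L_op\<close> itself.\<close>

definition distributional_L ::
  "(real ^ 'n) set \<Rightarrow> (real ^ 'n \<Rightarrow> real ^ 'n ^ 'n) \<Rightarrow> (real ^ 'n \<Rightarrow> real)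
     \<Rightarrow> (real ^ 'n) measure \<Rightarrow> bool" where
  "distributional_L \<Omega> A E \<mu> \<longleftrightarrow> locally_integrable \<Omega> E \<and>
     (\<forall>\<phi>\<in>Cc_smooth \<Omega>. (LINT x:\<Omega>|lebesgue. E x * L_op A \<phi> x) = (LINT x|\<mu>. \<phi> x))"

definition measure_support :: "'a::topological_space measure \<Rightarrow> 'a set" where
  "measure_support \<mu> =
     {x \<in> space \<mu>. \<forall>U. open U \<and> x \<in> U \<longrightarrow> emeasure \<mu> (U \<inter> space \<mu>) > 0}"

text \<open>\<open>E\<close> is an interior weight on \<open>\<Omega>\<close>, and \<open>K\<close> is the support of the measure \<open>- div (A \<nabla> E)\<close>.
  The weight takes the value \<open>\<infinity>\<close> on \<open>K\<close>, hence is extended real valued; \<^const>\<open>real_of_ereal\<close>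
  alters it only on the null set \<open>K\<close>.\<close>

definition interior_weight ::
  "(real ^ 'n) set \<Rightarrow> (real ^ 'n \<Rightarrow> real ^ 'n ^ 'n) \<Rightarrow> (real ^ 'n \<Rightarrow> ereal)
     \<Rightarrow> (real ^ 'n) set \<Rightarrow> bool" where
  "interior_weight \<Omega> A E K \<longleftrightarrow>
     (\<forall>x\<in>\<Omega>. E x > 0) \<and>
     (\<exists>\<mu>. sets \<mu> = sets (restrict_space borel \<Omega>) \<and> finite_measure \<mu> \<and> emeasure \<mu> \<Omega> \<noteq> 0 \<and>
        distributional_L \<Omega> A (\<lambda>x. real_of_ereal (E x)) \<mu> \<and> K = measure_support \<mu>) \<and>
     compact K \<and>
     (\<forall>x\<in>closure \<Omega> - K. \<bar>E x\<bar> \<noteq> \<infinity>) \<and>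
     smooth_upto (\<Omega> - K) (closure \<Omega> - K) (\<lambda>x. real_of_ereal (E x)) \<and>
     (\<forall>x\<in>K. E x = \<infinity>) \<and>
     (\<exists>d. has_box_dim \<Omega> K d \<and> d < real CARD('n) - 2)"


subsection \<open>The weighted spaces\<close>

text \<open>The squared norm \<open>\<integral>\<^sub>\<Omega> E\<^sup>2\<^sup>t |\<nabla>u|\<^sub>A\<^sup>2\<close>, as a function of the gradient field \<open>G = \<nabla>u\<close>.\<close>

definition X_norm_sq ::
  "(real ^ 'n) set \<Rightarrow> (real ^ 'n \<Rightarrow> real ^ 'n ^ 'n) \<Rightarrow> (real ^ 'n \<Rightarrow> ereal) \<Rightarrow> real
     \<Rightarrow> (real ^ 'n \<Rightarrow> real ^ 'n) \<Rightarrow> ennreal" where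
  "X_norm_sq \<Omega> A E t G =
     (\<integral>\<^sup>+x\<in>\<Omega>. ennreal (real_of_ereal (E x) powr (2 * t) * normA_sq A x (G x)) \<partial>lebesgue)"

text \<open>The completion of the compactly supported Lipschitz functions on \<open>\<Omega> - K\<close> with respect to
  this norm, realised as a space of functions: its members are the local \<open>L\<^sup>2\<close> limits on \<open>\<Omega> - K\<close>
  of the sequences that are Cauchy for the norm.  The gradient of a member is its weak gradient
  on \<open>\<Omega> - K\<close>; it is the limit of the gradients of the approximating sequence.\<close>

definition X_space ::
  "(real ^ 'n) set \<Rightarrow> (real ^ 'n \<Rightarrow> real ^ 'n ^ 'n) \<Rightarrow> (real ^ 'n \<Rightarrow> ereal)
     \<Rightarrow> (real ^ 'n) set \<Rightarrow> real \<Rightarrow> (real ^ 'n \<Rightarrow> real) set" where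
  "X_space \<Omega> A E K t = {u. set_borel_measurable lebesgue (\<Omega> - K) u \<and>
     (\<exists>s g. (\<forall>k. s k \<in> Cc_lipschitz (\<Omega> - K) \<and> weak_gradient (\<Omega> - K) (s k) (g k)) \<and>
        (\<forall>\<epsilon>>0. \<exists>N. \<forall>j\<ge>N. \<forall>k\<ge>N. X_norm_sq \<Omega> A E t (\<lambda>x. g j x - g k x) < \<epsilon>) \<and>
        (\<forall>C. compact C \<and> C \<subseteq> \<Omega> - K \<longrightarrow>
           (\<lambda>k. \<integral>\<^sup>+x\<in>C. ennreal ((s k x - u x)\<^sup>2) \<partial>lebesgue) \<longlonglongrightarrow> 0))}"

end

theory Submission
  imports Defs "HOL-Computational_Algebra.Polynomial"
begin

text \<open>Put \<open>U = \<Omega> - K\<close>, and let \<open>|\<xi>|\<^sub>A\<close> be the norm given by \<open>A\<close>. On \<open>U\<close> the weight \<open>e\<close> is positive and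
smooth. Its distributional source \<open>\<mu>\<close> does not charge \<open>U\<close>, so \<open>div (A \<nabla> e) = 0\<close> there, which may be
tested against every \<open>C\<^sup>1\<close> function with compact support in \<open>U\<close> (\<open>weight_equation\<close>).

The core of the proof is the ground state substitution. For \<open>v\<close> of class \<open>C\<^sup>1\<close> with compact support in
\<open>U\<close>, put \<open>b = 1/2 - t\<close> and \<open>u = e\<^sup>b v\<close>. Then pointwise
\<open>e\<^sup>2\<^sup>t |\<nabla> u|\<^sub>A\<^sup>2 = e |\<nabla> v|\<^sub>A\<^sup>2 + b\<^sup>2 |\<nabla> e|\<^sub>A\<^sup>2 v\<^sup>2 / e + b (A \<nabla> e) \<bullet> \<nabla> (v\<^sup>2)\<close>.
The last term integrates to zero by the equation for \<open>e\<close>, the second one is the Hardy term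
of \<open>u\<close>, and \<open>V e\<^sup>2\<^sup>t u\<^sup>2 = V e v\<^sup>2\<close>. So the inequality at exponent \<open>t\<close> for \<open>u\<close> is the inequality at
exponent \<open>1/2\<close> for \<open>v\<close>, and on this class of functions the inequalities for all real \<open>t\<close> are
equivalent (\<open>weighted_ineq_iff\<close>). The inequality of (i) is the one with \<open>t = 0\<close>.

It remains to pass between function classes, in three steps. First, from test functions to
Lipschitz functions with a weak gradient: mollify; by Jensen's inequality for the quadratic form
the energy increases at most by a factor close to one, and Fatou's lemma handles the other side
(\<open>mollify_ineq\<close>). Second, from Lipschitz functions to the completion: the gradients converge in the weighted
norm, and the limit is the weak gradient, by uniqueness of weak gradients (\<open>completion_ineq\<close>). Third,
for \<open>t = 0\<close>, from functions supported off \<open>K\<close> to \<open>H\<^sub>0\<^sup>1(\<Omega>)\<close>: the box dimension of \<open>K\<close> is below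
\<open>n - 2\<close>, so the tube of radius \<open>r\<close> around \<open>K\<close> has volume \<open>O(r\<^sup>p)\<close> with \<open>p > 2\<close>, whereas a cut-off
at scale \<open>r\<close> has gradient \<open>O(1/r)\<close>; its energy tends to zero (\<open>lebesgue_tube_decay\<close>,
\<open>cutoff_approx\<close>, \<open>H10_ineq\<close>).

Rademacher's theorem and Lebesgue points are not used: weak gradients only enter through test
functions, and the smooth kernels come from the functions \<open>p(1/x) exp(-1/x)\<close> with \<open>p\<close> a polynomial.\<close>

section \<open>Gradients and integration by parts\<close>

lemma has_derivative_grad:
  fixes f :: "real ^ 'n \<Rightarrow> real"
  assumes "f differentiable (at x)"
  shows "(f has_derivative (\<lambda>h. grad f x \<bullet> h)) (at x)"
proof -
  have D: "(f has_derivative frechet_derivative f (at x)) (at x)"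
    using assms by (simp add: frechet_derivative_works)
  then have lin: "linear (frechet_derivative f (at x))"
    by (rule has_derivative_linear)
  have "frechet_derivative f (at x) h = grad f x \<bullet> h" for h
  proof -
    have "frechet_derivative f (at x) h = frechet_derivative f (at x) (\<Sum>i\<in>UNIV. (h $ i) *\<^sub>R axis i 1)"
      by (simp add: basis_expansion scalar_mult_eq_scaleR[symmetric])
    also have "\<dots> = (\<Sum>i\<in>UNIV. h $ i * frechet_derivative f (at x) (axis i 1))"
      by (simp add: linear_sum[OF lin] linear_scale[OF lin])
    also have "\<dots> = grad f x \<bullet> h"
      by (simp add: grad_def inner_vec_def mult.commute)
    finally show ?thesis .
  qed
  then have "frechet_derivative f (at x) = (\<lambda>h. grad f x \<bullet> h)" by auto
  then show ?thesis using D by simp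
qed

lemma grad_eqI:
  fixes f :: "real ^ 'n \<Rightarrow> real"
  assumes "(f has_derivative (\<lambda>h. g \<bullet> h)) (at x)"
  shows "grad f x = g"
proof -
  have "frechet_derivative f (at x) = (\<lambda>h. g \<bullet> h)"
    using frechet_derivative_at[OF assms] by simp
  then show ?thesis by (simp add: grad_def vec_eq_iff inner_axis)
qed

lemma has_derivative_imp_differentiable:
  "(f has_derivative D) (at x) \<Longrightarrow> f differentiable (at x)"
  by (auto simp: differentiable_def)

lemma grad_cong_open:
  fixes f g :: "real ^ 'n \<Rightarrow> real"
  assumes "open S" "x \<in> S" "\<And>y. y \<in> S \<Longrightarrow> f y = g y" "f differentiable (at x)"
  shows "g differentiable (at x)" "grad g x = grad f x"
proof -
  have "(g has_derivative (\<lambda>h. grad f x \<bullet> h)) (at x)"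
    using has_derivative_transform_within_open[OF has_derivative_grad[OF assms(4)] assms(1-3)] .
  then show "g differentiable (at x)" "grad g x = grad f x"
    by (auto intro: grad_eqI has_derivative_imp_differentiable)
qed

lemma
  fixes f g :: "real ^ 'n \<Rightarrow> real"
  assumes "f differentiable (at x)" "g differentiable (at x)"
  shows grad_add: "grad (\<lambda>y. f y + g y) x = grad f x + grad g x"
    and grad_mult: "grad (\<lambda>y. f y * g y) x = f x *\<^sub>R grad g x + g x *\<^sub>R grad f x"
  by (rule grad_eqI; use assms in
      \<open>auto intro!: derivative_eq_intros has_derivative_grad simp: inner_add_left algebra_simps fun_eq_iff\<close>)+

lemma grad_const [simp]: "grad (\<lambda>y. c) x = 0"
  by (rule grad_eqI) simp

lemma grad_powr:
  fixes f :: "real ^ 'n \<Rightarrow> real"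
  assumes "f differentiable (at x)" "f x > 0"
  shows "(\<lambda>y. f y powr b) differentiable (at x)"
    "grad (\<lambda>y. f y powr b) x = (b * f x powr (b - 1)) *\<^sub>R grad f x"
proof -
  have "((\<lambda>y. f y powr b) has_derivative (\<lambda>h. ((b * f x powr (b - 1)) *\<^sub>R grad f x) \<bullet> h)) (at x)"
    using assms(2)
    by (auto intro!: derivative_eq_intros has_derivative_grad[OF assms(1)]
        simp: fun_eq_iff powr_diff field_simps)
  then show "(\<lambda>y. f y powr b) differentiable (at x)"
    "grad (\<lambda>y. f y powr b) x = (b * f x powr (b - 1)) *\<^sub>R grad f x"
    by (auto intro: grad_eqI has_derivative_imp_differentiable)
qed

text \<open>Continuously differentiable functions on a set; for a set that is not open, differentiability is
still required in a full neighbourhood of each point.\<close>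

definition C1_on :: "(real ^ 'n) set \<Rightarrow> (real ^ 'n \<Rightarrow> real) \<Rightarrow> bool" where
  "C1_on U f \<longleftrightarrow> (\<forall>x\<in>U. f differentiable (at x)) \<and> continuous_on U (grad f)"

text \<open>Continuously differentiable functions with compact support in \<open>U\<close>, extended by zero to the
whole space.\<close>

definition C1c :: "(real ^ 'n) set \<Rightarrow> (real ^ 'n \<Rightarrow> real) set" where
  "C1c U = {f. C1_on UNIV f \<and> compact_support_in U f}"

lemma C1_on_continuous: "C1_on U f \<Longrightarrow> continuous_on U f"
  unfolding C1_on_def
  by (meson continuous_at_imp_continuous_on differentiable_imp_continuous_within)

lemma C1_on_subset: "C1_on U f \<Longrightarrow> V \<subseteq> U \<Longrightarrow> C1_on V f"
  unfolding C1_on_def by (meson continuous_on_subset subsetD)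

lemma smooth_on_pderiv:
  fixes f :: "'a::euclidean_space \<Rightarrow> 'b::real_normed_vector"
  assumes "smooth_on U f" "v \<in> Basis"
  shows "smooth_on U (\<lambda>x. frechet_derivative f (at x) v)"
  unfolding smooth_on_def
proof (intro ballI)
  fix vs :: "'a list" and x assume "vs \<in> lists Basis" "x \<in> U"
  then show "iterated_pderiv vs (\<lambda>x. frechet_derivative f (at x) v) differentiable (at x)"
    using assms unfolding smooth_on_def by (force dest: bspec[where x="v # vs"])
qed

lemma smooth_on_differentiable: "smooth_on U f \<Longrightarrow> x \<in> U \<Longrightarrow> f differentiable (at x)"
  unfolding smooth_on_def by (force dest: bspec[where x="[]"])

lemma smooth_on_grad: "smooth_on U f \<Longrightarrow> smooth_on U (\<lambda>x. grad f x $ i)"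
  using smooth_on_pderiv[of U f "axis i 1"] by (auto simp: grad_def Basis_vec_def)

lemma smooth_on_imp_continuous_on: "smooth_on U f \<Longrightarrow> continuous_on U f"
  by (meson continuous_at_imp_continuous_on differentiable_imp_continuous_within smooth_on_differentiable)

lemma smooth_on_imp_C1_on:
  assumes "smooth_on U f"
  shows "C1_on U f"
proof -
  have "continuous_on U (\<lambda>x. \<chi> i. grad f x $ i)"
    by (intro continuous_on_vec_lambda smooth_on_imp_continuous_on smooth_on_grad assms)
  then show ?thesis using smooth_on_differentiable[OF assms] by (simp add: C1_on_def)
qed

lemma Cc_smooth_subset_C1c: "Cc_smooth U \<subseteq> C1c U"
  by (auto simp: Cc_smooth_def C1c_def smooth_on_imp_C1_on)

lemma C1_on_powr:
  assumes "C1_on U f" "\<And>x. x \<in> U \<Longrightarrow> f x > 0"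
  shows "C1_on U (\<lambda>x. f x powr b)"
proof -
  have nz: "f x \<noteq> 0" if "x \<in> U" for x using assms(2)[OF that] by simp
  have "continuous_on U (\<lambda>x. (b * f x powr (b - 1)) *\<^sub>R grad f x)"
    using assms C1_on_continuous[OF assms(1)]
    by (intro continuous_intros ballI) (auto simp: C1_on_def nz)
  moreover have "grad (\<lambda>x. f x powr b) x = (b * f x powr (b - 1)) *\<^sub>R grad f x" if "x \<in> U" for x
    by (rule grad_powr(2)) (use assms that in \<open>auto simp: C1_on_def\<close>)
  ultimately have "continuous_on U (grad (\<lambda>x. f x powr b))"
    by (simp cong: continuous_on_cong)
  moreover have "(\<lambda>x. f x powr b) differentiable (at x)" if "x \<in> U" for x
    by (rule grad_powr(1)) (use assms that in \<open>auto simp: C1_on_def\<close>)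
  ultimately show ?thesis by (simp add: C1_on_def)
qed

lemma C1_on_mult:
  assumes "C1_on U f" "C1_on U g"
  shows "C1_on U (\<lambda>x. f x * g x)"
proof -
  have "continuous_on U (\<lambda>x. f x *\<^sub>R grad g x + g x *\<^sub>R grad f x)"
    using assms C1_on_continuous[OF assms(1)] C1_on_continuous[OF assms(2)]
    by (intro continuous_intros) (auto simp: C1_on_def)
  moreover have "grad (\<lambda>x. f x * g x) x = f x *\<^sub>R grad g x + g x *\<^sub>R grad f x" if "x \<in> U" for x
    by (rule grad_mult) (use assms that in \<open>auto simp: C1_on_def\<close>)
  ultimately have "continuous_on U (grad (\<lambda>x. f x * g x))"
    by (simp cong: continuous_on_cong)
  then show ?thesis using assms by (auto simp: C1_on_def intro: differentiable_mult)
qed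

lemma C1cD:
  assumes "f \<in> C1c U"
  shows "f differentiable (at x)" "continuous_on UNIV (grad f)" "continuous_on UNIV f"
    "compact_support_in U f"
  using assms C1_on_continuous[of UNIV f] by (auto simp: C1c_def C1_on_def)

lemma grad_eq_0_outside:
  fixes f :: "real ^ 'n \<Rightarrow> real"
  assumes "closed C" "\<And>x. x \<notin> C \<Longrightarrow> f x = 0" "x \<notin> C"
  shows "grad f x = 0" "f differentiable (at x)"
  using grad_cong_open[of "- C" x "\<lambda>_. 0" f] assms by auto

text \<open>The factor \<open>g\<close> only has to be continuously differentiable on \<open>U\<close>: outside the support of \<open>f\<close> the
product vanishes whatever the values of \<open>g\<close> are.\<close>

lemma C1c_mult:
  assumes U: "open U" and f: "f \<in> C1c U" and g: "C1_on U g"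
  shows "(\<lambda>x. f x * g x) \<in> C1c U"
    "x \<in> U \<Longrightarrow> grad (\<lambda>x. f x * g x) x = f x *\<^sub>R grad g x + g x *\<^sub>R grad f x"
proof -
  obtain C where C: "compact C" "C \<subseteq> U" "\<And>x. x \<notin> C \<Longrightarrow> f x = 0"
    using C1cD(4)[OF f] by (auto simp: compact_support_in_def)
  have clC: "closed C" using C by (simp add: compact_imp_closed)
  have on_U: "C1_on U (\<lambda>x. f x * g x)"
    using f g by (intro C1_on_mult) (auto simp: C1c_def intro: C1_on_subset)
  have off: "grad (\<lambda>x. f x * g x) x = 0" "(\<lambda>x. f x * g x) differentiable (at x)" if "x \<notin> C" for x
    using grad_eq_0_outside[OF clC _ that, of "\<lambda>x. f x * g x"] C by auto
  have "continuous_on (U \<union> - C) (grad (\<lambda>x. f x * g x))"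
  proof (rule continuous_on_open_Un)
    show "continuous_on (- C) (grad (\<lambda>x. f x * g x))"
      using continuous_on_cong[of "- C" "- C" "grad (\<lambda>x. f x * g x)" "\<lambda>_. 0"] off by auto
  qed (use U clC on_U in \<open>auto simp: C1_on_def\<close>)
  moreover have "U \<union> - C = UNIV" using C by auto
  ultimately have "C1_on UNIV (\<lambda>x. f x * g x)"
    using off on_U unfolding C1_on_def by auto
  then show "(\<lambda>x. f x * g x) \<in> C1c U"
    using C by (auto simp: C1c_def compact_support_in_def)
  show "x \<in> U \<Longrightarrow> grad (\<lambda>x. f x * g x) x = f x *\<^sub>R grad g x + g x *\<^sub>R grad f x"
    by (rule grad_mult) (use f g in \<open>auto simp: C1c_def C1_on_def\<close>)
qed

lemma C1c_bounded_grad: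
  assumes "f \<in> C1c U"
  obtains B where "\<And>x. norm (grad f x) \<le> B" "B \<ge> 0"
proof -
  obtain C where C: "compact C" "\<And>x. x \<notin> C \<Longrightarrow> f x = 0"
    using C1cD(4)[OF assms] by (auto simp: compact_support_in_def)
  have "compact (grad f ` C)"
    using C1cD(2)[OF assms] C(1) by (meson compact_continuous_image continuous_on_subset top_greatest)
  then obtain B where B: "B > 0" "\<And>x. x \<in> C \<Longrightarrow> norm (grad f x) \<le> B"
    by (metis bounded_pos compact_imp_bounded imageI)
  then have "norm (grad f x) \<le> B" for x
    using grad_eq_0_outside[of C f x] C by (cases "x \<in> C") (auto simp: compact_imp_closed)
  then show ?thesis using that[of B] B by auto
qed

lemma lipschitz_of_bounded_grad:
  fixes f :: "real ^ 'n \<Rightarrow> real"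
  assumes "\<And>x. f differentiable (at x)" "\<And>x. norm (grad f x) \<le> B" "B \<ge> 0"
  shows "B-lipschitz_on UNIV f"
proof (rule lipschitz_onI)
  fix x y
  have "norm (f x - f y) \<le> B * norm (x - y)"
  proof (rule differentiable_bound[of UNIV f "\<lambda>x h. grad f x \<bullet> h"])
    fix x show "(f has_derivative (\<lambda>h. grad f x \<bullet> h)) (at x within UNIV)"
      using has_derivative_grad assms by auto
    show "onorm (\<lambda>h. grad f x \<bullet> h) \<le> B"
      by (rule onorm_bound) (use assms in \<open>auto intro: order_trans[OF Cauchy_Schwarz_ineq2 mult_right_mono]\<close>)
  qed auto
  then show "dist (f x) (f y) \<le> B * dist x y" by (simp add: dist_norm)
qed (use assms in auto)

lemma C1c_lipschitz:
  assumes "f \<in> C1c U"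
  shows "f \<in> Cc_lipschitz U"
proof -
  obtain B where "\<And>x. norm (grad f x) \<le> B" "B \<ge> 0"
    using C1c_bounded_grad[OF assms] by blast
  then have "B-lipschitz_on UNIV f" using lipschitz_of_bounded_grad C1cD(1)[OF assms] by blast
  then show ?thesis using C1cD(4)[OF assms] by (auto simp: Cc_lipschitz_def)
qed

lemma set_lebesgue_integral_eq_of_vanishing:
  fixes f :: "'a::euclidean_space \<Rightarrow> 'b::{banach, second_countable_topology}"
  assumes "\<And>x. x \<notin> U \<Longrightarrow> f x = 0"
  shows "(LINT x:U|lebesgue. f x) = (LINT x|lebesgue. f x)"
  unfolding set_lebesgue_integral_def
  by (rule Bochner_Integration.integral_cong) (use assms in \<open>auto simp: indicator_def\<close>)

lemma set_integral_lebesgue_eq_lborel: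
  fixes f :: "'a::euclidean_space \<Rightarrow> 'b::{banach, second_countable_topology}"
  assumes "integrable lborel f" "\<And>x. x \<notin> U \<Longrightarrow> f x = 0"
  shows "(LINT x:U|lebesgue. f x) = (LINT x|lborel. f x)"
  using set_lebesgue_integral_eq_of_vanishing[of U f, OF assms(2)] assms(1)
  by (simp add: integral_completion borel_measurable_integrable)

lemma integrable_continuous_compact_support:
  fixes f :: "real ^ 'n \<Rightarrow> 'b::{banach, second_countable_topology}"
  assumes "continuous_on U f" "compact C" "C \<subseteq> U" "\<And>x. x \<notin> C \<Longrightarrow> f x = 0"
  shows "integrable lborel f"
proof -
  have "integrable lborel (\<lambda>x. indicator C x *\<^sub>R f x)"
    by (rule borel_integrable_compact) (use assms continuous_on_subset in auto)
  also have "(\<lambda>x. indicator C x *\<^sub>R f x) = f" using assms by (auto simp: indicator_def)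
  finally show ?thesis .
qed

lemma integral_lborel_translate:
  fixes f :: "real ^ 'n \<Rightarrow> real"
  assumes "integrable lborel f"
  shows "integrable lborel (\<lambda>x. f (a + x))" "(LINT x|lborel. f (a + x)) = (LINT x|lborel. f x)"
proof -
  have "distr lborel borel ((+) a) = (lborel :: (real^'n) measure)" by (rule lborel_distr_plus)
  then have *: "integrable (distr lborel borel ((+) a)) f" "integral\<^sup>L (distr lborel borel ((+) a)) f = integral\<^sup>L lborel f"
    using assms by simp_all
  have m: "f \<in> borel_measurable borel" using assms by (auto dest: borel_measurable_integrable)
  show "integrable lborel (\<lambda>x. f (a + x))"
    using *(1) m by (subst (asm) integrable_distr_eq) auto
  show "(LINT x|lborel. f (a + x)) = (LINT x|lborel. f x)"
    using *(2) m by (subst (asm) integral_distr) auto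
qed

text \<open>The integral of a difference quotient vanishes by translation invariance of Lebesgue measure, and
the difference quotients converge boundedly to the partial derivative.\<close>

lemma integral_grad_C1c:
  fixes f :: "real ^ 'n \<Rightarrow> real"
  assumes "f \<in> C1c U"
  shows "(LINT x|lborel. grad f x $ i) = 0"
proof -
  obtain C where C: "compact C" "C \<subseteq> U" "\<And>x. x \<notin> C \<Longrightarrow> f x = 0"
    using C1cD(4)[OF assms] by (auto simp: compact_support_in_def)
  obtain B where B: "\<And>x. norm (grad f x) \<le> B" "B \<ge> 0"
    using C1c_bounded_grad[OF assms] by blast
  have lip: "B-lipschitz_on UNIV f" using lipschitz_of_bounded_grad B C1cD[OF assms] by auto
  have intf: "integrable lborel f"
    by (rule integrable_continuous_compact_support[of UNIV f C]) (use C C1cD[OF assms] in auto)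
  obtain r where r: "C \<subseteq> cball 0 r"
    using C(1) by (metis bounded_iff compact_imp_bounded mem_cball_0 subsetI)
  define h where "h k = inverse (real (Suc k))" for k
  have hpos: "h k > 0" "h k \<le> 1" for k by (auto simp: h_def inverse_le_1_iff)
  have h0: "h \<longlonglongrightarrow> 0" unfolding h_def by (rule LIMSEQ_inverse_real_of_nat)
  define q where "q k x = (f (x + h k *\<^sub>R axis i 1) - f x) / h k" for k x
  have shift: "integrable lborel (\<lambda>x. f (x + a))" "(LINT x|lborel. f (x + a)) = (LINT x|lborel. f x)"
    for a :: "real ^ 'n"
    using integral_lborel_translate[OF intf, of a] by (simp_all add: add.commute)
  have q0: "(LINT x|lborel. q k x) = 0" for k
    unfolding q_def using shift[of "h k *\<^sub>R axis i 1"] intf by simp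
  have "(\<lambda>k. LINT x|lborel. q k x) \<longlonglongrightarrow> (LINT x|lborel. grad f x $ i)"
  proof (rule integral_dominated_convergence[where w="\<lambda>x. indicator (cball 0 (r + 1)) x *\<^sub>R B"])
    have [measurable]: "f \<in> borel_measurable borel"
      using C1cD(3)[OF assms] by (rule borel_measurable_continuous_onI)
    show "q k \<in> borel_measurable lborel" for k
      unfolding q_def by measurable
    show "(\<lambda>x. grad f x $ i) \<in> borel_measurable lborel"
      using C1cD(2)[OF assms] by (auto intro!: borel_measurable_continuous_onI continuous_intros)
    show "integrable lborel (\<lambda>x. indicator (cball 0 (r + 1)) x *\<^sub>R B)"
      by (rule borel_integrable_compact) auto
    show "AE x in lborel. (\<lambda>k. q k x) \<longlonglongrightarrow> grad f x $ i"
    proof (rule AE_I2)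
      fix x
      have "((\<lambda>s. f (x + s *\<^sub>R axis i 1)) has_derivative (\<lambda>s. grad f x \<bullet> (s *\<^sub>R axis i 1))) (at 0)"
      proof (rule has_derivative_compose[of _ "\<lambda>s. s *\<^sub>R axis i 1" 0 UNIV f])
        show "((\<lambda>s. x + s *\<^sub>R axis i 1) has_derivative (\<lambda>s. s *\<^sub>R axis i 1)) (at 0)"
          by (auto intro!: derivative_eq_intros)
        show "(f has_derivative (\<lambda>h. grad f x \<bullet> h)) (at (x + 0 *\<^sub>R axis i 1))"
          using has_derivative_grad[OF C1cD(1)[OF assms]] by simp
      qed
      then have "((\<lambda>s. f (x + s *\<^sub>R axis i 1)) has_field_derivative (grad f x $ i)) (at 0)"
        by (simp add: has_field_derivative_def inner_axis mult_commute_abs)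
      then have "(\<lambda>s. (f (x + s *\<^sub>R axis i 1) - f x) / s) \<midarrow>0\<rightarrow> grad f x $ i"
        by (simp add: DERIV_def)
      moreover have "filterlim h (at 0) sequentially"
        using h0 hpos by (simp add: filterlim_at less_imp_neq[symmetric])
      ultimately show "(\<lambda>k. q k x) \<longlonglongrightarrow> grad f x $ i"
        unfolding q_def by (rule filterlim_compose)
    qed
    show "AE x in lborel. norm (q k x) \<le> indicator (cball 0 (r + 1)) x *\<^sub>R B" for k
    proof (rule AE_I2)
      fix x :: "real^'n"
      show "norm (q k x) \<le> indicator (cball 0 (r + 1)) x *\<^sub>R B"
      proof (cases "norm x \<le> r + 1")
        case True
        have "\<bar>f (x + h k *\<^sub>R axis i 1) - f x\<bar> \<le> B * h k"
          using lipschitz_onD[OF lip, of "x + h k *\<^sub>R axis i 1" x] hpos[of k]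
          by (simp add: dist_norm)
        then show ?thesis using True hpos[of k] by (simp add: q_def pos_divide_le_eq)
      next
        case False
        have "norm (x + h k *\<^sub>R axis i 1) \<ge> norm x - norm (h k *\<^sub>R (axis i 1 :: real^'n))"
          using norm_triangle_ineq2[of x "- (h k *\<^sub>R axis i 1)"] by simp
        then have "norm (x + h k *\<^sub>R axis i 1) > r" using False hpos[of k] by simp
        then have "f (x + h k *\<^sub>R axis i 1) = 0" "f x = 0" using C r False by (force simp: subset_eq)+
        then show ?thesis using False by (simp add: q_def)
      qed
    qed
  qed
  then show ?thesis unfolding q0 by (simp add: LIMSEQ_const_iff)
qed

lemma integral_by_parts_C1c:
  assumes U: "open U" and f: "f \<in> C1c U" and g: "C1_on U g"
  shows "(LINT x:U|lebesgue. g x * grad f x $ i) = - (LINT x:U|lebesgue. grad g x $ i * f x)"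
proof -
  obtain C where C: "compact C" "C \<subseteq> U" "\<And>x. x \<notin> C \<Longrightarrow> f x = 0"
    using C1cD(4)[OF f] by (auto simp: compact_support_in_def)
  have clC: "closed C" using C by (simp add: compact_imp_closed)
  have gf: "grad f x = 0" if "x \<notin> C" for x using grad_eq_0_outside(1)[OF clC C(3)] that by auto
  have cont: "continuous_on U (grad f)" "continuous_on U f" "continuous_on U (grad g)" "continuous_on U g"
    using C1cD[OF f] g C1_on_continuous[OF g] by (auto simp: C1_on_def intro: continuous_on_subset)
  have 1: "integrable lborel (\<lambda>x. g x * grad f x $ i)"
    by (rule integrable_continuous_compact_support[of U _ C])
      (use C gf cont in \<open>auto intro!: continuous_intros\<close>)
  have 2: "integrable lborel (\<lambda>x. grad g x $ i * f x)"
    by (rule integrable_continuous_compact_support[of U _ C])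
      (use C gf cont in \<open>auto intro!: continuous_intros\<close>)
  have "grad (\<lambda>x. f x * g x) x $ i = g x * grad f x $ i + grad g x $ i * f x" for x
  proof (cases "x \<in> U")
    case True
    then show ?thesis using C1c_mult(2)[OF U f g True] by simp
  next
    case False
    then have "x \<notin> C" using C by auto
    then show ?thesis using grad_eq_0_outside(1)[OF clC _ \<open>x \<notin> C\<close>, of "\<lambda>x. f x * g x"] C(3) gf by simp
  qed
  then have "0 = (LINT x|lborel. g x * grad f x $ i + grad g x $ i * f x)"
    using integral_grad_C1c[OF C1c_mult(1)[OF U f g], of i] by simp
  also have "\<dots> = (LINT x|lborel. g x * grad f x $ i) + (LINT x|lborel. grad g x $ i * f x)"
    by (rule Bochner_Integration.integral_add[OF 1 2])
  finally have "(LINT x|lborel. g x * grad f x $ i) = - (LINT x|lborel. grad g x $ i * f x)" by simp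
  moreover have "(LINT x:U|lebesgue. g x * grad f x $ i) = (LINT x|lborel. g x * grad f x $ i)"
    by (rule set_integral_lebesgue_eq_lborel[OF 1]) (use C gf in force)
  moreover have "(LINT x:U|lebesgue. grad g x $ i * f x) = (LINT x|lborel. grad g x $ i * f x)"
    by (rule set_integral_lebesgue_eq_lborel[OF 2]) (use C in force)
  ultimately show ?thesis by simp
qed

lemma locally_integrable_continuous:
  assumes "continuous_on U f"
  shows "locally_integrable U f"
  unfolding locally_integrable_def set_integrable_def
proof (intro allI impI)
  fix C assume "compact C \<and> C \<subseteq> U"
  then have "integrable lborel (\<lambda>x. indicator C x *\<^sub>R f x)"
    using borel_integrable_compact[of C f] continuous_on_subset[OF assms] by auto
  then show "integrable lebesgue (\<lambda>x. indicator C x *\<^sub>R f x)"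
    by (simp add: integrable_completion borel_measurable_integrable)
qed

lemma weak_gradient_C1_on:
  assumes U: "open U" and g: "C1_on U g"
  shows "weak_gradient U g (grad g)"
  unfolding weak_gradient_def
proof (intro conjI ballI allI)
  show "locally_integrable U g" "locally_integrable U (grad g)"
    using g C1_on_continuous[OF g] by (auto intro: locally_integrable_continuous simp: C1_on_def)
next
  fix \<phi> i assume "\<phi> \<in> Cc_smooth U"
  then have "\<phi> \<in> C1c U" using Cc_smooth_subset_C1c by auto
  then show "(LINT x:U|lebesgue. g x * grad \<phi> x $ i) = - (LINT x:U|lebesgue. grad g x $ i * \<phi> x)"
    by (rule integral_by_parts_C1c[OF U _ g])
qed

section \<open>Mollifiers\<close>

text \<open>The functions \<open>p(1/x) exp(-1/x)\<close>, extended by zero to \<open>x \<le> 0\<close>. As \<open>p\<close> ranges over all real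
polynomials they form a class which is closed under differentiation.\<close>

definition flat_exp :: "real poly \<Rightarrow> real \<Rightarrow> real" where
  "flat_exp p x = (if x > 0 then poly p (1 / x) * exp (- (1 / x)) else 0)"

lemma poly_le_exp:
  fixes p :: "real poly"
  assumes "s > 0"
  shows "\<exists>B. \<forall>y\<ge>0. \<bar>poly p y\<bar> \<le> B * exp (s * y)"
  using assms
proof (induction p arbitrary: s)
  case 0
  then show ?case by (intro exI[of _ 0]) simp
next
  case (pCons a p)
  then obtain B where B: "\<And>y. y \<ge> 0 \<Longrightarrow> \<bar>poly p y\<bar> \<le> B * exp (s / 2 * y)"
    by (meson half_gt_zero)
  have "\<bar>poly (pCons a p) y\<bar> \<le> (\<bar>a\<bar> + 2 / s * B) * exp (s * y)" if y: "y \<ge> 0" for y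
  proof -
    have "s / 2 * y \<le> exp (s / 2 * y)" using exp_ge_add_one_self[of "s / 2 * y"] by linarith
    then have "y \<le> 2 / s * exp (s / 2 * y)" using pCons.prems by (simp add: field_simps)
    then have "y * \<bar>poly p y\<bar> \<le> 2 / s * exp (s / 2 * y) * (B * exp (s / 2 * y))"
      using B[OF y] y pCons.prems by (intro mult_mono) auto
    also have "\<dots> = 2 / s * B * exp (s * y)"
      by (simp add: exp_add[symmetric] field_simps)
    finally have 1: "y * \<bar>poly p y\<bar> \<le> 2 / s * B * exp (s * y)" .
    have "\<bar>a\<bar> * 1 \<le> \<bar>a\<bar> * exp (s * y)"
      using y pCons.prems by (intro mult_left_mono) auto
    moreover have "\<bar>poly (pCons a p) y\<bar> \<le> \<bar>a\<bar> + y * \<bar>poly p y\<bar>"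
      using y abs_triangle_ineq[of a "y * poly p y"] by (simp add: abs_mult)
    ultimately show ?thesis using 1 by (simp add: distrib_right)
  qed
  then show ?case by blast
qed

lemma flat_exp_bounded: "\<exists>B. \<forall>x. \<bar>flat_exp p x\<bar> \<le> B"
proof -
  obtain B where B: "\<And>y. y \<ge> 0 \<Longrightarrow> \<bar>poly p y\<bar> \<le> B * exp y"
    using poly_le_exp[of 1 p] by auto
  have "B \<ge> 0" using B[of 0] by auto
  moreover have "\<bar>flat_exp p x\<bar> \<le> B" if "x > 0" for x
    using B[of "1 / x"] that by (simp add: flat_exp_def abs_mult exp_minus field_simps)
  ultimately have "\<bar>flat_exp p x\<bar> \<le> B" for x by (cases "x > 0") (auto simp: flat_exp_def)
  then show ?thesis by blast
qed

lemma flat_exp_pCons_0: "h > 0 \<Longrightarrow> flat_exp (pCons 0 p) h = flat_exp p h / h"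
  by (simp add: flat_exp_def)

text \<open>Multiplying \<open>p\<close> by the variable divides the function by \<open>x\<close>, so boundedness of the class also gives
decay at the origin.\<close>

lemma flat_exp_le_linear: "\<exists>B. \<forall>x. \<bar>flat_exp p x\<bar> \<le> B * \<bar>x\<bar>"
proof -
  obtain B where B: "\<And>x. \<bar>flat_exp (pCons 0 p) x\<bar> \<le> B" using flat_exp_bounded by blast
  have "B \<ge> 0" using B[of 0] by auto
  have "\<bar>flat_exp p x\<bar> \<le> B * \<bar>x\<bar>" for x
  proof (cases "x > 0")
    case True
    then show ?thesis using B[of x] by (simp add: flat_exp_pCons_0 abs_divide pos_divide_le_eq)
  next
    case False
    moreover have "0 \<le> B * \<bar>x\<bar>" using \<open>B \<ge> 0\<close> by (rule mult_nonneg_nonneg) simp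
    ultimately show ?thesis by (simp only: flat_exp_def if_False abs_zero)
  qed
  then show ?thesis by blast
qed

lemma flat_exp_has_derivative:
  "(flat_exp p has_real_derivative flat_exp (pCons 0 (pCons 0 (p - pderiv p))) x) (at x)"
proof -
  consider "x > 0" | "x < 0" | "x = 0" by linarith
  then show ?thesis
  proof cases
    case 1
    have "((\<lambda>x. poly p (1 / x) * exp (- (1 / x))) has_real_derivative
        flat_exp (pCons 0 (pCons 0 (p - pderiv p))) x) (at x)"
      using 1 by (auto intro!: derivative_eq_intros DERIV_chain2[OF poly_DERIV]
          simp: flat_exp_def field_simps power2_eq_square)
    then show ?thesis
      by (rule has_field_derivative_transform_within_open[of _ _ _ "{0<..}"])
        (use 1 in \<open>auto simp: flat_exp_def\<close>)
  next
    case 2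
    have "((\<lambda>x. 0) has_real_derivative flat_exp (pCons 0 (pCons 0 (p - pderiv p))) x) (at x)"
      using 2 by (auto simp: flat_exp_def)
    then show ?thesis
      by (rule has_field_derivative_transform_within_open[of _ _ _ "{..<0}"])
        (use 2 in \<open>auto simp: flat_exp_def\<close>)
  next
    case 3
    obtain B where B: "\<And>x. \<bar>flat_exp (pCons 0 p) x\<bar> \<le> B * \<bar>x\<bar>" using flat_exp_le_linear by blast
    have "(\<lambda>h. flat_exp (pCons 0 p) h) \<midarrow>0\<rightarrow> 0"
    proof (rule Lim_null_comparison)
      show "\<forall>\<^sub>F x in at 0. norm (flat_exp (pCons 0 p) x) \<le> B * \<bar>x\<bar>" using B by simp
      show "(\<lambda>x. B * \<bar>x\<bar>) \<midarrow>0\<rightarrow> 0" by (auto intro!: tendsto_eq_intros)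
    qed
    moreover have "flat_exp (pCons 0 p) h = (flat_exp p (0 + h) - flat_exp p 0) / h" for h
      by (cases "h > 0") (auto simp: flat_exp_def)
    ultimately have "(\<lambda>h. (flat_exp p (0 + h) - flat_exp p 0) / h) \<midarrow>0\<rightarrow> 0" by simp
    then show ?thesis using 3 by (simp add: DERIV_def flat_exp_def)
  qed
qed

lemma flat_exp_1_nonneg: "flat_exp 1 x \<ge> 0" and flat_exp_1_pos: "x > 0 \<Longrightarrow> flat_exp 1 x > 0"
  by (auto simp: flat_exp_def)

lemma flat_exp_nonpos: "x \<le> 0 \<Longrightarrow> flat_exp p x = 0"
  by (simp add: flat_exp_def)

text \<open>A class of functions on Euclidean space which is closed under partial derivatives and consists of
bounded functions. All its members are therefore smooth, with bounded derivatives of all orders;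
it is an algebra that contains nonzero functions with compact support.\<close>

inductive_set bump_class :: "(real ^ 'n \<Rightarrow> real) set" where
  bump_class_flat_exp: "(\<lambda>x. flat_exp p (a + b * x $ i)) \<in> bump_class"
| bump_class_const: "(\<lambda>x. c) \<in> bump_class"
| bump_class_add: "f \<in> bump_class \<Longrightarrow> g \<in> bump_class \<Longrightarrow> (\<lambda>x. f x + g x) \<in> bump_class"
| bump_class_mult: "f \<in> bump_class \<Longrightarrow> g \<in> bump_class \<Longrightarrow> (\<lambda>x. f x * g x) \<in> bump_class"

lemma grad_flat_exp:
  fixes x :: "real ^ 'n"
  defines "q \<equiv> \<lambda>p. pCons 0 (pCons 0 (p - pderiv p))"
  shows "(\<lambda>x :: real ^ 'n. flat_exp p (a + b * x $ i)) differentiable (at x)"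
    "grad (\<lambda>x :: real ^ 'n. flat_exp p (a + b * x $ i)) x = (b * flat_exp (q p) (a + b * x $ i)) *\<^sub>R axis i 1"
proof -
  have 1: "((\<lambda>x :: real ^ 'n. a + b * x $ i) has_derivative (\<lambda>h. b * h $ i)) (at x)"
    by (auto intro!: derivative_eq_intros bounded_linear_imp_has_derivative bounded_linear_vec_nth)
  have 2: "(flat_exp p has_derivative (\<lambda>h. flat_exp (q p) (a + b * x $ i) * h)) (at (a + b * x $ i))"
    using flat_exp_has_derivative[of p "a + b * x $ i"] by (simp add: has_field_derivative_def q_def)
  have "((\<lambda>x :: real ^ 'n. flat_exp p (a + b * x $ i)) has_derivative
      (\<lambda>h. ((b * flat_exp (q p) (a + b * x $ i)) *\<^sub>R axis i 1) \<bullet> h)) (at x)"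
    using has_derivative_compose[OF 1 2] by (simp add: inner_axis' mult_ac)
  then show "(\<lambda>x :: real ^ 'n. flat_exp p (a + b * x $ i)) differentiable (at x)"
    "grad (\<lambda>x :: real ^ 'n. flat_exp p (a + b * x $ i)) x = (b * flat_exp (q p) (a + b * x $ i)) *\<^sub>R axis i 1"
    by (auto intro: grad_eqI has_derivative_imp_differentiable)
qed

lemma bump_class_bounded: "f \<in> bump_class \<Longrightarrow> \<exists>B. \<forall>x. \<bar>f x\<bar> \<le> B"
proof (induction rule: bump_class.induct)
  case (bump_class_flat_exp p a b i)
  then show ?case using flat_exp_bounded[of p] by auto
next
  case (bump_class_add f g)
  then obtain B C where "\<And>x. \<bar>f x\<bar> \<le> B" "\<And>x. \<bar>g x\<bar> \<le> C" by blast
  then have "\<bar>f x + g x\<bar> \<le> B + C" for x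
    by (meson abs_triangle_ineq add_mono order_trans)
  then show ?case by blast
next
  case (bump_class_mult f g)
  then obtain B C where "\<And>x. \<bar>f x\<bar> \<le> B" "\<And>x. \<bar>g x\<bar> \<le> C" by blast
  then have "\<bar>f x * g x\<bar> \<le> B * C" for x
    unfolding abs_mult by (meson abs_ge_zero mult_mono order_trans)
  then show ?case by blast
qed auto

lemma bump_class_differentiable: "f \<in> bump_class \<Longrightarrow> f differentiable (at x)"
  by (induction rule: bump_class.induct) (auto intro: grad_flat_exp(1) differentiable_mult)

lemma bump_class_grad: "f \<in> bump_class \<Longrightarrow> (\<lambda>x. grad f x $ j) \<in> bump_class"
proof (induction rule: bump_class.induct)
  case (bump_class_flat_exp p a b i)
  have "(\<lambda>x. b * flat_exp (pCons 0 (pCons 0 (p - pderiv p))) (a + b * x $ i)) \<in> bump_class"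
    by (intro bump_class.intros)
  then show ?case
    by (cases "i = j") (auto simp: grad_flat_exp axis_def intro: bump_class_const)
next
  case (bump_class_add f g)
  have "grad (\<lambda>x. f x + g x) x = grad f x + grad g x" for x
    by (rule grad_add) (use bump_class_add bump_class_differentiable in auto)
  then show ?case using bump_class_add by (auto intro: bump_class.bump_class_add)
next
  case (bump_class_mult f g)
  have "grad (\<lambda>x. f x * g x) x = f x *\<^sub>R grad g x + g x *\<^sub>R grad f x" for x
    by (rule grad_mult) (use bump_class_mult bump_class_differentiable in auto)
  then show ?case using bump_class_mult by (auto intro!: bump_class.bump_class_add bump_class.bump_class_mult)
qed (auto intro: bump_class_const)

lemma bump_class_reflect: "f \<in> bump_class \<Longrightarrow> (\<lambda>y. f (x - y)) \<in> bump_class"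
proof (induction rule: bump_class.induct)
  case (bump_class_flat_exp p a b i)
  have "(\<lambda>y. flat_exp p ((a + b * x $ i) + (- b) * y $ i)) \<in> bump_class"
    by (rule bump_class.bump_class_flat_exp)
  then show ?case by (simp add: algebra_simps)
qed (auto intro: bump_class.intros)

lemma bump_class_prod: "(\<And>i. i \<in> I \<Longrightarrow> f i \<in> bump_class) \<Longrightarrow> (\<lambda>x. \<Prod>i\<in>I. f i x) \<in> bump_class"
  by (induction I rule: infinite_finite_induct) (auto intro: bump_class.intros)

lemma smooth_on_of_closed_class:
  fixes f :: "real ^ 'n \<Rightarrow> real"
  assumes diff: "\<And>f x. f \<in> S \<Longrightarrow> f differentiable (at x)"
    and grad: "\<And>f i. f \<in> S \<Longrightarrow> (\<lambda>x. grad f x $ i) \<in> S"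
    and f: "f \<in> S"
  shows "smooth_on UNIV f"
proof -
  have "iterated_pderiv vs f differentiable (at x)" if "vs \<in> lists Basis" "f \<in> S" for vs f x
    using that
  proof (induction vs arbitrary: f)
    case Nil
    then show ?case using diff by simp
  next
    case (Cons v vs)
    then obtain i where "v = axis i 1" by (auto simp: Basis_vec_def)
    then have "(\<lambda>x. frechet_derivative f (at x) v) = (\<lambda>x. grad f x $ i)"
      by (simp add: grad_def)
    then show ?case using Cons grad by simp
  qed
  then show ?thesis using f by (auto simp: smooth_on_def)
qed

lemma bump_class_smooth: "f \<in> bump_class \<Longrightarrow> smooth_on UNIV f"
  by (rule smooth_on_of_closed_class[of bump_class]) (auto intro: bump_class_differentiable bump_class_grad)

lemma bump_class_continuous: "f \<in> bump_class \<Longrightarrow> continuous_on S f"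
  by (meson bump_class_smooth continuous_on_subset smooth_on_imp_continuous_on subset_UNIV)

lemma bump_class_grad_bounded:
  assumes "f \<in> bump_class"
  shows "\<exists>B\<ge>0. \<forall>x. norm (grad f x) \<le> B"
proof -
  have "\<forall>i. \<exists>B. \<forall>x. \<bar>grad f x $ i\<bar> \<le> B" using bump_class_bounded[OF bump_class_grad[OF assms]] by blast
  then obtain B where B: "\<And>i x. \<bar>grad f x $ i\<bar> \<le> B i" by metis
  have "norm (grad f x) \<le> sum B UNIV" for x
    using norm_le_l1_cart[of "grad f x"] sum_mono[of UNIV "\<lambda>i. \<bar>grad f x $ i\<bar>" B] B by force
  moreover from this[of 0] have "0 \<le> sum B UNIV" using norm_ge_zero order_trans by blast
  ultimately show ?thesis by blast
qed

text \<open>The remainder of the first order Taylor expansion is quadratic, uniformly in the base point,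
because the second derivatives are bounded.\<close>

lemma bump_class_taylor:
  fixes f :: "real ^ 'n \<Rightarrow> real"
  assumes "f \<in> bump_class"
  shows "\<exists>B\<ge>0. \<forall>x h. \<bar>f (x + h) - f x - grad f x \<bullet> h\<bar> \<le> B * (norm h)\<^sup>2"
proof -
  have "\<forall>i. \<exists>L\<ge>0. \<forall>x. norm (grad (\<lambda>y. grad f y $ i) x) \<le> L"
    using bump_class_grad_bounded[OF bump_class_grad[OF assms]] by blast
  then have "\<exists>L. \<forall>i. L i \<ge> 0 \<and> (\<forall>x. norm (grad (\<lambda>y. grad f y $ i) x) \<le> L i)"
    by (rule choice)
  then obtain L where L: "\<And>i. L i \<ge> 0" "\<And>i x. norm (grad (\<lambda>y. grad f y $ i) x) \<le> L i" by blast
  have lip: "(L i)-lipschitz_on UNIV (\<lambda>y. grad f y $ i)" for i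
    by (rule lipschitz_of_bounded_grad) (use L bump_class_differentiable[OF bump_class_grad[OF assms]] in auto)
  have gl: "norm (grad f (x + h) - grad f x) \<le> sum L UNIV * norm h" for x h
  proof -
    have "norm (grad f (x + h) - grad f x) \<le> (\<Sum>i\<in>UNIV. \<bar>(grad f (x + h) - grad f x) $ i\<bar>)"
      by (rule norm_le_l1_cart)
    also have "\<dots> \<le> (\<Sum>i\<in>UNIV. L i * norm h)"
      using lipschitz_onD[OF lip, of "x + h" x] by (intro sum_mono) (auto simp: dist_norm)
    finally show ?thesis by (simp add: sum_distrib_right)
  qed
  have "\<bar>f (x + h) - f x - grad f x \<bullet> h\<bar> \<le> sum L UNIV * (norm h)\<^sup>2" for x h
  proof -
    define F where "F k = f (x + k) - grad f x \<bullet> k" for k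
    have dF: "(F has_derivative (\<lambda>v. (grad f (x + k) - grad f x) \<bullet> v)) (at k)" for k
    proof -
      have "((\<lambda>k. f (x + k)) has_derivative (\<lambda>v. grad f (x + k) \<bullet> v)) (at k)"
        by (rule has_derivative_compose[of "\<lambda>k. x + k" "\<lambda>v. v" k UNIV f])
          (auto intro!: derivative_eq_intros has_derivative_grad bump_class_differentiable assms)
      then show ?thesis unfolding F_def
        by (auto intro!: derivative_eq_intros simp: inner_diff_left)
    qed
    have "norm (F h - F 0) \<le> (sum L UNIV * norm h) * norm (h - 0)"
    proof (rule differentiable_bound[of "cball 0 (norm h)" F "\<lambda>k v. (grad f (x + k) - grad f x) \<bullet> v"])
      fix k :: "real ^ 'n" assume k: "k \<in> cball 0 (norm h)"
      show "onorm (\<lambda>v. (grad f (x + k) - grad f x) \<bullet> v) \<le> sum L UNIV * norm h"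
      proof (rule onorm_bound)
        show "0 \<le> sum L UNIV * norm h" using L by (simp add: sum_nonneg)
        have "norm (grad f (x + k) - grad f x) \<le> sum L UNIV * norm h"
          using gl[of x k] k L
          by (meson mem_cball_0 mult_left_mono order_trans sum_nonneg)
        then show "norm ((grad f (x + k) - grad f x) \<bullet> v) \<le> sum L UNIV * norm h * norm v" for v
          by (metis Cauchy_Schwarz_ineq2 mult_right_mono norm_ge_zero order_trans real_norm_def)
      qed
    qed (use dF in \<open>auto intro: has_derivative_at_withinI\<close>)
    then show ?thesis by (simp add: F_def power2_eq_square algebra_simps)
  qed
  moreover have "0 \<le> sum L UNIV" using L by (simp add: sum_nonneg)
  ultimately show ?thesis by blast
qed

section \<open>Convolution\<close>

text \<open>Convolution of an integrable function with a kernel.\<close>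

definition conv :: "(real ^ 'n \<Rightarrow> real) \<Rightarrow> (real ^ 'n \<Rightarrow> real) \<Rightarrow> real ^ 'n \<Rightarrow> real" where
  "conv f \<rho> x = (LINT y|lborel. f y * \<rho> (x - y))"

lemma conv_integrable:
  assumes f: "integrable lborel f" and \<rho>: "\<rho> \<in> bump_class"
  shows "integrable lborel (\<lambda>y. f y * \<rho> (x - y))"
proof -
  obtain B where B: "\<And>x. \<bar>\<rho> x\<bar> \<le> B" using bump_class_bounded[OF \<rho>] by blast
  have [measurable]: "f \<in> borel_measurable lborel" using f by (rule borel_measurable_integrable)
  have [measurable]: "(\<lambda>y. \<rho> (x - y)) \<in> borel_measurable lborel"
    using bump_class_continuous[OF bump_class_reflect[OF \<rho>]] by (auto intro: borel_measurable_continuous_onI)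
  show ?thesis
  proof (rule Bochner_Integration.integrable_bound)
    show "integrable lborel (\<lambda>y. B * f y)" using f by simp
    show "AE y in lborel. norm (f y * \<rho> (x - y)) \<le> norm (B * f y)"
    proof (rule AE_I2)
      fix y
      have "\<bar>f y\<bar> * \<bar>\<rho> (x - y)\<bar> \<le> \<bar>f y\<bar> * \<bar>B\<bar>"
        using B[of "x - y"] by (intro mult_left_mono) auto
      then show "norm (f y * \<rho> (x - y)) \<le> norm (B * f y)" by (simp add: abs_mult mult.commute)
    qed
  qed measurable
qed

text \<open>The uniform Taylor estimate for the kernel can be integrated against \<open>f\<close>, which makes a dominated
convergence argument unnecessary.\<close>

lemma conv_has_derivative:
  fixes f :: "real ^ 'n \<Rightarrow> real"
  assumes f: "integrable lborel f" and \<rho>: "\<rho> \<in> bump_class"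
  shows "(conv f \<rho> has_derivative (\<lambda>h. (\<chi> i. conv f (\<lambda>z. grad \<rho> z $ i) x) \<bullet> h)) (at x)"
proof -
  obtain B where B: "B \<ge> 0" "\<And>x h. \<bar>\<rho> (x + h) - \<rho> x - grad \<rho> x \<bullet> h\<bar> \<le> B * (norm h)\<^sup>2"
    using bump_class_taylor[OF \<rho>] by blast
  define M where "M = B * (LINT y|lborel. \<bar>f y\<bar>)"
  have M0: "M \<ge> 0" using B by (simp add: M_def)
  define G where "G = (\<chi> i. conv f (\<lambda>z. grad \<rho> z $ i) x)"
  note int = conv_integrable[OF f \<rho>] conv_integrable[OF f bump_class_grad[OF \<rho>]]
  have est: "\<bar>conv f \<rho> (x + h) - conv f \<rho> x - G \<bullet> h\<bar> \<le> M * (norm h)\<^sup>2" for h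
  proof -
    have "G \<bullet> h = (\<Sum>i\<in>UNIV. (LINT y|lborel. f y * grad \<rho> (x - y) $ i * h $ i))"
      by (simp add: G_def inner_vec_def conv_def)
    also have "\<dots> = (LINT y|lborel. (\<Sum>i\<in>UNIV. f y * grad \<rho> (x - y) $ i * h $ i))"
      by (subst Bochner_Integration.integral_sum) (auto intro: int)
    also have "\<dots> = (LINT y|lborel. f y * (grad \<rho> (x - y) \<bullet> h))"
      by (simp add: inner_vec_def sum_distrib_left mult.assoc)
    finally have Gh: "G \<bullet> h = (LINT y|lborel. f y * (grad \<rho> (x - y) \<bullet> h))" .
    have int3: "integrable lborel (\<lambda>y. f y * (grad \<rho> (x - y) \<bullet> h))"
      by (simp add: inner_vec_def sum_distrib_left mult.assoc[symmetric] int)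
    have "conv f \<rho> (x + h) - conv f \<rho> x - G \<bullet> h
        = (LINT y|lborel. f y * \<rho> (x + h - y) - f y * \<rho> (x - y) - f y * (grad \<rho> (x - y) \<bullet> h))"
      using int int3 by (simp add: conv_def Gh)
    also have "\<bar>\<dots>\<bar> \<le> (LINT y|lborel. \<bar>f y\<bar> * (B * (norm h)\<^sup>2))"
    proof (rule integral_abs_bound[THEN order_trans], rule integral_mono)
      fix y
      have "\<bar>f y * \<rho> (x + h - y) - f y * \<rho> (x - y) - f y * (grad \<rho> (x - y) \<bullet> h)\<bar>
          = \<bar>f y\<bar> * \<bar>\<rho> ((x - y) + h) - \<rho> (x - y) - grad \<rho> (x - y) \<bullet> h\<bar>"
        by (simp add: abs_mult[symmetric] algebra_simps)
      also have "\<dots> \<le> \<bar>f y\<bar> * (B * (norm h)\<^sup>2)"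
        by (rule mult_left_mono[OF B(2)]) simp
      finally show "\<bar>f y * \<rho> (x + h - y) - f y * \<rho> (x - y) - f y * (grad \<rho> (x - y) \<bullet> h)\<bar>
        \<le> \<bar>f y\<bar> * (B * (norm h)\<^sup>2)" .
    qed (use int int3 f in auto)
    also have "\<dots> = M * (norm h)\<^sup>2" by (simp add: M_def mult_ac)
    finally show ?thesis .
  qed
  have "(conv f \<rho> has_derivative (\<lambda>h. G \<bullet> h)) (at x)"
    unfolding has_derivative_at
  proof
    show "bounded_linear (\<lambda>h. G \<bullet> h)" by (rule bounded_linear_inner_right)
    show "(\<lambda>h. norm (conv f \<rho> (x + h) - conv f \<rho> x - G \<bullet> h) / norm h) \<midarrow>0\<rightarrow> 0"
    proof (rule Lim_null_comparison)
      show "(\<lambda>h::real^'n. M * norm h) \<midarrow>0\<rightarrow> 0" by (auto intro!: tendsto_eq_intros)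
      have "norm (norm (conv f \<rho> (x + h) - conv f \<rho> x - G \<bullet> h) / norm h) \<le> M * norm h" for h
        using est[of h] by (cases "h = 0") (simp_all add: divide_simps power2_eq_square mult_ac)
      then show "\<forall>\<^sub>F h in at 0. norm (norm (conv f \<rho> (x + h) - conv f \<rho> x - G \<bullet> h) / norm h) \<le> M * norm h"
        by simp
    qed
  qed
  then show ?thesis by (simp add: G_def)
qed

lemma conv_differentiable:
  "integrable lborel f \<Longrightarrow> \<rho> \<in> bump_class \<Longrightarrow> conv f \<rho> differentiable (at x)"
  using conv_has_derivative has_derivative_imp_differentiable by blast

lemma grad_conv:
  "integrable lborel f \<Longrightarrow> \<rho> \<in> bump_class \<Longrightarrow> grad (conv f \<rho>) x $ i = conv f (\<lambda>z. grad \<rho> z $ i) x"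
  using grad_eqI[OF conv_has_derivative[of f \<rho> x]] by simp

lemma conv_smooth:
  assumes f: "integrable lborel f" and \<rho>: "\<rho> \<in> bump_class"
  shows "smooth_on UNIV (conv f \<rho>)"
proof (rule smooth_on_of_closed_class[of "conv f ` bump_class"])
  show "conv f \<rho> \<in> conv f ` bump_class" using \<rho> by blast
next
  fix g i assume "g \<in> conv f ` bump_class"
  then obtain \<sigma> where s: "\<sigma> \<in> bump_class" "g = conv f \<sigma>" by blast
  then have "(\<lambda>x. grad g x $ i) = conv f (\<lambda>z. grad \<sigma> z $ i)"
    using grad_conv[OF f] by auto
  then show "(\<lambda>x. grad g x $ i) \<in> conv f ` bump_class" using bump_class_grad[OF s(1)] by blast
qed (use conv_differentiable[OF f] in auto)

text \<open>A smooth, nonnegative and even kernel of mass one supported in the closed ball of radius \<open>\<epsilon>\<close>.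
Evenness makes the kernel a probability density in each of the two variables of \<open>\<rho> (x - y)\<close>.\<close>

definition mollifier :: "real \<Rightarrow> (real ^ 'n \<Rightarrow> real) \<Rightarrow> bool" where
  "mollifier \<epsilon> \<rho> \<longleftrightarrow> \<rho> \<in> bump_class \<and> (\<forall>x. 0 \<le> \<rho> x) \<and> (\<forall>x. \<epsilon> < norm x \<longrightarrow> \<rho> x = 0) \<and>
     (\<forall>x. \<rho> (- x) = \<rho> x) \<and>
     integrable lborel \<rho> \<and> (LINT x|lborel. \<rho> x) = 1"

lemma mollifier_exists:
  assumes "\<epsilon> > 0"
  obtains \<rho> :: "real ^ 'n \<Rightarrow> real" where "mollifier \<epsilon> \<rho>"
proof -
  define a where "a = real CARD('n) / \<epsilon>"
  have a: "a > 0" using assms by (simp add: a_def)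
  \<comment> \<open>a product of one-dimensional bumps, supported in the cube of side \<open>2 / a\<close>, which lies in the ball of radius \<open>\<epsilon>\<close>\<close>
  define \<beta> :: "real ^ 'n \<Rightarrow> real" where "\<beta> x = (\<Prod>i\<in>UNIV. flat_exp 1 (1 + (- a) * x $ i) * flat_exp 1 (1 + a * x $ i))" for x
  have \<beta>: "\<beta> \<in> bump_class" unfolding \<beta>_def by (intro bump_class_prod bump_class.intros)
  have nn: "\<beta> x \<ge> 0" for x unfolding \<beta>_def by (intro prod_nonneg ballI mult_nonneg_nonneg flat_exp_1_nonneg)
  have even: "\<beta> (- x) = \<beta> x" for x by (simp add: \<beta>_def mult.commute)
  have supp: "\<beta> x = 0" if "\<epsilon> < norm x" for x
  proof (rule ccontr)
    assume "\<beta> x \<noteq> 0"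
    then have nz: "flat_exp 1 (1 + (- a) * x $ i) \<noteq> 0" "flat_exp 1 (1 + a * x $ i) \<noteq> 0" for i
      by (auto simp: \<beta>_def)
    have "\<bar>x $ i\<bar> \<le> 1 / a" for i
    proof -
      have "1 + (- a) * x $ i > 0" "1 + a * x $ i > 0" using nz[of i] flat_exp_nonpos not_less by blast+
      then have "\<bar>a * x $ i\<bar> \<le> 1" by (simp add: abs_le_iff)
      then show ?thesis using a by (simp add: abs_mult pos_le_divide_eq mult.commute)
    qed
    then have "(\<Sum>i\<in>UNIV. \<bar>x $ i\<bar>) \<le> (\<Sum>i\<in>(UNIV::'n set). 1 / a)" by (rule sum_mono)
    also have "\<dots> = \<epsilon>" using assms by (simp add: a_def)
    finally show False using norm_le_l1_cart[of x] that by linarith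
  qed
  have int: "integrable lborel \<beta>"
    by (rule integrable_continuous_compact_support[of UNIV \<beta> "cball 0 \<epsilon>"])
      (use supp bump_class_continuous[OF \<beta>] in \<open>auto simp: not_le\<close>)
  have ne: "(LINT x|lborel. \<beta> x) \<noteq> 0"
  proof
    assume "(LINT x|lborel. \<beta> x) = 0"
    then have "AE x in lborel. \<beta> x = 0"
      using integral_nonneg_eq_0_iff_AE[OF int] nn by simp
    moreover have op: "open {x. \<beta> x \<noteq> 0}"
      using bump_class_continuous[OF \<beta>] by (intro open_Collect_neq) auto
    ultimately have "{x. \<beta> x \<noteq> 0} \<in> null_sets lborel"
      by (subst AE_iff_null_sets) auto
    then have "negligible {x. \<beta> x \<noteq> 0}"
      by (simp add: negligible_iff_null_sets null_sets_completionI)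
    moreover note op
    moreover have "\<beta> 0 \<noteq> 0" by (simp add: \<beta>_def flat_exp_def)
    ultimately show False using open_not_negligible by blast
  qed
  then have pos: "(LINT x|lborel. \<beta> x) > 0" using nn by (simp add: less_le)
  define c where "c = 1 / (LINT x|lborel. \<beta> x)"
  have "(\<lambda>x. c * \<beta> x) \<in> bump_class" by (intro bump_class.intros \<beta>)
  then have "mollifier \<epsilon> (\<lambda>x. c * \<beta> x)"
    unfolding mollifier_def using nn supp even int pos by (auto simp: c_def)
  then show ?thesis by (rule that)
qed

lemma mollifierD:
  assumes "mollifier \<epsilon> \<rho>"
  shows "\<rho> \<in> bump_class" "\<rho> x \<ge> 0" "\<epsilon> < norm x \<Longrightarrow> \<rho> x = 0" "\<rho> (- x) = \<rho> x"
    "continuous_on UNIV \<rho>"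
  using assms bump_class_continuous by (auto simp: mollifier_def)

lemma mollifier_translate:
  fixes \<rho> :: "real ^ 'n \<Rightarrow> real"
  assumes "mollifier \<epsilon> \<rho>"
  shows "integrable lborel (\<lambda>y. \<rho> (x - y))" "(LINT y|lborel. \<rho> (x - y)) = 1"
proof -
  have \<rho>: "integrable lborel \<rho>" "(LINT y|lborel. \<rho> y) = 1" using assms by (simp_all add: mollifier_def)
  have sw: "(\<lambda>y. \<rho> (x - y)) = (\<lambda>y. \<rho> (- x + y))"
    using mollifierD(4)[OF assms, of "x - _"] by (intro ext) (simp add: minus_diff_eq)
  show "integrable lborel (\<lambda>y. \<rho> (x - y))" "(LINT y|lborel. \<rho> (x - y)) = 1"
    unfolding sw using integral_lborel_translate[OF \<rho>(1), of "- x"] \<rho>(2) by simp_all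
qed

text \<open>The closed \<open>\<epsilon>\<close>-neighbourhood of a set, as a union of closed balls.\<close>

definition thicken :: "'a::metric_space set \<Rightarrow> real \<Rightarrow> 'a set" where
  "thicken C \<epsilon> = (\<Union>y\<in>C. cball y \<epsilon>)"

lemma compact_thicken:
  fixes C :: "'a::euclidean_space set"
  assumes "compact C"
  shows "compact (thicken C \<epsilon>)"
proof -
  have eq: "thicken C \<epsilon> = {x + y | x y. x \<in> C \<and> y \<in> cball 0 \<epsilon>}"
  proof (intro set_eqI iffI)
    fix z assume "z \<in> thicken C \<epsilon>"
    then obtain y where "y \<in> C" "dist y z \<le> \<epsilon>" by (auto simp: thicken_def)
    then show "z \<in> {x + y | x y. x \<in> C \<and> y \<in> cball 0 \<epsilon>}"
      by (intro CollectI exI[of _ y] exI[of _ "z - y"]) (auto simp: dist_norm norm_minus_commute)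
  next
    fix z assume "z \<in> {x + y | x y. x \<in> C \<and> y \<in> cball 0 \<epsilon>}"
    then obtain x y where "x \<in> C" "norm y \<le> \<epsilon>" "z = x + y" by auto
    then have "z \<in> cball x \<epsilon>" by (simp add: dist_norm)
    then show "z \<in> thicken C \<epsilon>" using \<open>x \<in> C\<close> by (auto simp: thicken_def)
  qed
  show ?thesis unfolding eq by (rule compact_sums[OF assms compact_cball])
qed

lemma thicken_thicken: "thicken (thicken C a) b \<subseteq> thicken C (a + b)"
proof
  fix z assume "z \<in> thicken (thicken C a) b"
  then obtain x y where "x \<in> C" "dist x y \<le> a" "dist y z \<le> b" by (auto simp: thicken_def)
  moreover have "dist x z \<le> dist x y + dist y z" by (rule dist_triangle)
  ultimately show "z \<in> thicken C (a + b)" by (auto simp: thicken_def intro!: bexI[of _ x])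
qed

lemma thicken_mono: "a \<le> b \<Longrightarrow> thicken C a \<subseteq> thicken C b"
  by (auto simp: thicken_def)

text \<open>If \<open>f\<close> is within \<open>\<delta>\<close> of the constant \<open>c\<close> near \<open>x\<close>, so is its mollification at \<open>x\<close>. This gives
uniform convergence, the support of the mollification and its bounds.\<close>

lemma conv_near_const:
  assumes f: "integrable lborel f" and \<rho>: "mollifier \<epsilon> \<rho>"
    and near: "\<And>y. dist y x \<le> \<epsilon> \<Longrightarrow> \<bar>f y - c\<bar> \<le> \<delta>"
  shows "\<bar>conv f \<rho> x - c\<bar> \<le> \<delta>"
proof -
  note int = conv_integrable[OF f mollifierD(1)[OF \<rho>], of x] mollifier_translate(1)[OF \<rho>, of x]
  have eq: "conv f \<rho> x - c = (LINT y|lborel. f y * \<rho> (x - y) - c * \<rho> (x - y))"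
    using int by (simp add: conv_def mollifier_translate(2)[OF \<rho>, of x])
  have "\<bar>LINT y|lborel. f y * \<rho> (x - y) - c * \<rho> (x - y)\<bar> \<le> (LINT y|lborel. \<delta> * \<rho> (x - y))"
  proof (rule integral_abs_bound[THEN order_trans], rule integral_mono)
    fix y
    have "\<bar>f y - c\<bar> * \<rho> (x - y) \<le> \<delta> * \<rho> (x - y)"
    proof (cases "dist y x \<le> \<epsilon>")
      case True
      then show ?thesis using near mollifierD(2)[OF \<rho>] by (intro mult_right_mono) auto
    next
      case False
      then show ?thesis using mollifierD(3)[OF \<rho>, of "x - y"] by (simp add: dist_norm norm_minus_commute)
    qed
    then show "\<bar>f y * \<rho> (x - y) - c * \<rho> (x - y)\<bar> \<le> \<delta> * \<rho> (x - y)"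
      using mollifierD(2)[OF \<rho>, of "x - y"] by (simp add: left_diff_distrib[symmetric] abs_mult)
  qed (use int in simp_all)
  then show ?thesis
    unfolding eq integral_mult_right_zero mollifier_translate(2)[OF \<rho>, of x] mult_1_right .
qed

lemma conv_eq_0:
  assumes "integrable lborel f" "mollifier \<epsilon> \<rho>" "\<And>y. y \<notin> C \<Longrightarrow> f y = 0" "x \<notin> thicken C \<epsilon>"
  shows "conv f \<rho> x = 0"
proof -
  have "y \<notin> C" if "dist y x \<le> \<epsilon>" for y using assms(4) that by (auto simp: thicken_def)
  then have "\<bar>conv f \<rho> x - 0\<bar> \<le> 0" using assms(3) by (intro conv_near_const[OF assms(1,2)]) auto
  then show ?thesis by simp
qed

lemma conv_Cc_smooth:
  assumes "integrable lborel f" "mollifier \<epsilon> \<rho>" "compact C" "\<And>y. y \<notin> C \<Longrightarrow> f y = 0"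
    "thicken C \<epsilon> \<subseteq> U"
  shows "conv f \<rho> \<in> Cc_smooth U"
  unfolding Cc_smooth_def compact_support_in_def
proof (intro CollectI conjI exI[of _ "thicken C \<epsilon>"] allI impI)
  show "conv f \<rho> x = 0" if "x \<notin> thicken C \<epsilon>" for x
    by (rule conv_eq_0[OF assms(1,2,4) that])
qed (use conv_smooth[OF assms(1) mollifierD(1)[OF assms(2)]] compact_thicken[OF assms(3)] assms(5) in simp_all)

text \<open>The mollified indicator of the neighbourhood of half the size.\<close>

lemma smooth_bump:
  fixes C :: "(real ^ 'n) set"
  assumes "compact C" "\<epsilon> > 0"
  obtains \<phi> :: "real ^ 'n \<Rightarrow> real" where "smooth_on UNIV \<phi>" "\<And>x. 0 \<le> \<phi> x \<and> \<phi> x \<le> 1" "\<And>x. x \<in> C \<Longrightarrow> \<phi> x = 1"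
    "\<And>x. x \<notin> thicken C \<epsilon> \<Longrightarrow> \<phi> x = 0"
proof -
  obtain \<rho> :: "real ^ 'n \<Rightarrow> real" where \<rho>: "mollifier (\<epsilon> / 2) \<rho>"
    using mollifier_exists[of "\<epsilon> / 2"] assms by auto
  define D where "D = thicken C (\<epsilon> / 2)"
  have D: "compact D" unfolding D_def by (rule compact_thicken[OF assms(1)])
  have DD: "thicken D (\<epsilon> / 2) \<subseteq> thicken C \<epsilon>"
    unfolding D_def using thicken_thicken[of C "\<epsilon> / 2" "\<epsilon> / 2"] by simp
  have int: "integrable lborel (indicator D :: _ \<Rightarrow> real)"
    using borel_integrable_compact[OF D, of "\<lambda>_. 1 :: real"] by simp
  let ?\<phi> = "conv (indicator D) \<rho>"
  show ?thesis
  proof (rule that[of ?\<phi>])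
    show "smooth_on UNIV ?\<phi>" by (rule conv_smooth[OF int mollifierD(1)[OF \<rho>]])
    show "0 \<le> ?\<phi> x \<and> ?\<phi> x \<le> 1" for x
    proof -
      have "\<bar>?\<phi> x - 1 / 2\<bar> \<le> 1 / 2"
        by (rule conv_near_const[OF int \<rho>]) (auto simp: indicator_def)
      then show ?thesis by (simp only: abs_le_iff) linarith
    qed
    show "?\<phi> x = 1" if "x \<in> C" for x
    proof -
      have "y \<in> D" if "dist y x \<le> \<epsilon> / 2" for y
        using that \<open>x \<in> C\<close> by (auto simp: D_def thicken_def dist_commute)
      then have "\<bar>?\<phi> x - 1\<bar> \<le> 0" by (intro conv_near_const[OF int \<rho>]) auto
      then show ?thesis by simp
    qed
    show "?\<phi> x = 0" if "x \<notin> thicken C \<epsilon>" for x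
      by (rule conv_eq_0[OF int \<rho>, of D]) (use that DD in auto)
  qed
qed

section \<open>The fundamental lemma of the calculus of variations\<close>

lemma locally_integrable_compact:
  "locally_integrable U f \<Longrightarrow> compact C \<Longrightarrow> C \<subseteq> U \<Longrightarrow> integrable lebesgue (\<lambda>x. indicator C x *\<^sub>R f x)"
  unfolding locally_integrable_def set_integrable_def by blast

lemma compact_exhaustion:
  fixes U :: "'a::euclidean_space set"
  assumes "open U"
  shows "\<exists>C :: nat \<Rightarrow> 'a set. (\<forall>n. compact (C n) \<and> C n \<subseteq> U) \<and> (\<Union>n. C n) = U \<and> incseq C \<and>
    (\<forall>K. compact K \<and> K \<subseteq> U \<longrightarrow> (\<exists>N. \<forall>n\<ge>N. K \<subseteq> C n))"
proof (rule open_Union_compact_subsets[OF assms])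
  fix C :: "nat \<Rightarrow> 'a set"
  assume C: "\<And>n. compact (C n)" "\<And>n. C n \<subseteq> U" "\<And>n. C n \<subseteq> interior (C (Suc n))"
    "\<Union>(range C) = U" "\<And>K. \<lbrakk>compact K; K \<subseteq> U\<rbrakk> \<Longrightarrow> \<exists>N. \<forall>n\<ge>N. K \<subseteq> C n"
  have "incseq C"
    by (rule incseq_SucI) (use C(3) interior_subset in blast)
  then show ?thesis using C(1,2,4)
    by (intro exI[of _ C] conjI allI impI C(5)) auto
qed

lemma locally_integrable_measurable:
  fixes f :: "real ^ 'n \<Rightarrow> 'b::{banach, second_countable_topology}"
  assumes "open U" "locally_integrable U f"
  shows "(\<lambda>x. indicator U x *\<^sub>R f x) \<in> borel_measurable lebesgue"
proof -
  obtain C :: "nat \<Rightarrow> (real ^ 'n) set" where C: "\<And>n. compact (C n)" "\<And>n. C n \<subseteq> U"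
    "\<And>K. compact K \<and> K \<subseteq> U \<Longrightarrow> \<exists>N. \<forall>n\<ge>N. K \<subseteq> C n"
    using compact_exhaustion[OF assms(1)] by auto
  show ?thesis
  proof (rule borel_measurable_LIMSEQ_metric)
    show "(\<lambda>x. indicator (C n) x *\<^sub>R f x) \<in> borel_measurable lebesgue" for n
      using locally_integrable_compact[OF assms(2) C(1,2)] by (rule borel_measurable_integrable)
    fix x
    show "(\<lambda>n. indicator (C n) x *\<^sub>R f x) \<longlonglongrightarrow> indicator U x *\<^sub>R f x"
    proof (cases "x \<in> U")
      case True
      then obtain N where "\<forall>n\<ge>N. {x} \<subseteq> C n" using C(3)[of "{x}"] by auto
      then have "\<forall>\<^sub>F n in sequentially. indicator (C n) x *\<^sub>R f x = indicator U x *\<^sub>R f x"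
        using True by (auto simp: eventually_sequentially indicator_def)
      then show ?thesis by (rule tendsto_eventually)
    next
      case False
      then have "x \<notin> C n" for n using C(2) by blast
      then show ?thesis using False by simp
    qed
  qed
qed

lemma integrable_locally_integrable_mult:
  fixes f :: "real ^ 'n \<Rightarrow> 'b::{banach, second_countable_topology}"
  assumes f: "locally_integrable U f" and \<phi>: "continuous_on U \<phi>"
    and C: "compact C" "C \<subseteq> U" "\<And>x. x \<notin> C \<Longrightarrow> \<phi> x = 0"
  shows "integrable lebesgue (\<lambda>x. \<phi> x *\<^sub>R f x)" "set_integrable lebesgue U (\<lambda>x. \<phi> x *\<^sub>R f x)"
proof -
  have fC: "integrable lebesgue (\<lambda>x. indicator C x *\<^sub>R f x)"
    by (rule locally_integrable_compact[OF f C(1,2)])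
  have "compact (\<phi> ` C)"
    using compact_continuous_image continuous_on_subset[OF \<phi> C(2)] C(1) by blast
  then obtain B where B: "\<And>x. x \<in> C \<Longrightarrow> \<bar>\<phi> x\<bar> \<le> B"
    by (metis bounded_pos compact_imp_bounded imageI real_norm_def)
  have "integrable lborel \<phi>"
    by (rule integrable_continuous_compact_support[OF \<phi> C])
  then have [measurable]: "\<phi> \<in> borel_measurable lebesgue"
    by (intro measurable_completion) (auto dest: borel_measurable_integrable)
  have [measurable]: "(\<lambda>x. indicator C x *\<^sub>R f x) \<in> borel_measurable lebesgue"
    using fC by (rule borel_measurable_integrable)
  have "integrable lebesgue (\<lambda>x. \<phi> x *\<^sub>R (indicator C x *\<^sub>R f x))"
  proof (rule Bochner_Integration.integrable_bound)
    show "integrable lebesgue (\<lambda>x. B *\<^sub>R (indicator C x *\<^sub>R f x))"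
      by (rule integrable_scaleR_right) (rule fC)
    show "AE x in lebesgue. norm (\<phi> x *\<^sub>R (indicator C x *\<^sub>R f x)) \<le> norm (B *\<^sub>R (indicator C x *\<^sub>R f x))"
    proof (rule AE_I2)
      fix x
      show "norm (\<phi> x *\<^sub>R (indicator C x *\<^sub>R f x)) \<le> norm (B *\<^sub>R (indicator C x *\<^sub>R f x))"
      proof (cases "x \<in> C")
        case True
        have "\<bar>\<phi> x\<bar> * norm (f x) \<le> \<bar>B\<bar> * norm (f x)"
          using B[OF True] by (intro mult_right_mono) auto
        then show ?thesis using True by simp
      qed simp
    qed
  qed measurable
  also have "(\<lambda>x. \<phi> x *\<^sub>R (indicator C x *\<^sub>R f x)) = (\<lambda>x. \<phi> x *\<^sub>R f x)"
    using C(3) by (intro ext) (auto simp: indicator_def)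
  finally show "integrable lebesgue (\<lambda>x. \<phi> x *\<^sub>R f x)" .
  moreover have "(\<lambda>x. indicator U x *\<^sub>R \<phi> x *\<^sub>R f x) = (\<lambda>x. \<phi> x *\<^sub>R f x)"
  proof
    show "indicator U x *\<^sub>R \<phi> x *\<^sub>R f x = \<phi> x *\<^sub>R f x" for x
      using C(2) C(3)[of x] by (cases "x \<in> C") auto
  qed
  ultimately show "set_integrable lebesgue U (\<lambda>x. \<phi> x *\<^sub>R f x)"
    by (simp add: set_integrable_def)
qed

text \<open>Smooth bumps converge boundedly to the indicator of a compact set, so a function that is orthogonal to all
test functions has vanishing integral over every compact set.\<close>

lemma set_integral_compact_eq_0:
  fixes f :: "real ^ 'n \<Rightarrow> real"
  assumes U: "open U" and f: "locally_integrable U f"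
    and orth: "\<And>\<phi>. \<phi> \<in> Cc_smooth U \<Longrightarrow> (LINT x:U|lebesgue. f x * \<phi> x) = 0"
    and C: "compact C" "C \<subseteq> U"
  shows "(LINT x|lebesgue. indicator C x * f x) = 0"
proof -
  obtain e where e: "e > 0" "thicken C e \<subseteq> U"
    using compact_subset_open_imp_cball_epsilon_subset[OF C(1) U C(2)] unfolding thicken_def by metis
  define D where "D = thicken C e"
  have D: "compact D" "D \<subseteq> U" using compact_thicken[OF C(1)] e by (auto simp: D_def)
  define \<epsilon> where "\<epsilon> k = e / real (Suc k)" for k
  have \<epsilon>: "\<epsilon> k > 0" "\<epsilon> k \<le> e" for k using e by (auto simp: \<epsilon>_def field_simps)
  have "\<forall>k. \<exists>\<phi>. smooth_on UNIV \<phi> \<and> (\<forall>x. 0 \<le> \<phi> x \<and> \<phi> x \<le> 1) \<and> (\<forall>x\<in>C. \<phi> x = 1)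
      \<and> (\<forall>x. x \<notin> thicken C (\<epsilon> k) \<longrightarrow> \<phi> x = (0::real))"
  proof
    fix k
    show "\<exists>\<phi>. smooth_on UNIV \<phi> \<and> (\<forall>x. 0 \<le> \<phi> x \<and> \<phi> x \<le> 1) \<and> (\<forall>x\<in>C. \<phi> x = 1)
      \<and> (\<forall>x. x \<notin> thicken C (\<epsilon> k) \<longrightarrow> \<phi> x = (0::real))"
      by (rule smooth_bump[OF C(1) \<epsilon>(1)[of k]]) blast
  qed
  from choice[OF this] obtain \<phi> :: "nat \<Rightarrow> real ^ 'n \<Rightarrow> real" where \<phi>: "\<And>k. smooth_on UNIV (\<phi> k)" "\<And>k x. 0 \<le> \<phi> k x \<and> \<phi> k x \<le> 1"
    "\<And>k x. x \<in> C \<Longrightarrow> \<phi> k x = 1" "\<And>k x. x \<notin> thicken C (\<epsilon> k) \<Longrightarrow> \<phi> k x = 0" by blast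
  have off: "\<phi> k x = 0" if "x \<notin> D" for k x
    using \<phi>(4)[where k=k and x=x] thicken_mono[OF \<epsilon>(2)[of k], of C] that by (auto simp: D_def)
  have Cc: "\<phi> k \<in> Cc_smooth U" for k
    using \<phi>(1) off D by (auto simp: Cc_smooth_def compact_support_in_def)
  have int: "integrable lebesgue (\<lambda>x. \<phi> k x * f x)" for k
    using integrable_locally_integrable_mult(1)[OF f
        continuous_on_subset[OF smooth_on_imp_continuous_on[OF \<phi>(1)] subset_UNIV] D off, of k] by simp
  have zero: "(LINT x|lebesgue. \<phi> k x * f x) = 0" for k
  proof -
    have "(LINT x:U|lebesgue. f x * \<phi> k x) = (LINT x|lebesgue. f x * \<phi> k x)"
      by (rule set_lebesgue_integral_eq_of_vanishing) (use off D in auto)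
    then show ?thesis using orth[OF Cc] by (simp add: mult.commute)
  qed
  have fD: "integrable lebesgue (\<lambda>x. indicator D x *\<^sub>R f x)"
    by (rule locally_integrable_compact[OF f D])
  have "(\<lambda>k. LINT x|lebesgue. \<phi> k x * f x) \<longlonglongrightarrow> (LINT x|lebesgue. indicator C x * f x)"
  proof (rule integral_dominated_convergence[where w="\<lambda>x. norm (indicator D x *\<^sub>R f x)"])
    show "(\<lambda>x. indicator C x * f x) \<in> borel_measurable lebesgue"
      using locally_integrable_compact[OF f C] by (auto dest: borel_measurable_integrable)
    show "integrable lebesgue (\<lambda>x. norm (indicator D x *\<^sub>R f x))" using fD by (rule integrable_norm)
    show "AE x in lebesgue. norm (\<phi> k x * f x) \<le> norm (indicator D x *\<^sub>R f x)" for k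
    proof (rule AE_I2)
      fix x
      show "norm (\<phi> k x * f x) \<le> norm (indicator D x *\<^sub>R f x)"
        using \<phi>(2)[of k x] off[of x k] by (cases "x \<in> D") (auto simp: abs_mult intro: mult_left_le_one_le)
    qed
    show "AE x in lebesgue. (\<lambda>k. \<phi> k x * f x) \<longlonglongrightarrow> indicator C x * f x"
    proof (rule AE_I2)
      fix x
      show "(\<lambda>k. \<phi> k x * f x) \<longlonglongrightarrow> indicator C x * f x"
      proof (cases "x \<in> C")
        case True
        then show ?thesis using \<phi>(3) by simp
      next
        case False
        have "open (- C)" using C(1) by (simp add: compact_imp_closed open_Compl)
        then obtain d where d: "d > 0" "ball x d \<subseteq> - C" using False by (meson ComplI openE)
        have "\<epsilon> \<longlonglongrightarrow> 0" unfolding \<epsilon>_def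
          using LIMSEQ_inverse_real_of_nat[THEN tendsto_mult_left, of e] by (simp add: divide_inverse)
        then have "\<forall>\<^sub>F k in sequentially. \<epsilon> k < d" using d(1) by (rule order_tendstoD)
        then have "\<forall>\<^sub>F k in sequentially. \<phi> k x * f x = indicator C x * f x"
        proof eventually_elim
          case (elim k)
          have "x \<notin> thicken C (\<epsilon> k)"
          proof
            assume "x \<in> thicken C (\<epsilon> k)"
            then obtain y where "y \<in> C" "dist y x \<le> \<epsilon> k" by (auto simp: thicken_def)
            then have "y \<in> ball x d" using elim by (simp add: dist_commute)
            then show False using d \<open>y \<in> C\<close> by blast
          qed
          then show ?case using \<phi>(4) False by simp
        qed
        then show ?thesis by (rule tendsto_eventually)
      qed
    qed
  qed (use int in \<open>auto dest: borel_measurable_integrable\<close>)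
  then show ?thesis by (simp add: zero LIMSEQ_const_iff)
qed

text \<open>By inner regularity, if the set where \<open>g > 0\<close> had positive measure, it would contain a compact set of
positive measure, over which the integral of \<open>g\<close> would be positive.\<close>

lemma AE_nonpos_of_compact_integrals:
  fixes g :: "real ^ 'n \<Rightarrow> real"
  assumes K: "compact K" and g: "integrable lebesgue (\<lambda>x. indicator K x * g x)"
    and zero: "\<And>C. compact C \<Longrightarrow> C \<subseteq> K \<Longrightarrow> (LINT x|lebesgue. indicator C x * g x) = 0"
  shows "AE x in lebesgue. x \<in> K \<longrightarrow> g x \<le> 0"
proof -
  define P where "P = {x. indicator K x * g x > 0}"
  have Pm: "P \<in> sets lebesgue"
  proof -
    have [measurable]: "(\<lambda>x. indicator K x * g x) \<in> borel_measurable lebesgue"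
      using g by (rule borel_measurable_integrable)
    have "{x \<in> space lebesgue. indicator K x * g x > 0} \<in> sets lebesgue" by measurable
    then show ?thesis by (simp add: P_def)
  qed
  have PK: "x \<in> K \<and> g x > 0" if "x \<in> P" for x
    using that by (cases "x \<in> K") (auto simp: P_def)
  have "emeasure lebesgue P \<le> ennreal e" if e: "e > 0" for e :: real
  proof -
    obtain T where T: "closed T" "T \<subseteq> P" "emeasure lebesgue (P - T) < ennreal e"
      using sets_lebesgue_inner_closed[OF Pm e] .
    have "T \<subseteq> K" using T PK by blast
    then have cT: "compact T" using T(1) K by (metis compact_Int_closed inf.absorb_iff2)
    have Tm: "T \<in> sets lebesgue" using T(1) by auto
    have gT: "integrable lebesgue (\<lambda>x. indicator T x * g x)"
    proof -
      have "integrable lebesgue (\<lambda>x. indicator T x *\<^sub>R (indicator K x * g x))"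
        by (rule integrable_mult_indicator[OF Tm g])
      moreover have "(\<lambda>x. indicator T x *\<^sub>R (indicator K x * g x)) = (\<lambda>x. indicator T x * g x)"
        using \<open>T \<subseteq> K\<close> by (intro ext) (auto simp: indicator_def)
      ultimately show ?thesis by simp
    qed
    have "AE x in lebesgue. indicator T x * g x = 0"
    proof (subst integral_nonneg_eq_0_iff_AE[OF gT, symmetric])
      have "0 \<le> indicator T x * g x" for x
        using T(2) PK[of x] by (cases "x \<in> T") auto
      then show "AE x in lebesgue. 0 \<le> indicator T x * g x" by simp
    qed (rule zero[OF cT \<open>T \<subseteq> K\<close>])
    moreover have "x \<notin> T" if "indicator T x * g x = 0" for x
      using that T(2) PK[of x] by (cases "x \<in> T") auto
    ultimately have "AE x in lebesgue. x \<notin> T" by (rule eventually_mono)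
    then have "T \<in> null_sets lebesgue" using Tm AE_iff_null_sets by blast
    then have "emeasure lebesgue P = emeasure lebesgue (P - T)"
      using Pm by (simp add: emeasure_Diff_null_set)
    then show ?thesis using T(3) by simp
  qed
  then have "emeasure lebesgue P \<le> 0" by - (rule ennreal_le_epsilon, simp)
  then have "P \<in> null_sets lebesgue" using Pm by (auto intro: null_setsI)
  then have "AE x in lebesgue. x \<notin> P" by (rule AE_not_in)
  then show ?thesis by (rule AE_mp) (auto intro!: AE_I2 simp: P_def)
qed

lemma AE_all_compact:
  fixes U :: "(real ^ 'n) set"
  assumes "open U" "\<And>C. compact C \<Longrightarrow> C \<subseteq> U \<Longrightarrow> AE x in lebesgue. x \<in> C \<longrightarrow> P x"
  shows "AE x in lebesgue. x \<in> U \<longrightarrow> P x"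
proof -
  obtain C :: "nat \<Rightarrow> (real ^ 'n) set" where C: "\<forall>n. compact (C n) \<and> C n \<subseteq> U" "(\<Union>n. C n) = U"
    using compact_exhaustion[OF assms(1)] by blast
  have "AE x in lebesgue. \<forall>n. x \<in> C n \<longrightarrow> P x"
    using assms(2) C(1) by (intro AE_all_countable[THEN iffD2] allI) blast
  then show ?thesis by (rule AE_mp) (use C(2) in \<open>auto intro!: AE_I2\<close>)
qed

theorem fundamental_lemma:
  fixes f :: "real ^ 'n \<Rightarrow> real"
  assumes U: "open U" and f: "locally_integrable U f"
    and orth: "\<And>\<phi>. \<phi> \<in> Cc_smooth U \<Longrightarrow> (LINT x:U|lebesgue. f x * \<phi> x) = 0"
  shows "AE x in lebesgue. x \<in> U \<longrightarrow> f x = 0"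
proof (rule AE_all_compact[OF U])
  fix K assume K: "compact K" "K \<subseteq> U"
  note z = set_integral_compact_eq_0[OF U f orth]
  have i: "integrable lebesgue (\<lambda>x. indicator K x * f x)"
    using locally_integrable_compact[OF f K] by simp
  have "AE x in lebesgue. x \<in> K \<longrightarrow> f x \<le> 0"
    by (rule AE_nonpos_of_compact_integrals[OF K(1) i]) (use z K in auto)
  moreover have "AE x in lebesgue. x \<in> K \<longrightarrow> - f x \<le> 0"
    by (rule AE_nonpos_of_compact_integrals[OF K(1)]) (use z K i in auto)
  ultimately show "AE x in lebesgue. x \<in> K \<longrightarrow> f x = 0"
    by eventually_elim auto
qed

lemma locally_integrable_component:
  fixes G :: "real ^ 'n \<Rightarrow> real ^ 'n"
  assumes "locally_integrable U G"
  shows "locally_integrable U (\<lambda>x. G x $ i)"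
  unfolding locally_integrable_def set_integrable_def
proof (intro allI impI)
  fix C assume "compact C \<and> C \<subseteq> U"
  then have "integrable lebesgue (\<lambda>x. indicator C x *\<^sub>R G x)"
    using locally_integrable_compact[OF assms] by auto
  then have "integrable lebesgue (\<lambda>x. (indicator C x *\<^sub>R G x) $ i)"
    by (rule integrable_bounded_linear[OF bounded_linear_vec_nth])
  then show "integrable lebesgue (\<lambda>x. indicator C x *\<^sub>R G x $ i)" by simp
qed

lemma compact_support_CcE:
  assumes "\<phi> \<in> Cc_smooth U"
  obtains C where "compact C" "C \<subseteq> U" "\<And>x. x \<notin> C \<Longrightarrow> \<phi> x = 0" "\<And>x. x \<notin> C \<Longrightarrow> grad \<phi> x = 0"
proof -
  obtain C where C: "compact C" "C \<subseteq> U" "\<And>x. x \<notin> C \<Longrightarrow> \<phi> x = 0"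
    using assms by (auto simp: Cc_smooth_def compact_support_in_def)
  then show ?thesis using that[OF C] grad_eq_0_outside(1)[of C \<phi>] by (auto simp: compact_imp_closed)
qed

lemma Cc_smooth_continuous:
  assumes "\<phi> \<in> Cc_smooth U"
  shows "continuous_on V \<phi>" "continuous_on V (grad \<phi>)"
proof -
  have "\<phi> \<in> C1c U" using assms Cc_smooth_subset_C1c by blast
  then show "continuous_on V \<phi>" "continuous_on V (grad \<phi>)"
    using continuous_on_subset[OF C1cD(3) subset_UNIV] continuous_on_subset[OF C1cD(2) subset_UNIV] by blast+
qed

theorem weak_gradient_unique:
  fixes G H :: "real ^ 'n \<Rightarrow> real ^ 'n"
  assumes U: "open U" and G: "weak_gradient U u G" and H: "weak_gradient U u H"
  shows "AE x in lebesgue. x \<in> U \<longrightarrow> G x = H x"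
proof -
  have li: "locally_integrable U (\<lambda>x. G x $ i)" "locally_integrable U (\<lambda>x. H x $ i)" for i
    using G H by (auto simp: weak_gradient_def intro: locally_integrable_component)
  have "AE x in lebesgue. x \<in> U \<longrightarrow> G x $ i - H x $ i = 0" for i
  proof (rule fundamental_lemma[OF U])
    show "locally_integrable U (\<lambda>x. G x $ i - H x $ i)"
      using li[of i] unfolding locally_integrable_def by (auto intro: set_integral_diff)
    fix \<phi> assume \<phi>: "\<phi> \<in> Cc_smooth U"
    obtain C where C: "compact C" "C \<subseteq> U" "\<And>x. x \<notin> C \<Longrightarrow> \<phi> x = 0"
      by (rule compact_support_CcE[OF \<phi>]) blast
    have int: "set_integrable lebesgue U (\<lambda>x. G x $ i * \<phi> x)" "set_integrable lebesgue U (\<lambda>x. H x $ i * \<phi> x)"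
      using integrable_locally_integrable_mult(2)[OF li(1) Cc_smooth_continuous(1)[OF \<phi>] C, of i]
        integrable_locally_integrable_mult(2)[OF li(2) Cc_smooth_continuous(1)[OF \<phi>] C, of i]
      by (simp_all add: mult.commute)
    have "(LINT x:U|lebesgue. (G x $ i - H x $ i) * \<phi> x)
        = (LINT x:U|lebesgue. G x $ i * \<phi> x) - (LINT x:U|lebesgue. H x $ i * \<phi> x)"
      using set_integral_diff(2)[OF int] by (simp add: left_diff_distrib)
    also have "\<dots> = 0"
    proof -
      have "(LINT x:U|lebesgue. G x $ i * \<phi> x) = - (LINT x:U|lebesgue. u x * grad \<phi> x $ i)"
        using G \<phi> by (simp add: weak_gradient_def)
      moreover have "(LINT x:U|lebesgue. H x $ i * \<phi> x) = - (LINT x:U|lebesgue. u x * grad \<phi> x $ i)"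
        using H \<phi> by (simp add: weak_gradient_def)
      ultimately show ?thesis by simp
    qed
    finally show "(LINT x:U|lebesgue. (G x $ i - H x $ i) * \<phi> x) = 0" .
  qed
  then have "AE x in lebesgue. \<forall>i. x \<in> U \<longrightarrow> G x $ i - H x $ i = 0"
    by (intro AE_all_countable[THEN iffD2] allI)
  then show ?thesis by (rule AE_mp) (auto intro!: AE_I2 simp: vec_eq_iff)
qed

text \<open>Mollification commutes with weak gradients: the kernel, seen from a point whose closed
\<open>\<epsilon>\<close>-ball lies in \<open>U\<close>, is a test function.\<close>

lemma grad_conv_weak:
  fixes g :: "real ^ 'n \<Rightarrow> real ^ 'n"
  assumes s: "integrable lborel s" "\<And>x. x \<notin> U \<Longrightarrow> s x = 0" and g: "weak_gradient U s g"
    and \<rho>: "mollifier \<epsilon> \<rho>" and x: "cball x \<epsilon> \<subseteq> U"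
  shows "grad (conv s \<rho>) x $ i = (LINT y:U|lebesgue. g y $ i * \<rho> (x - y))"
proof -
  define \<phi> where "\<phi> y = \<rho> (x - y)" for y
  have bump_class: "\<phi> \<in> bump_class" unfolding \<phi>_def by (rule bump_class_reflect[OF mollifierD(1)[OF \<rho>]])
  have off: "\<phi> y = 0" if "y \<notin> cball x \<epsilon>" for y
    using mollifierD(3)[OF \<rho>, of "x - y"] that by (simp add: \<phi>_def dist_norm)
  have Cc: "\<phi> \<in> Cc_smooth U"
    using bump_class_smooth[OF bump_class] off x
    unfolding Cc_smooth_def compact_support_in_def
    by (intro CollectI conjI exI[of _ "cball x \<epsilon>"] allI impI compact_cball) auto
  have gr: "grad \<phi> y = - grad \<rho> (x - y)" for y
  proof (rule grad_eqI)
    have "((\<lambda>y. \<rho> (x - y)) has_derivative (\<lambda>h. grad \<rho> (x - y) \<bullet> (- h))) (at y)"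
    proof (rule has_derivative_compose[of "\<lambda>y. x - y" "\<lambda>h. - h" y UNIV \<rho>])
      show "((\<lambda>y. x - y) has_derivative (\<lambda>h. - h)) (at y)" by (auto intro!: derivative_eq_intros)
      show "(\<rho> has_derivative (\<lambda>h. grad \<rho> (x - y) \<bullet> h)) (at (x - y))"
        by (rule has_derivative_grad[OF bump_class_differentiable[OF mollifierD(1)[OF \<rho>]]])
    qed
    then show "(\<phi> has_derivative (\<lambda>h. (- grad \<rho> (x - y)) \<bullet> h)) (at y)"
      unfolding \<phi>_def[abs_def] inner_minus_left inner_minus_right .
  qed
  have "grad (conv s \<rho>) x $ i = (LINT y|lborel. s y * grad \<rho> (x - y) $ i)"
    using grad_conv[OF s(1) mollifierD(1)[OF \<rho>]] by (simp add: conv_def)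
  also have "\<dots> = - (LINT y|lborel. s y * grad \<phi> y $ i)" by (simp add: gr)
  also have "(LINT y|lborel. s y * grad \<phi> y $ i) = (LINT y:U|lebesgue. s y * grad \<phi> y $ i)"
    using conv_integrable[OF s(1) bump_class_grad[OF mollifierD(1)[OF \<rho>]], of x i] s(2)
    by (intro set_integral_lebesgue_eq_lborel[symmetric]) (auto simp: gr)
  also have "\<dots> = - (LINT y:U|lebesgue. g y $ i * \<phi> y)"
    using g Cc by (simp add: weak_gradient_def)
  finally show ?thesis by (simp add: \<phi>_def)
qed

section \<open>Quadratic forms\<close>

lemma normA_sq_expand: "normA_sq W x \<xi> = (\<Sum>i\<in>UNIV. \<Sum>j\<in>UNIV. W x $ i $ j * \<xi> $ j * \<xi> $ i)"
  by (simp add: normA_sq_def inner_vec_def matrix_vector_mult_def sum_distrib_right)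

lemma normA_sq_scaleR: "normA_sq W x (c *\<^sub>R \<xi>) = c\<^sup>2 * normA_sq W x \<xi>"
  by (simp add: normA_sq_def matrix_vector_mult_scaleR power2_eq_square)

lemma normA_sq_weight: "normA_sq (\<lambda>x. c x *\<^sub>R A x) x \<xi> = c x * normA_sq A x \<xi>"
  by (simp add: normA_sq_def scaleR_matrix_vector_assoc[symmetric])

lemma normA_sq_0 [simp]: "normA_sq W x 0 = 0"
  by (simp add: normA_sq_def)

lemma normA_sq_add:
  "normA_sq W x (\<xi> + \<eta>) = normA_sq W x \<xi> + (W x *v \<xi>) \<bullet> \<eta> + (W x *v \<eta>) \<bullet> \<xi> + normA_sq W x \<eta>"
  by (simp add: normA_sq_def matrix_vector_right_distrib inner_add_left inner_add_right)

text \<open>The quadratic triangle inequality with a weight; symmetry of the matrix is not needed.\<close>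

lemma normA_sq_young:
  assumes pos: "\<And>\<zeta>. 0 \<le> normA_sq W x \<zeta>" and \<delta>: "\<delta> > 0"
  shows "normA_sq W x \<xi> \<le> (1 + \<delta>) * normA_sq W x \<eta> + (1 + 1 / \<delta>) * normA_sq W x (\<xi> - \<eta>)"
proof -
  define d where "d = \<xi> - \<eta>"
  define s where "s = sqrt \<delta>"
  have s: "s > 0" "s * s = \<delta>" using \<delta> by (auto simp: s_def)
  define c where "c = - 1 / s"
  have c: "s * c = - 1" "c * c = 1 / \<delta>" using s by (auto simp: c_def field_simps)
  have "0 \<le> normA_sq W x (s *\<^sub>R \<eta> + c *\<^sub>R d)" by (rule pos)
  also have "\<dots> = (s * s) * normA_sq W x \<eta> + (s * c) * ((W x *v \<eta>) \<bullet> d) + (s * c) * ((W x *v d) \<bullet> \<eta>) + (c * c) * normA_sq W x d"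
    unfolding normA_sq_add normA_sq_scaleR
    by (simp add: matrix_vector_mult_scaleR power2_eq_square)
  also have "\<dots> = \<delta> * normA_sq W x \<eta> - (W x *v \<eta>) \<bullet> d - (W x *v d) \<bullet> \<eta> + 1 / \<delta> * normA_sq W x d"
    unfolding s c by simp
  finally have "(W x *v \<eta>) \<bullet> d + (W x *v d) \<bullet> \<eta> \<le> \<delta> * normA_sq W x \<eta> + 1 / \<delta> * normA_sq W x d"
    by simp
  moreover have "normA_sq W x \<xi> = normA_sq W x (\<eta> + d)" by (simp add: d_def)
  ultimately show ?thesis unfolding d_def[symmetric] by (simp add: normA_sq_add distrib_right)
qed

lemma abs_normA_sq_le: "\<bar>normA_sq W x \<xi>\<bar> \<le> real CARD('n) * norm (W x) * (norm \<xi>)\<^sup>2"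
  for W :: "real ^ 'n \<Rightarrow> real ^ 'n ^ 'n"
proof -
  have 1: "\<bar>(W x *v \<xi>) $ i * \<xi> $ i\<bar> \<le> norm (W x) * (norm \<xi>)\<^sup>2" for i
  proof -
    have "\<bar>(W x *v \<xi>) $ i\<bar> \<le> norm (W x $ i) * norm \<xi>"
      by (simp add: matrix_vector_mul_component Cauchy_Schwarz_ineq2)
    also have "\<dots> \<le> norm (W x) * norm \<xi>"
      by (intro mult_right_mono Finite_Cartesian_Product.norm_nth_le norm_ge_zero)
    finally have "\<bar>(W x *v \<xi>) $ i\<bar> * \<bar>\<xi> $ i\<bar> \<le> (norm (W x) * norm \<xi>) * norm \<xi>"
      using component_le_norm_cart[of \<xi> i] by (intro mult_mono) auto
    then show ?thesis by (simp add: abs_mult power2_eq_square mult_ac)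
  qed
  have "\<bar>normA_sq W x \<xi>\<bar> \<le> (\<Sum>i\<in>UNIV. \<bar>(W x *v \<xi>) $ i * \<xi> $ i\<bar>)"
    unfolding normA_sq_def inner_vec_def inner_real_def by (rule sum_abs)
  also have "\<dots> \<le> (\<Sum>i\<in>(UNIV :: 'n set). norm (W x) * (norm \<xi>)\<^sup>2)"
    by (rule sum_mono) (rule 1)
  finally show ?thesis by simp
qed

text \<open>A continuous matrix field whose quadratic form is positive definite, uniformly on each compact
subset of \<open>U\<close>. Symmetry is not part of the notion.\<close>

definition elliptic_loc :: "(real ^ 'n) set \<Rightarrow> (real ^ 'n \<Rightarrow> real ^ 'n ^ 'n) \<Rightarrow> bool" where
  "elliptic_loc U W \<longleftrightarrow> continuous_on U W \<and>
     (\<forall>C. compact C \<and> C \<subseteq> U \<longrightarrow> (\<exists>c>0. \<forall>x\<in>C. \<forall>\<xi>. c * (norm \<xi>)\<^sup>2 \<le> normA_sq W x \<xi>))"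

lemma elliptic_loc_nonneg:
  assumes "elliptic_loc U W" "x \<in> U"
  shows "0 \<le> normA_sq W x \<xi>"
proof -
  have "compact {x} \<and> {x} \<subseteq> U" using assms by auto
  then obtain c where "c > 0" "c * (norm \<xi>)\<^sup>2 \<le> normA_sq W x \<xi>"
    using assms(1) unfolding elliptic_loc_def by (metis singletonI)
  moreover have "0 \<le> c * (norm \<xi>)\<^sup>2" using \<open>c > 0\<close> by simp
  ultimately show ?thesis by linarith
qed

lemma continuous_on_normA_sq:
  assumes "continuous_on S W" "continuous_on S G"
  shows "continuous_on S (\<lambda>x. normA_sq W x (G x))"
  unfolding normA_sq_expand using assms by (intro continuous_intros)

text \<open>By uniform continuity the matrices at nearby points differ little, and by uniform ellipticity a small
change of the matrix is a small multiple of the form.\<close>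

lemma elliptic_loc_compare:
  fixes W :: "real ^ 'n \<Rightarrow> real ^ 'n ^ 'n"
  assumes W: "elliptic_loc U W" and D: "compact D" "D \<subseteq> U" and \<delta>: "\<delta> > 0"
  shows "\<exists>\<eta>>0. \<forall>x\<in>D. \<forall>y\<in>D. dist x y \<le> \<eta> \<longrightarrow> (\<forall>\<xi>. normA_sq W x \<xi> \<le> (1 + \<delta>) * normA_sq W y \<xi>)"
proof -
  obtain c where c: "c > 0" "\<And>x \<xi>. x \<in> D \<Longrightarrow> c * (norm \<xi>)\<^sup>2 \<le> normA_sq W x \<xi>"
    using W D by (auto simp: elliptic_loc_def dest!: spec[where x = D])
  define n where "n = real CARD('n)"
  have n: "n > 0" by (simp add: n_def)
  have "uniformly_continuous_on D W"
    using W D by (intro compact_uniformly_continuous) (auto simp: elliptic_loc_def intro: continuous_on_subset)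
  moreover have "\<delta> * c / n > 0" using \<delta> c n by simp
  ultimately obtain \<eta> where \<eta>: "\<eta> > 0" "\<And>x y. x \<in> D \<Longrightarrow> y \<in> D \<Longrightarrow> dist y x < \<eta> \<Longrightarrow> dist (W y) (W x) < \<delta> * c / n"
    unfolding uniformly_continuous_on_def by blast
  have "normA_sq W x \<xi> \<le> (1 + \<delta>) * normA_sq W y \<xi>" if xy: "x \<in> D" "y \<in> D" "dist x y \<le> \<eta> / 2" for x y \<xi>
  proof -
    have "dist (W x) (W y) < \<delta> * c / n" using \<eta> xy by auto
    then have "norm (W x - W y) \<le> \<delta> * c / n" by (simp add: dist_norm)
    then have "n * norm (W x - W y) \<le> \<delta> * c" using n by (simp add: field_simps)
    then have "n * norm (W x - W y) * (norm \<xi>)\<^sup>2 \<le> \<delta> * c * (norm \<xi>)\<^sup>2"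
      by (intro mult_right_mono) auto
    also have "\<dots> \<le> \<delta> * normA_sq W y \<xi>"
      using c(2)[OF xy(2), of \<xi>] \<delta> by (simp add: mult.assoc)
    finally have "n * norm (W x - W y) * (norm \<xi>)\<^sup>2 \<le> \<delta> * normA_sq W y \<xi>" .
    moreover have "normA_sq W x \<xi> - normA_sq W y \<xi> = normA_sq (\<lambda>_. W x - W y) x \<xi>"
      by (simp add: normA_sq_def matrix_vector_mult_diff_rdistrib inner_diff_left)
    moreover have "\<bar>normA_sq (\<lambda>_. W x - W y) x \<xi>\<bar> \<le> n * norm (W x - W y) * (norm \<xi>)\<^sup>2"
      using abs_normA_sq_le[of "\<lambda>_. W x - W y" x \<xi>] by (simp add: n_def)
    ultimately show ?thesis by (simp add: distrib_right)
  qed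
  then show ?thesis using \<eta>(1) by (intro exI[of _ "\<eta> / 2"]) auto
qed

lemma borel_measurable_normA_sq:
  fixes W :: "real ^ 'n \<Rightarrow> real ^ 'n ^ 'n"
  assumes "\<And>i j. (\<lambda>x. W x $ i $ j) \<in> borel_measurable M" "G \<in> borel_measurable M"
  shows "(\<lambda>x. normA_sq W x (G x)) \<in> borel_measurable M"
proof -
  have "(\<lambda>x. G x \<bullet> axis i 1) \<in> borel_measurable M" for i :: 'n
    by (intro borel_measurable_inner assms borel_measurable_const)
  then have [measurable]: "(\<lambda>x. G x $ i) \<in> borel_measurable M" for i by (simp add: inner_axis)
  note [measurable] = assms(1)
  show ?thesis unfolding normA_sq_expand by measurable
qed

lemma elliptic_loc_measurable:
  assumes "open U" "elliptic_loc U W"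
  shows "(\<lambda>x. W x $ i $ j) \<in> borel_measurable (lebesgue_on U)"
  using assms by (intro continuous_imp_measurable_on_sets_lebesgue) (auto simp: elliptic_loc_def intro!: continuous_intros)

section \<open>Limits of weighted inequalities\<close>

lemma ennreal_le_of_approx:
  assumes "\<And>\<delta> e. \<delta> > 0 \<Longrightarrow> e > 0 \<Longrightarrow> a \<le> ennreal (1 + \<delta>) * b + ennreal e"
  shows "a \<le> (b :: ennreal)"
proof (cases b)
  case (real r)
  show ?thesis
  proof (rule ennreal_le_epsilon)
    fix e :: real assume e: "e > 0"
    define \<delta> where "\<delta> = e / (2 * (r + 1))"
    have \<delta>: "\<delta> > 0" using e real by (simp add: \<delta>_def)
    have "\<delta> * r \<le> e / 2"
    proof -
      have "\<delta> * r \<le> \<delta> * (r + 1)" using \<delta> by simp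
      also have "\<dots> = e / 2" using real by (simp add: \<delta>_def field_simps)
      finally show ?thesis .
    qed
    have "a \<le> ennreal (1 + \<delta>) * b + ennreal (e / 2)" using assms[OF \<delta>, of "e / 2"] e by simp
    also have "\<dots> = ennreal ((1 + \<delta>) * r + e / 2)" using real \<delta> e by (simp add: ennreal_mult ennreal_plus)
    also have "\<dots> \<le> ennreal (r + e)" using \<open>\<delta> * r \<le> e / 2\<close> by (intro ennreal_leI) (simp add: distrib_right)
    also have "\<dots> = b + ennreal e" using real e by simp
    finally show "a \<le> b + ennreal e" .
  qed
qed simp

text \<open>A nonnegative sequence whose integrals tend to zero has a subsequence that tends to zero almost
everywhere; finitely many of the integrals may be infinite.\<close>

lemma L1_AE_subseq:
  fixes f :: "nat \<Rightarrow> 'a \<Rightarrow> real"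
  assumes m: "\<And>k. f k \<in> borel_measurable M" and nn: "\<And>k x. f k x \<ge> 0"
    and lim: "(\<lambda>k. \<integral>\<^sup>+x. ennreal (f k x) \<partial>M) \<longlonglongrightarrow> 0"
  shows "\<exists>r. strict_mono r \<and> (AE x in M. (\<lambda>k. f (r k) x) \<longlonglongrightarrow> 0)"
proof -
  have "\<forall>\<^sub>F k in sequentially. (\<integral>\<^sup>+x. ennreal (f k x) \<partial>M) < 1"
    using lim by (rule order_tendstoD) simp
  then obtain N where N: "\<And>k. k \<ge> N \<Longrightarrow> (\<integral>\<^sup>+x. ennreal (f k x) \<partial>M) < 1"
    unfolding eventually_sequentially by blast
  define u where "u k = f (k + N)" for k
  have int: "integrable M (u k)" for k
    unfolding u_def using N[of "k + N"] m nn
    by (intro integrableI_bounded) (auto simp: less_top[symmetric] top_unique intro: order_less_trans)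
  have eq: "ennreal (LINT x|M. norm (u k x)) = (\<integral>\<^sup>+x. ennreal (f (k + N) x) \<partial>M)" for k
    using nn_integral_eq_integral[OF int[of k]] nn by (simp add: u_def)
  have "(\<lambda>k. \<integral>\<^sup>+x. ennreal (f (k + N) x) \<partial>M) \<longlonglongrightarrow> 0" using lim by (rule LIMSEQ_ignore_initial_segment)
  then have "(\<lambda>k. ennreal (LINT x|M. norm (u k x))) \<longlonglongrightarrow> ennreal 0" unfolding eq by simp
  then have "(\<lambda>k. LINT x|M. norm (u k x)) \<longlonglongrightarrow> 0"
    by (subst (asm) tendsto_ennreal_iff) (auto intro!: always_eventually)
  from tendsto_L1_AE_subseq[OF int this] obtain r where r: "strict_mono r" "AE x in M. (\<lambda>k. u (r k) x) \<longlonglongrightarrow> 0"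
    by blast
  have "strict_mono (\<lambda>k. r k + N)" using r(1) by (simp add: strict_mono_def)
  then show ?thesis using r(2) unfolding u_def by (intro exI[of _ "\<lambda>k. r k + N"]) simp
qed

lemma fatou_bound:
  fixes f :: "nat \<Rightarrow> 'a \<Rightarrow> real"
  assumes m: "\<And>k. f k \<in> borel_measurable M" "R \<in> borel_measurable M"
    and lim: "AE x in M. (\<lambda>k. f k x) \<longlonglongrightarrow> u x"
    and bd: "\<And>k. (\<integral>\<^sup>+x. ennreal (R x * (f k x)\<^sup>2) \<partial>M) \<le> B"
  shows "(\<integral>\<^sup>+x. ennreal (R x * (u x)\<^sup>2) \<partial>M) \<le> B"
proof -
  note [measurable] = m
  have "(\<integral>\<^sup>+x. ennreal (R x * (u x)\<^sup>2) \<partial>M) = (\<integral>\<^sup>+x. liminf (\<lambda>k. ennreal (R x * (f k x)\<^sup>2)) \<partial>M)"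
  proof (rule nn_integral_cong_AE)
    show "AE x in M. ennreal (R x * (u x)\<^sup>2) = liminf (\<lambda>k. ennreal (R x * (f k x)\<^sup>2))"
      using lim
    proof (rule eventually_mono)
      fix x assume "(\<lambda>k. f k x) \<longlonglongrightarrow> u x"
      then have "(\<lambda>k. ennreal (R x * (f k x)\<^sup>2)) \<longlonglongrightarrow> ennreal (R x * (u x)\<^sup>2)"
        by (intro tendsto_ennrealI tendsto_intros)
      then show "ennreal (R x * (u x)\<^sup>2) = liminf (\<lambda>k. ennreal (R x * (f k x)\<^sup>2))"
        using lim_imp_Liminf[OF trivial_limit_sequentially] by metis
    qed
  qed
  also have "\<dots> \<le> liminf (\<lambda>k. \<integral>\<^sup>+x. ennreal (R x * (f k x)\<^sup>2) \<partial>M)"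
    by (rule nn_integral_liminf) measurable
  also have "\<dots> \<le> liminf (\<lambda>k::nat. B)"
    by (intro Liminf_mono always_eventually allI bd)
  also have "\<dots> = B" by (simp add: Liminf_const)
  finally show ?thesis .
qed

lemma nn_integral_on:
  assumes "S \<in> sets lebesgue"
  shows "(\<integral>\<^sup>+x\<in>S. F x \<partial>lebesgue) = (\<integral>\<^sup>+x. F x \<partial>lebesgue_on S)"
  using assms by (subst nn_integral_restrict_space) auto

lemma nn_integral_open_le_of_compact:
  fixes U :: "(real ^ 'n) set"
  assumes U: "open U" and F: "F \<in> borel_measurable (lebesgue_on U)"
    and bd: "\<And>C. compact C \<Longrightarrow> C \<subseteq> U \<Longrightarrow> (\<integral>\<^sup>+x\<in>C. F x \<partial>lebesgue) \<le> B"
  shows "(\<integral>\<^sup>+x\<in>U. F x \<partial>lebesgue) \<le> B"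
proof -
  obtain C :: "nat \<Rightarrow> (real ^ 'n) set" where C: "\<forall>n. compact (C n) \<and> C n \<subseteq> U" "(\<Union>n. C n) = U" "incseq C"
    using compact_exhaustion[OF U] by blast
  have Um: "U \<in> sets lebesgue" using U by auto
  have Cm: "C n \<in> sets lebesgue" for n using C(1) by (simp add: lmeasurable_compact fmeasurableD)
  have FU: "(\<lambda>x. F x * indicator U x) \<in> borel_measurable lebesgue"
    using F Um by (subst (asm) borel_measurable_restrict_space_iff_ennreal) auto
  have FC: "(\<lambda>x. F x * indicator (C n) x) \<in> borel_measurable lebesgue" for n
  proof -
    have "(\<lambda>x. (F x * indicator U x) * indicator (C n) x) \<in> borel_measurable lebesgue"
      using FU Cm[of n] by measurable
    moreover have "(\<lambda>x. (F x * indicator U x) * indicator (C n) x) = (\<lambda>x. F x * indicator (C n) x)"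
    proof
      show "(F x * indicator U x) * indicator (C n) x = F x * indicator (C n) x" for x
        using C(1)[rule_format, of n] by (cases "x \<in> C n") (auto dest: subsetD)
    qed
    ultimately show ?thesis by simp
  qed
  have "(\<integral>\<^sup>+x\<in>U. F x \<partial>lebesgue) = (\<integral>\<^sup>+x. (SUP n. F x * indicator (C n) x) \<partial>lebesgue)"
  proof (rule nn_integral_cong)
    fix x
    show "F x * indicator U x = (SUP n. F x * indicator (C n) x)"
    proof (cases "x \<in> U")
      case True
      then obtain n where n: "x \<in> C n" using C(2) by blast
      have "(SUP n. F x * indicator (C n) x) = F x"
      proof (rule antisym)
        show "(SUP n. F x * indicator (C n) x) \<le> F x"
          by (rule SUP_least) (simp add: indicator_def)
        show "F x \<le> (SUP n. F x * indicator (C n) x)"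
          by (rule SUP_upper2[of n]) (use n in auto)
      qed
      then show ?thesis using True by simp
    next
      case False
      then have "x \<notin> C n" for n using C(1) by blast
      then show ?thesis using False by simp
    qed
  qed
  also have "\<dots> = (SUP n. \<integral>\<^sup>+x. F x * indicator (C n) x \<partial>lebesgue)"
  proof (rule nn_integral_monotone_convergence_SUP)
    show "incseq (\<lambda>n x. F x * indicator (C n) x)"
    proof (rule incseq_SucI, rule le_funI)
      fix n x
      have "C n \<subseteq> C (Suc n)" using C(3) by (rule incseq_SucD)
      then show "F x * indicator (C n) x \<le> F x * indicator (C (Suc n)) x"
        by (intro mult_left_mono) (auto simp: indicator_def)
    qed
  qed (rule FC)
  also have "\<dots> \<le> B"
    by (rule SUP_least) (use bd C(1) in auto)
  finally show ?thesis .
qed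

text \<open>The inequality \<open>\<integral>\<^sub>U R u\<^sup>2 \<le> \<integral>\<^sub>U (W G) \<bullet> G\<close>, where \<open>G\<close> stands for the gradient of \<open>u\<close> in a sense
that depends on the class of functions considered.\<close>

definition weighted_ineq ::
  "(real ^ 'n) set \<Rightarrow> (real ^ 'n \<Rightarrow> real ^ 'n ^ 'n) \<Rightarrow> (real ^ 'n \<Rightarrow> real) \<Rightarrow> (real ^ 'n \<Rightarrow> real)
     \<Rightarrow> (real ^ 'n \<Rightarrow> real ^ 'n) \<Rightarrow> bool" where
  "weighted_ineq U W R u G \<longleftrightarrow> (\<integral>\<^sup>+x\<in>U. ennreal (R x * (u x)\<^sup>2) \<partial>lebesgue)
     \<le> (\<integral>\<^sup>+x\<in>U. ennreal (normA_sq W x (G x)) \<partial>lebesgue)"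

text \<open>The inequality survives limits with convergence of the functions in local \<open>L\<^sup>2\<close> and of the gradients
in the weighted \<open>L\<^sup>2\<close> norm. The left side is treated by Fatou's lemma on compact sets and monotone
convergence.\<close>

lemma limit_ineq:
  fixes U :: "(real ^ 'n) set" and W :: "real ^ 'n \<Rightarrow> real ^ 'n ^ 'n"
  assumes U: "open U" and W: "elliptic_loc U W" and R: "continuous_on U R"
    and s: "\<And>k. s k \<in> borel_measurable (lebesgue_on U)" and u: "u \<in> borel_measurable (lebesgue_on U)"
    and g: "\<And>k. g k \<in> borel_measurable (lebesgue_on U)" and G: "G \<in> borel_measurable (lebesgue_on U)"
    and slim: "\<And>C. compact C \<Longrightarrow> C \<subseteq> U \<Longrightarrow> (\<lambda>k. \<integral>\<^sup>+x\<in>C. ennreal ((s k x - u x)\<^sup>2) \<partial>lebesgue) \<longlonglongrightarrow> 0"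
    and glim: "(\<lambda>k. \<integral>\<^sup>+x\<in>U. ennreal (normA_sq W x (g k x - G x)) \<partial>lebesgue) \<longlonglongrightarrow> 0"
    and ineq: "\<And>k. weighted_ineq U W R (s k) (g k)"
  shows "weighted_ineq U W R u G"
  unfolding weighted_ineq_def
proof (rule ennreal_le_of_approx)
  let ?L = "\<integral>\<^sup>+x\<in>U. ennreal (normA_sq W x (G x)) \<partial>lebesgue"
  fix \<delta> e :: real assume \<delta>: "\<delta> > 0" and e: "e > 0"
  have Um: "U \<in> sets lebesgue" using U by auto
  have Rm: "R \<in> borel_measurable (lebesgue_on U)"
    using R Um by (rule continuous_imp_measurable_on_sets_lebesgue)
  note Wm = elliptic_loc_measurable[OF U W]
  define err where "err k = (\<integral>\<^sup>+x\<in>U. ennreal (normA_sq W x (g k x - G x)) \<partial>lebesgue)" for k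
  have qm [measurable]: "(\<lambda>x. normA_sq W x (H x)) \<in> borel_measurable (lebesgue_on U)"
    if "H \<in> borel_measurable (lebesgue_on U)" for H
    by (rule borel_measurable_normA_sq[OF Wm that])
  have step: "(\<integral>\<^sup>+x\<in>U. ennreal (normA_sq W x (g k x)) \<partial>lebesgue) \<le> ennreal (1 + \<delta>) * ?L + ennreal (1 + 1 / \<delta>) * err k" for k
  proof -
    have gG: "(\<lambda>x. g k x - G x) \<in> borel_measurable (lebesgue_on U)" using g G by measurable
    note [measurable] = qm[OF G] qm[OF gG]
    have "(\<integral>\<^sup>+x. ennreal (normA_sq W x (g k x)) \<partial>lebesgue_on U)
      \<le> (\<integral>\<^sup>+x. ennreal (1 + \<delta>) * ennreal (normA_sq W x (G x)) + ennreal (1 + 1 / \<delta>) * ennreal (normA_sq W x (g k x - G x)) \<partial>lebesgue_on U)"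
    proof (rule nn_integral_mono)
      fix x assume "x \<in> space (lebesgue_on U)"
      then have pos: "0 \<le> normA_sq W x \<zeta>" for \<zeta> using elliptic_loc_nonneg[OF W, of x \<zeta>] by simp
      have "ennreal (normA_sq W x (g k x)) \<le> ennreal ((1 + \<delta>) * normA_sq W x (G x) + (1 + 1 / \<delta>) * normA_sq W x (g k x - G x))"
        by (intro ennreal_leI normA_sq_young pos \<delta>)
      also have "\<dots> = ennreal (1 + \<delta>) * ennreal (normA_sq W x (G x)) + ennreal (1 + 1 / \<delta>) * ennreal (normA_sq W x (g k x - G x))"
        using \<delta> pos by (simp add: ennreal_plus ennreal_mult)
      finally show "ennreal (normA_sq W x (g k x)) \<le> \<dots>" .
    qed
    also have "\<dots> = ennreal (1 + \<delta>) * (\<integral>\<^sup>+x. ennreal (normA_sq W x (G x)) \<partial>lebesgue_on U)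
        + ennreal (1 + 1 / \<delta>) * (\<integral>\<^sup>+x. ennreal (normA_sq W x (g k x - G x)) \<partial>lebesgue_on U)"
      by (subst nn_integral_add) (auto simp: nn_integral_cmult)
    finally show ?thesis unfolding err_def nn_integral_on[OF Um] .
  qed
  have "(\<lambda>k. ennreal (1 + 1 / \<delta>) * err k) \<longlonglongrightarrow> ennreal (1 + 1 / \<delta>) * 0"
    using glim unfolding err_def by (intro ennreal_tendsto_cmult) auto
  then have "\<forall>\<^sub>F k in sequentially. ennreal (1 + 1 / \<delta>) * err k < ennreal e"
    using e by (intro order_tendstoD(2)) auto
  then obtain N where N: "\<And>k. k \<ge> N \<Longrightarrow> ennreal (1 + 1 / \<delta>) * err k < ennreal e"
    unfolding eventually_sequentially by blast
  show "(\<integral>\<^sup>+x\<in>U. ennreal (R x * (u x)\<^sup>2) \<partial>lebesgue) \<le> ennreal (1 + \<delta>) * ?L + ennreal e" (is "_ \<le> ?B")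
  proof (rule nn_integral_open_le_of_compact[OF U])
    show "(\<lambda>x. ennreal (R x * (u x)\<^sup>2)) \<in> borel_measurable (lebesgue_on U)"
      using Rm u by measurable
    fix C assume C: "compact C" "C \<subseteq> U"
    have Cm: "C \<in> sets lebesgue" using C(1) by (simp add: lmeasurable_compact fmeasurableD)
    have sub: "h \<in> borel_measurable (lebesgue_on C)" if "h \<in> borel_measurable (lebesgue_on U)" for h :: "real ^ 'n \<Rightarrow> real"
      using measurable_restrict_mono[OF that C(2)] .
    note [measurable] = sub[OF s] sub[OF u] sub[OF Rm]
    have "\<exists>r. strict_mono r \<and> (AE x in lebesgue_on C. (\<lambda>k. (s (r k) x - u x)\<^sup>2) \<longlonglongrightarrow> 0)"
      using slim[OF C] unfolding nn_integral_on[OF Cm] by (intro L1_AE_subseq) auto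
    then obtain r where r: "strict_mono r" "AE x in lebesgue_on C. (\<lambda>k. (s (r k) x - u x)\<^sup>2) \<longlonglongrightarrow> 0"
      by blast
    show "(\<integral>\<^sup>+x\<in>C. ennreal (R x * (u x)\<^sup>2) \<partial>lebesgue) \<le> ?B"
      unfolding nn_integral_on[OF Cm]
    proof (rule fatou_bound[where f = "\<lambda>k. s (r (k + N))"])
      show "AE x in lebesgue_on C. (\<lambda>k. s (r (k + N)) x) \<longlonglongrightarrow> u x"
        using r(2)
      proof (rule eventually_mono)
        fix x assume "(\<lambda>k. (s (r k) x - u x)\<^sup>2) \<longlonglongrightarrow> 0"
        then have "(\<lambda>k. sqrt ((s (r k) x - u x)\<^sup>2)) \<longlonglongrightarrow> sqrt 0" by (rule tendsto_real_sqrt)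
        then have "(\<lambda>k. s (r k) x - u x) \<longlonglongrightarrow> 0" by (simp add: tendsto_rabs_zero_iff)
        then have "(\<lambda>k. s (r k) x) \<longlonglongrightarrow> u x" by (simp add: LIM_zero_iff)
        then show "(\<lambda>k. s (r (k + N)) x) \<longlonglongrightarrow> u x"
          by (rule LIMSEQ_ignore_initial_segment)
      qed
      fix k
      have kN: "r (k + N) \<ge> N" using seq_suble[OF r(1), of "k + N"] by simp
      have "(\<integral>\<^sup>+x. ennreal (R x * (s (r (k + N)) x)\<^sup>2) \<partial>lebesgue_on C)
        = (\<integral>\<^sup>+x\<in>C. ennreal (R x * (s (r (k + N)) x)\<^sup>2) \<partial>lebesgue)" by (simp add: nn_integral_on[OF Cm])
      also have "\<dots> \<le> (\<integral>\<^sup>+x\<in>U. ennreal (R x * (s (r (k + N)) x)\<^sup>2) \<partial>lebesgue)"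
        using C(2) by (intro nn_integral_mono mult_left_mono) (auto simp: indicator_def)
      also have "\<dots> \<le> (\<integral>\<^sup>+x\<in>U. ennreal (normA_sq W x (g (r (k + N)) x)) \<partial>lebesgue)"
        by (rule ineq[unfolded weighted_ineq_def])
      also have "\<dots> \<le> ennreal (1 + \<delta>) * ?L + ennreal (1 + 1 / \<delta>) * err (r (k + N))" by (rule step)
      also have "\<dots> \<le> ?B" using N[OF kN] by (intro add_left_mono) (simp add: less_imp_le)
      finally show "(\<integral>\<^sup>+x. ennreal (R x * (s (r (k + N)) x)\<^sup>2) \<partial>lebesgue_on C) \<le> ?B" .
    qed measurable
  qed
qed

section \<open>Mollification and the energy\<close>

text \<open>Jensen's inequality for a nonnegative quadratic form: the form lies above its tangent plane
at the mean.\<close>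

lemma jensen_quadratic:
  fixes g :: "'a \<Rightarrow> real ^ 'n" and B :: "real ^ 'n ^ 'n"
  assumes pos: "\<And>\<zeta>. 0 \<le> (B *v \<zeta>) \<bullet> \<zeta>"
    and p: "\<And>y. 0 \<le> p y" "integrable M p" "(LINT y|M. p y) = 1"
    and pg: "integrable M (\<lambda>y. p y *\<^sub>R g y)" and g: "g \<in> borel_measurable M"
  shows "ennreal ((B *v (LINT y|M. p y *\<^sub>R g y)) \<bullet> (LINT y|M. p y *\<^sub>R g y))
      \<le> (\<integral>\<^sup>+y. ennreal (p y * ((B *v g y) \<bullet> g y)) \<partial>M)"
proof (cases "(\<integral>\<^sup>+y. ennreal (p y * ((B *v g y) \<bullet> g y)) \<partial>M) = \<infinity>")
  case False
  define m where "m = (LINT y|M. p y *\<^sub>R g y)"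
  define L where "L = B *v m + transpose B *v m"
  have qm: "(\<lambda>y. (B *v g y) \<bullet> g y) \<in> borel_measurable M"
    by (rule borel_measurable_continuous_on[OF _ g])
      (intro continuous_on_inner linear_continuous_on matrix_vector_mul_bounded_linear continuous_on_id)
  have [measurable]: "p \<in> borel_measurable M" using p(2) by (rule borel_measurable_integrable)
  have int: "integrable M (\<lambda>y. p y * ((B *v g y) \<bullet> g y))"
    using False qm pos p(1) by (intro integrableI_nonneg) (auto simp: less_top)
  have tang: "(B *v m) \<bullet> m + L \<bullet> (\<xi> - m) \<le> (B *v \<xi>) \<bullet> \<xi>" for \<xi>
  proof -
    have "(B *v (\<xi> - m)) \<bullet> m = (transpose B *v m) \<bullet> (\<xi> - m)"
      by (metis dot_lmul_matrix inner_commute vector_transpose_matrix transpose_transpose)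
    then have "(B *v \<xi>) \<bullet> \<xi> = (B *v m) \<bullet> m + L \<bullet> (\<xi> - m) + (B *v (\<xi> - m)) \<bullet> (\<xi> - m)"
      using normA_sq_add[of "\<lambda>_. B" undefined m "\<xi> - m"] by (simp add: normA_sq_def L_def inner_add_left)
    then show ?thesis using pos[of "\<xi> - m"] by linarith
  qed
  have i1: "integrable M (\<lambda>y. p y *\<^sub>R (g y - m))"
    using pg p(2) by (simp add: scaleR_diff_right)
  have z: "(LINT y|M. p y *\<^sub>R (g y - m)) = 0"
    using pg p(2,3) by (simp add: scaleR_diff_right m_def)
  have i2: "integrable M (\<lambda>y. L \<bullet> (p y *\<^sub>R (g y - m)))" using i1 by (intro integrable_inner_right) 
  have "(LINT y|M. p y * ((B *v m) \<bullet> m) + L \<bullet> (p y *\<^sub>R (g y - m))) = (LINT y|M. p y * ((B *v m) \<bullet> m)) + (LINT y|M. L \<bullet> (p y *\<^sub>R (g y - m)))"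
    using i2 p(2) by (intro Bochner_Integration.integral_add) auto
  also have "(LINT y|M. L \<bullet> (p y *\<^sub>R (g y - m))) = L \<bullet> (LINT y|M. p y *\<^sub>R (g y - m))"
    by (rule integral_inner_right[OF i1])
  finally have eq: "(LINT y|M. p y * ((B *v m) \<bullet> m) + L \<bullet> (p y *\<^sub>R (g y - m))) = (B *v m) \<bullet> m"
    unfolding z using p(3) by simp
  have "(LINT y|M. p y * ((B *v m) \<bullet> m) + L \<bullet> (p y *\<^sub>R (g y - m))) \<le> (LINT y|M. p y * ((B *v g y) \<bullet> g y))"
  proof (rule integral_mono)
    show "integrable M (\<lambda>y. p y * ((B *v m) \<bullet> m) + L \<bullet> (p y *\<^sub>R (g y - m)))"
      by (rule Bochner_Integration.integrable_add[OF integrable_mult_left i2]) (rule p(2))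
    fix y
    show "p y * ((B *v m) \<bullet> m) + L \<bullet> (p y *\<^sub>R (g y - m)) \<le> p y * ((B *v g y) \<bullet> g y)"
      using mult_left_mono[OF tang[of "g y"] p(1)[of y]]
      unfolding distrib_left inner_scaleR_right .
  qed (rule int)
  then have "(B *v m) \<bullet> m \<le> (LINT y|M. p y * ((B *v g y) \<bullet> g y))" unfolding eq .
  then have "ennreal ((B *v m) \<bullet> m) \<le> ennreal (LINT y|M. p y * ((B *v g y) \<bullet> g y))" by (rule ennreal_leI)
  also have "\<dots> = (\<integral>\<^sup>+y. ennreal (p y * ((B *v g y) \<bullet> g y)) \<partial>M)"
    by (rule nn_integral_eq_integral[symmetric, OF int]) (use pos p(1) in auto)
  finally show ?thesis unfolding m_def .
qed simp

text \<open>Tonelli's theorem needs joint Borel measurability, hence the passage to a Borel representative of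
\<open>F\<close>.\<close>

lemma nn_integral_conv_mollifier:
  fixes F :: "real ^ 'n \<Rightarrow> ennreal"
  assumes F: "F \<in> borel_measurable lebesgue" and \<rho>: "mollifier \<epsilon> \<rho>"
  shows "(\<integral>\<^sup>+x. (\<integral>\<^sup>+y. ennreal (\<rho> (x - y)) * F y \<partial>lebesgue) \<partial>lebesgue) = (\<integral>\<^sup>+y. F y \<partial>lebesgue)"
proof -
  obtain F' where F': "F' \<in> borel_measurable lborel" "AE x in lborel. F x = F' x"
    using completion_ex_borel_measurable[OF F] by blast
  note [measurable] = F'(1)
  have [measurable]: "\<rho> \<in> borel_measurable borel"
    using mollifierD(5)[OF \<rho>] by (rule borel_measurable_continuous_onI)
  have in1: "(\<integral>\<^sup>+y. ennreal (\<rho> (x - y)) * F y \<partial>lborel) = (\<integral>\<^sup>+y. ennreal (\<rho> (x - y)) * F' y \<partial>lborel)" for x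
    by (rule nn_integral_cong_AE) (use F'(2) in auto)
  have mass: "(\<integral>\<^sup>+x. ennreal (\<rho> (x - y)) \<partial>lborel) = 1" for y
  proof -
    have sw: "\<rho> (x - y) = \<rho> (y - x)" for x using mollifierD(4)[OF \<rho>, of "y - x"] by simp
    show ?thesis
      unfolding sw using nn_integral_eq_integral[OF mollifier_translate(1)[OF \<rho>, of y]]
        mollifier_translate(2)[OF \<rho>, of y] mollifierD(2)[OF \<rho>] by simp
  qed
  have "(\<integral>\<^sup>+x. (\<integral>\<^sup>+y. ennreal (\<rho> (x - y)) * F y \<partial>lebesgue) \<partial>lebesgue)
      = (\<integral>\<^sup>+x. (\<integral>\<^sup>+y. ennreal (\<rho> (x - y)) * F' y \<partial>lborel) \<partial>lborel)"
    unfolding nn_integral_completion in1 ..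
  also have "\<dots> = (\<integral>\<^sup>+y. (\<integral>\<^sup>+x. ennreal (\<rho> (x - y)) * F' y \<partial>lborel) \<partial>lborel)"
    by (rule lborel_pair.Fubini') measurable
  also have "\<dots> = (\<integral>\<^sup>+y. (\<integral>\<^sup>+x. ennreal (\<rho> (x - y)) \<partial>lborel) * F' y \<partial>lborel)"
    by (subst nn_integral_multc) auto
  also have "\<dots> = (\<integral>\<^sup>+y. F' y \<partial>lborel)" unfolding mass by simp
  also have "\<dots> = (\<integral>\<^sup>+y. F y \<partial>lebesgue)"
    unfolding nn_integral_completion by (rule nn_integral_cong_AE) (use F'(2) in auto)
  finally show ?thesis .
qed

lemma
  fixes f :: "real ^ 'n \<Rightarrow> 'b::{banach, second_countable_topology}"
  assumes U: "U \<in> sets lebesgue" and f: "integrable lborel f" and off: "\<And>x. x \<notin> U \<Longrightarrow> f x = 0"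
  shows integrable_lebesgue_on_of_lborel: "integrable (lebesgue_on U) f"
    and integral_lebesgue_on_of_lborel: "(LINT x|lebesgue_on U. f x) = (LINT x|lborel. f x)"
proof -
  have eq: "(\<lambda>x. indicator U x *\<^sub>R f x) = f"
  proof
    show "indicator U x *\<^sub>R f x = f x" for x using off[of x] by (cases "x \<in> U") auto
  qed
  have fm: "f \<in> borel_measurable lborel" using f by (rule borel_measurable_integrable)
  have Us: "U \<inter> space lebesgue \<in> sets lebesgue" using U by simp
  show "integrable (lebesgue_on U) f"
    unfolding integrable_restrict_space[OF Us] eq integrable_completion[OF fm] by (rule f)
  show "(LINT x|lebesgue_on U. f x) = (LINT x|lborel. f x)"
    unfolding integral_restrict_space[OF Us] eq integral_completion[OF fm] ..
qed

lemma integral_lebesgue_on_eq_set_integral: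
  fixes f :: "real ^ 'n \<Rightarrow> 'b::{banach, second_countable_topology}"
  assumes "U \<in> sets lebesgue"
  shows "(LINT x|lebesgue_on U. f x) = (LINT x:U|lebesgue. f x)"
  using assms by (simp add: integral_restrict_space set_lebesgue_integral_def)

lemma integrable_lebesgue_on_iff_set_integrable:
  fixes f :: "real ^ 'n \<Rightarrow> 'b::{banach, second_countable_topology}"
  assumes "U \<in> sets lebesgue"
  shows "integrable (lebesgue_on U) f \<longleftrightarrow> set_integrable lebesgue U f"
  using assms by (simp add: integrable_restrict_space set_integrable_def)

lemma locally_integrable_measurable_on:
  fixes f :: "real ^ 'n \<Rightarrow> 'b::{banach, second_countable_topology}"
  assumes "open U" "locally_integrable U f"
  shows "f \<in> borel_measurable (lebesgue_on U)"
  using locally_integrable_measurable[OF assms] assms(1)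
  by (subst borel_measurable_restrict_space_iff) auto

lemma integral_component:
  fixes f :: "'a \<Rightarrow> real ^ 'n"
  assumes "integrable M f"
  shows "(LINT x|M. f x) $ i = (LINT x|M. f x $ i)"
  using integral_bounded_linear[OF bounded_linear_vec_nth assms, of i] by simp

lemma Cc_lipschitzD:
  assumes "s \<in> Cc_lipschitz U"
  shows "continuous_on S s" "integrable lborel s"
proof -
  obtain L where L: "L-lipschitz_on UNIV s" using assms by (auto simp: Cc_lipschitz_def)
  obtain C where C: "compact C" "\<And>x. x \<notin> C \<Longrightarrow> s x = 0"
    using assms by (auto simp: Cc_lipschitz_def compact_support_in_def)
  have c: "continuous_on UNIV s" using L by (rule lipschitz_on_continuous_on)
  then show "continuous_on S s" using continuous_on_subset by blast
  show "integrable lborel s"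
    by (rule integrable_continuous_compact_support[OF c C(1) subset_UNIV C(2)])
qed

text \<open>Pointwise bound for the energy density of a mollification: Jensen's inequality with the form
frozen at \<open>x\<close>, followed by a comparison with the form at the point of integration.\<close>

lemma normA_sq_grad_conv_le:
  fixes U :: "(real ^ 'n) set" and W :: "real ^ 'n \<Rightarrow> real ^ 'n ^ 'n"
  assumes U: "open U" and W: "elliptic_loc U W" and s: "s \<in> Cc_lipschitz U" and g: "weak_gradient U s g"
    and \<rho>: "mollifier \<epsilon> \<rho>" and x: "x \<in> U" "cball x \<epsilon> \<subseteq> U" and \<delta>: "\<delta> > 0"
    and cmp: "\<And>y \<xi>. dist x y \<le> \<epsilon> \<Longrightarrow> normA_sq W x \<xi> \<le> (1 + \<delta>) * normA_sq W y \<xi>"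
  shows "ennreal (normA_sq W x (grad (conv s \<rho>) x))
    \<le> (\<integral>\<^sup>+y\<in>U. ennreal (\<rho> (x - y)) * ennreal ((1 + \<delta>) * normA_sq W y (g y)) \<partial>lebesgue)"
proof -
  have Um: "U \<in> sets lebesgue" using U by auto
  define p where "p y = \<rho> (x - y)" for y
  have s0: "s y = 0" if "y \<notin> U" for y
    using s that by (auto simp: Cc_lipschitz_def compact_support_in_def)
  have p0: "0 \<le> p y" for y using mollifierD(2)[OF \<rho>] by (simp add: p_def)
  have poff: "p y = 0" if "y \<notin> cball x \<epsilon>" for y
    using mollifierD(3)[OF \<rho>, of "x - y"] that by (simp add: p_def dist_norm)
  have poffU: "p y = 0" if "y \<notin> U" for y using that x poff by blast
  have pcont: "continuous_on U p"
    unfolding p_def[abs_def] by (rule bump_class_continuous[OF bump_class_reflect[OF mollifierD(1)[OF \<rho>]]])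
  have pl: "integrable lborel p" "(LINT y|lborel. p y) = 1"
    unfolding p_def[abs_def] by (rule mollifier_translate[OF \<rho>])+
  have pi: "integrable (lebesgue_on U) p" "(LINT y|lebesgue_on U. p y) = 1"
    using integrable_lebesgue_on_of_lborel[OF Um pl(1) poffU] integral_lebesgue_on_of_lborel[OF Um pl(1) poffU] pl(2)
    by simp_all
  have lg: "locally_integrable U g" using g by (simp add: weak_gradient_def)
  have gm: "g \<in> borel_measurable (lebesgue_on U)" by (rule locally_integrable_measurable_on[OF U lg])
  have pg: "integrable (lebesgue_on U) (\<lambda>y. p y *\<^sub>R g y)"
    unfolding integrable_lebesgue_on_iff_set_integrable[OF Um]
    by (rule integrable_locally_integrable_mult(2)[OF lg pcont compact_cball x(2) poff])
  have gr: "grad (conv s \<rho>) x = (LINT y|lebesgue_on U. p y *\<^sub>R g y)"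
  proof (subst vec_eq_iff, rule allI)
    fix i
    have "grad (conv s \<rho>) x $ i = (LINT y:U|lebesgue. g y $ i * p y)"
      unfolding p_def by (rule grad_conv_weak[OF Cc_lipschitzD(2)[OF s] s0 g \<rho> x(2)])
    also have "\<dots> = (LINT y|lebesgue_on U. (p y *\<^sub>R g y) $ i)"
      unfolding integral_lebesgue_on_eq_set_integral[OF Um] by (simp add: mult.commute)
    also have "\<dots> = (LINT y|lebesgue_on U. p y *\<^sub>R g y) $ i"
      by (rule integral_component[OF pg, symmetric])
    finally show "grad (conv s \<rho>) x $ i = (LINT y|lebesgue_on U. p y *\<^sub>R g y) $ i" .
  qed
  have pos: "0 \<le> (W x *v \<zeta>) \<bullet> \<zeta>" for \<zeta>
    using elliptic_loc_nonneg[OF W x(1), of \<zeta>] by (simp add: normA_sq_def)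
  have "ennreal (normA_sq W x (grad (conv s \<rho>) x)) \<le> (\<integral>\<^sup>+y. ennreal (p y * ((W x *v g y) \<bullet> g y)) \<partial>lebesgue_on U)"
    unfolding normA_sq_def gr by (rule jensen_quadratic[OF pos p0 pi pg gm])
  also have "\<dots> \<le> (\<integral>\<^sup>+y. ennreal (p y) * ennreal ((1 + \<delta>) * normA_sq W y (g y)) \<partial>lebesgue_on U)"
  proof (rule nn_integral_mono)
    fix y assume "y \<in> space (lebesgue_on U)"
    have "p y * ((W x *v g y) \<bullet> g y) \<le> p y * ((1 + \<delta>) * normA_sq W y (g y))"
    proof (cases "dist x y \<le> \<epsilon>")
      case True
      then show ?thesis using cmp[OF True, of "g y"] p0[of y] by (intro mult_left_mono) (simp_all add: normA_sq_def)
    next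
      case False
      then show ?thesis using poff[of y] by simp
    qed
    then show "ennreal (p y * ((W x *v g y) \<bullet> g y)) \<le> ennreal (p y) * ennreal ((1 + \<delta>) * normA_sq W y (g y))"
      using p0[of y] by (simp add: ennreal_mult'[symmetric] ennreal_leI)
  qed
  finally show ?thesis unfolding p_def nn_integral_on[OF Um] .
qed

text \<open>The inequality passes from test functions to Lipschitz functions with compact support. The
mollifications converge uniformly, and by Jensen's inequality and Tonelli's theorem their energies
exceed the energy of the limit at most by a factor close to one, so strong convergence of the gradients
is not needed.\<close>

theorem mollify_ineq:
  fixes U :: "(real ^ 'n) set" and W :: "real ^ 'n \<Rightarrow> real ^ 'n ^ 'n"
  assumes U: "open U" and W: "elliptic_loc U W" and R: "continuous_on U R"
    and ineq: "\<And>\<phi>. \<phi> \<in> Cc_smooth U \<Longrightarrow> weighted_ineq U W R \<phi> (grad \<phi>)"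
    and s: "s \<in> Cc_lipschitz U" and g: "weak_gradient U s g"
  shows "weighted_ineq U W R s g"
  unfolding weighted_ineq_def
proof (rule ennreal_le_of_approx)
  let ?L = "\<integral>\<^sup>+x\<in>U. ennreal (normA_sq W x (g x)) \<partial>lebesgue"
  fix \<delta> e :: real assume \<delta>: "\<delta> > 0" and e: "e > 0"
  have Um: "U \<in> sets lebesgue" using U by auto
  have Rm: "R \<in> borel_measurable (lebesgue_on U)"
    using R Um by (rule continuous_imp_measurable_on_sets_lebesgue)
  obtain L where L: "L-lipschitz_on UNIV s" using s by (auto simp: Cc_lipschitz_def)
  obtain C where C: "compact C" "C \<subseteq> U" "\<And>x. x \<notin> C \<Longrightarrow> s x = 0"
    using s by (auto simp: Cc_lipschitz_def compact_support_in_def)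
  obtain e0 where e0: "e0 > 0" "thicken C e0 \<subseteq> U"
    using compact_subset_open_imp_cball_epsilon_subset[OF C(1) U C(2)] unfolding thicken_def by metis
  define D where "D = thicken C e0"
  have D: "compact D" "D \<subseteq> U" using compact_thicken[OF C(1)] e0 by (auto simp: D_def)
  obtain \<eta> where \<eta>: "\<eta> > 0" "\<And>x y \<xi>. x \<in> D \<Longrightarrow> y \<in> D \<Longrightarrow> dist x y \<le> \<eta> \<Longrightarrow> normA_sq W x \<xi> \<le> (1 + \<delta>) * normA_sq W y \<xi>"
    using elliptic_loc_compare[OF W D \<delta>] by auto
  \<comment> \<open>all points within \<open>2 * d\<close> of the support lie in \<open>D\<close>, where the forms at points at distance at most \<open>d\<close> are comparable\<close>
  define d where "d = min (e0 / 2) \<eta>"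
  have d: "d > 0" "d \<le> e0 / 2" "d \<le> \<eta>" using e0 \<eta> by (auto simp: d_def)
  define \<epsilon> where "\<epsilon> k = d / real (Suc k)" for k
  have "d / real (Suc k) \<le> d" for k using d(1) by (simp add: field_simps)
  then have \<epsilon>: "\<epsilon> k > 0" "\<epsilon> k \<le> d" for k using d(1) by (auto simp: \<epsilon>_def)
  have \<epsilon>0: "\<epsilon> \<longlonglongrightarrow> 0"
    unfolding \<epsilon>_def using LIMSEQ_inverse_real_of_nat[THEN tendsto_mult_left, of d] by (simp add: divide_inverse)
  have "\<forall>k. \<exists>\<rho> :: real ^ 'n \<Rightarrow> real. mollifier (\<epsilon> k) \<rho>"
  proof
    show "\<exists>\<rho> :: real ^ 'n \<Rightarrow> real. mollifier (\<epsilon> k) \<rho>" for k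
      by (rule mollifier_exists[OF \<epsilon>(1)]) blast
  qed
  from choice[OF this] obtain \<rho> :: "nat \<Rightarrow> real ^ 'n \<Rightarrow> real" where \<rho>: "\<And>k. mollifier (\<epsilon> k) (\<rho> k)" by blast
  define \<phi> where "\<phi> k = conv s (\<rho> k)" for k
  have si: "integrable lborel s" by (rule Cc_lipschitzD(2)[OF s])
  have near: "cball x (\<epsilon> k) \<subseteq> D" if "x \<in> thicken C (\<epsilon> k)" for x k
  proof -
    have "cball x (\<epsilon> k) \<subseteq> thicken (thicken C (\<epsilon> k)) (\<epsilon> k)"
      unfolding thicken_def[of "thicken C (\<epsilon> k)"] using that by blast
    also have "\<dots> \<subseteq> thicken C (\<epsilon> k + \<epsilon> k)" by (rule thicken_thicken)
    also have "\<dots> \<subseteq> D" unfolding D_def by (rule thicken_mono) (use \<epsilon>(2)[of k] d in linarith)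
    finally show ?thesis .
  qed
  have TD: "thicken C (\<epsilon> k) \<subseteq> D" for k
    unfolding D_def by (rule thicken_mono) (use \<epsilon>(2)[of k] d e0 in linarith)
  have \<phi>Cc: "\<phi> k \<in> Cc_smooth U" for k
    unfolding \<phi>_def by (rule conv_Cc_smooth[OF si \<rho> C(1,3)]) (use TD D in blast)+
  define F where "F y = ennreal ((1 + \<delta>) * normA_sq W y (g y)) * indicator U y" for y
  have gm: "g \<in> borel_measurable (lebesgue_on U)"
    by (rule locally_integrable_measurable_on[OF U]) (use g in \<open>simp add: weak_gradient_def\<close>)
  have qm: "(\<lambda>y. normA_sq W y (g y)) \<in> borel_measurable (lebesgue_on U)"
    by (rule borel_measurable_normA_sq[OF elliptic_loc_measurable[OF U W] gm])
  have qm': "(\<lambda>y. ennreal ((1 + \<delta>) * normA_sq W y (g y))) \<in> borel_measurable (lebesgue_on U)"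
    using qm by measurable
  have Fm: "F \<in> borel_measurable lebesgue"
    using qm' Um unfolding F_def by (subst (asm) borel_measurable_restrict_space_iff_ennreal) auto
  have bd: "(\<integral>\<^sup>+x\<in>U. ennreal (normA_sq W x (grad (\<phi> k) x)) \<partial>lebesgue) \<le> ennreal (1 + \<delta>) * ?L" for k
  proof -
    have "(\<integral>\<^sup>+x\<in>U. ennreal (normA_sq W x (grad (\<phi> k) x)) \<partial>lebesgue)
      \<le> (\<integral>\<^sup>+x. (\<integral>\<^sup>+y. ennreal (\<rho> k (x - y)) * F y \<partial>lebesgue) \<partial>lebesgue)"
    proof (rule nn_integral_mono)
      fix x
      show "ennreal (normA_sq W x (grad (\<phi> k) x)) * indicator U x \<le> (\<integral>\<^sup>+y. ennreal (\<rho> k (x - y)) * F y \<partial>lebesgue)"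
      proof (cases "x \<in> thicken C (\<epsilon> k)")
        case True
        have xD: "x \<in> D" "x \<in> U" using True TD D by blast+
        have "ennreal (normA_sq W x (grad (\<phi> k) x))
          \<le> (\<integral>\<^sup>+y\<in>U. ennreal (\<rho> k (x - y)) * ennreal ((1 + \<delta>) * normA_sq W y (g y)) \<partial>lebesgue)"
          unfolding \<phi>_def
        proof (rule normA_sq_grad_conv_le[OF U W s g \<rho> xD(2) _ \<delta>])
          show "cball x (\<epsilon> k) \<subseteq> U" using near[OF True] D by blast
          fix y \<xi> assume y: "dist x y \<le> \<epsilon> k"
          have "y \<in> D" using near[OF True] y by auto
          moreover have "dist x y \<le> \<eta>" using y \<epsilon>(2)[of k] d by linarith
          ultimately show "normA_sq W x \<xi> \<le> (1 + \<delta>) * normA_sq W y \<xi>" using \<eta>(2) xD by blast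
        qed
        then show ?thesis using xD by (simp add: F_def mult.assoc)
      next
        case False
        have "grad (\<phi> k) x = 0"
        proof (rule grad_eq_0_outside(1)[OF _ _ False])
          show "closed (thicken C (\<epsilon> k))" by (rule compact_imp_closed[OF compact_thicken[OF C(1)]])
          show "\<phi> k y = 0" if "y \<notin> thicken C (\<epsilon> k)" for y
            unfolding \<phi>_def by (rule conv_eq_0[OF si \<rho> C(3) that])
        qed
        then show ?thesis by simp
      qed
    qed
    also have "\<dots> = (\<integral>\<^sup>+y. F y \<partial>lebesgue)" by (rule nn_integral_conv_mollifier[OF Fm \<rho>])
    also have "\<dots> = (\<integral>\<^sup>+y. ennreal ((1 + \<delta>) * normA_sq W y (g y)) \<partial>lebesgue_on U)"
      unfolding F_def by (rule nn_integral_on[OF Um])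
    also have "\<dots> = (\<integral>\<^sup>+y. ennreal (1 + \<delta>) * ennreal (normA_sq W y (g y)) \<partial>lebesgue_on U)"
      using \<delta> elliptic_loc_nonneg[OF W] by (intro nn_integral_cong) (simp add: ennreal_mult)
    also have "\<dots> = ennreal (1 + \<delta>) * ?L"
      unfolding nn_integral_on[OF Um] by (rule nn_integral_cmult) (use qm in measurable)
    finally show ?thesis .
  qed
  have lim: "(\<lambda>k. \<phi> k x) \<longlonglongrightarrow> s x" for x
  proof (rule LIM_zero_cancel, rule Lim_null_comparison)
    show "(\<lambda>k. L * \<epsilon> k) \<longlonglongrightarrow> 0" using tendsto_mult_left[OF \<epsilon>0, of L] by simp
    have "\<bar>\<phi> k x - s x\<bar> \<le> L * \<epsilon> k" for k
      unfolding \<phi>_def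
    proof (rule conv_near_const[OF si \<rho>])
      fix y assume "dist y x \<le> \<epsilon> k"
      then have "L * dist y x \<le> L * \<epsilon> k" using lipschitz_on_nonneg[OF L] by (rule mult_left_mono)
      then show "\<bar>s y - s x\<bar> \<le> L * \<epsilon> k"
        using lipschitz_onD[OF L, of y x] by (simp add: dist_real_def)
    qed
    then show "\<forall>\<^sub>F k in sequentially. norm (\<phi> k x - s x) \<le> L * \<epsilon> k" by simp
  qed
  have "(\<integral>\<^sup>+x. ennreal (R x * (s x)\<^sup>2) \<partial>lebesgue_on U) \<le> ennreal (1 + \<delta>) * ?L"
  proof (rule fatou_bound[where f = \<phi>])
    show "\<phi> k \<in> borel_measurable (lebesgue_on U)" for k
      using Cc_smooth_continuous(1)[OF \<phi>Cc] Um by (rule continuous_imp_measurable_on_sets_lebesgue)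
    show "AE x in lebesgue_on U. (\<lambda>k. \<phi> k x) \<longlonglongrightarrow> s x" using lim by simp
    show "(\<integral>\<^sup>+x. ennreal (R x * (\<phi> k x)\<^sup>2) \<partial>lebesgue_on U) \<le> ennreal (1 + \<delta>) * ?L" for k
      using order_trans[OF ineq[OF \<phi>Cc, unfolded weighted_ineq_def] bd, of k] unfolding nn_integral_on[OF Um] .
  qed (rule Rm)
  then show "(\<integral>\<^sup>+x\<in>U. ennreal (R x * (s x)\<^sup>2) \<partial>lebesgue) \<le> ennreal (1 + \<delta>) * ?L + ennreal e"
    unfolding nn_integral_on[OF Um] by (rule order_trans) simp
qed

section \<open>The weighted completion\<close>

lemma compact_sets_lebesgue: "compact C \<Longrightarrow> C \<in> sets lebesgue"
  by (simp add: lmeasurable_compact fmeasurableD)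

lemma emeasure_compact_finite: "compact C \<Longrightarrow> emeasure lebesgue C < \<infinity>"
  using lmeasurable_compact[of C] by (auto simp: fmeasurable_def simp del: emeasure_completion)

text \<open>Convergence in \<open>L\<^sup>2\<close> on a compact set outside of which \<open>\<psi>\<close> vanishes passes to integrals against
\<open>\<psi>\<close>, by the Cauchy-Schwarz inequality.\<close>

lemma L2_limit_test_function:
  fixes U :: "(real ^ 'n) set" and f :: "nat \<Rightarrow> real ^ 'n \<Rightarrow> real"
  assumes U: "open U" and f: "\<And>k. locally_integrable U (f k)" and h: "locally_integrable U h"
    and C: "compact C" "C \<subseteq> U" and \<psi>: "continuous_on U \<psi>" "\<And>x. x \<notin> C \<Longrightarrow> \<psi> x = 0"
    and lim: "(\<lambda>k. \<integral>\<^sup>+x\<in>C. ennreal ((f k x - h x)\<^sup>2) \<partial>lebesgue) \<longlonglongrightarrow> 0"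
  shows "(\<lambda>k. LINT x:U|lebesgue. f k x * \<psi> x) \<longlonglongrightarrow> (LINT x:U|lebesgue. h x * \<psi> x)"
proof -
  have Um: "U \<in> sets lebesgue" using U by auto
  have Cm: "C \<in> sets lebesgue" by (rule compact_sets_lebesgue[OF C(1)])
  have i: "integrable lebesgue (\<lambda>x. f k x * \<psi> x)" "integrable lebesgue (\<lambda>x. h x * \<psi> x)" for k
    using integrable_locally_integrable_mult(1)[OF f[of k] \<psi>(1) C \<psi>(2)]
      integrable_locally_integrable_mult(1)[OF h \<psi>(1) C \<psi>(2)] by (simp_all add: mult.commute)
  have eqU: "(LINT x:U|lebesgue. w x * \<psi> x) = (LINT x|lebesgue. w x * \<psi> x)" for w :: "real ^ 'n \<Rightarrow> real"
    by (rule set_lebesgue_integral_eq_of_vanishing) (use \<psi>(2) C(2) in auto)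
  have fm: "f k \<in> borel_measurable (lebesgue_on C)" "h \<in> borel_measurable (lebesgue_on C)" for k
    using measurable_restrict_mono[OF locally_integrable_measurable_on[OF U f] C(2)]
      measurable_restrict_mono[OF locally_integrable_measurable_on[OF U h] C(2)] .
  have \<psi>m: "\<psi> \<in> borel_measurable (lebesgue_on C)"
    using continuous_on_subset[OF \<psi>(1) C(2)] Cm by (rule continuous_imp_measurable_on_sets_lebesgue)
  note [measurable] = fm \<psi>m
  have "compact (\<psi> ` C)"
    by (rule compact_continuous_image[OF continuous_on_subset[OF \<psi>(1) C(2)] C(1)])
  then obtain B where B: "\<And>x. x \<in> C \<Longrightarrow> \<bar>\<psi> x\<bar> \<le> B"
    by (metis bounded_pos compact_imp_bounded imageI real_norm_def)
  define P where "P = (\<integral>\<^sup>+x. (ennreal \<bar>\<psi> x\<bar>)\<^sup>2 \<partial>lebesgue_on C)"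
  have "P \<le> (\<integral>\<^sup>+x. ennreal (B\<^sup>2) \<partial>lebesgue_on C)"
    unfolding P_def
  proof (rule nn_integral_mono)
    fix x assume "x \<in> space (lebesgue_on C)"
    then have "\<bar>\<psi> x\<bar>\<^sup>2 \<le> B\<^sup>2" using B by (intro power_mono) auto
    then show "(ennreal \<bar>\<psi> x\<bar>)\<^sup>2 \<le> ennreal (B\<^sup>2)" by (simp add: ennreal_power ennreal_leI)
  qed
  also have "\<dots> = ennreal (B\<^sup>2) * emeasure lebesgue C"
    using Cm by (simp add: emeasure_restrict_space)
  also have "\<dots> < \<infinity>"
    using emeasure_compact_finite[OF C(1)] by (simp add: ennreal_mult_less_top del: emeasure_completion)
  finally have P: "P < \<infinity>" .
  define E where "E k = (\<integral>\<^sup>+x\<in>C. ennreal ((f k x - h x)\<^sup>2) \<partial>lebesgue)" for k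
  have le: "(ennreal \<bar>(LINT x|lebesgue. f k x * \<psi> x) - (LINT x|lebesgue. h x * \<psi> x)\<bar>)\<^sup>2 \<le> E k * P" for k
  proof -
    have "(LINT x|lebesgue. f k x * \<psi> x) - (LINT x|lebesgue. h x * \<psi> x) = (LINT x|lebesgue. f k x * \<psi> x - h x * \<psi> x)"
      by (rule Bochner_Integration.integral_diff[OF i(1)[of k] i(2), symmetric])
    then have "ennreal \<bar>(LINT x|lebesgue. f k x * \<psi> x) - (LINT x|lebesgue. h x * \<psi> x)\<bar>
        \<le> (\<integral>\<^sup>+x. ennreal (norm (f k x * \<psi> x - h x * \<psi> x)) \<partial>lebesgue)"
      using integral_norm_bound_ennreal[OF Bochner_Integration.integrable_diff[OF i(1)[of k] i(2)]] by simp
    also have "\<dots> = (\<integral>\<^sup>+x\<in>C. ennreal \<bar>f k x - h x\<bar> * ennreal \<bar>\<psi> x\<bar> \<partial>lebesgue)"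
    proof (rule nn_integral_cong)
      fix x
      show "ennreal (norm (f k x * \<psi> x - h x * \<psi> x)) = ennreal \<bar>f k x - h x\<bar> * ennreal \<bar>\<psi> x\<bar> * indicator C x"
        using \<psi>(2)[of x] by (cases "x \<in> C") (simp_all add: left_diff_distrib[symmetric] abs_mult ennreal_mult)
    qed
    also have "\<dots> = (\<integral>\<^sup>+x. ennreal \<bar>f k x - h x\<bar> * ennreal \<bar>\<psi> x\<bar> \<partial>lebesgue_on C)"
      by (rule nn_integral_on[OF Cm])
    finally have "(ennreal \<bar>(LINT x|lebesgue. f k x * \<psi> x) - (LINT x|lebesgue. h x * \<psi> x)\<bar>)\<^sup>2
        \<le> (\<integral>\<^sup>+x. ennreal \<bar>f k x - h x\<bar> * ennreal \<bar>\<psi> x\<bar> \<partial>lebesgue_on C)\<^sup>2"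
      by (rule power_mono) simp
    also have "\<dots> \<le> (\<integral>\<^sup>+x. (ennreal \<bar>f k x - h x\<bar>)\<^sup>2 \<partial>lebesgue_on C) * P"
      unfolding P_def by (rule Cauchy_Schwarz_nn_integral) measurable
    also have "(\<integral>\<^sup>+x. (ennreal \<bar>f k x - h x\<bar>)\<^sup>2 \<partial>lebesgue_on C) = E k"
      unfolding E_def nn_integral_on[OF Cm] by (simp add: ennreal_power)
    finally show ?thesis .
  qed
  have "(\<lambda>k. P * E k) \<longlonglongrightarrow> P * 0"
    using lim P unfolding E_def by (intro ennreal_tendsto_cmult) auto
  then have EP: "(\<lambda>k. E k * P) \<longlonglongrightarrow> 0" by (simp add: mult.commute)
  define D where "D k = (LINT x|lebesgue. f k x * \<psi> x) - (LINT x|lebesgue. h x * \<psi> x)" for k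
  have "(\<lambda>k. ennreal ((D k)\<^sup>2)) \<longlonglongrightarrow> 0"
  proof (rule tendsto_sandwich[OF _ _ tendsto_const EP])
    show "\<forall>\<^sub>F k in sequentially. ennreal ((D k)\<^sup>2) \<le> E k * P"
      using le by (auto simp: D_def ennreal_power)
  qed simp
  then have "(\<lambda>k. ennreal ((D k)\<^sup>2)) \<longlonglongrightarrow> ennreal 0" by simp
  then have "(\<lambda>k. (D k)\<^sup>2) \<longlonglongrightarrow> 0"
    by (subst (asm) tendsto_ennreal_iff) auto
  then have "(\<lambda>k. sqrt ((D k)\<^sup>2)) \<longlonglongrightarrow> sqrt 0" by (rule tendsto_real_sqrt)
  then have "D \<longlonglongrightarrow> 0" by (simp add: tendsto_rabs_zero_iff)
  then show ?thesis unfolding eqU D_def[abs_def] by (rule LIM_zero_cancel)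
qed

lemma convergent_of_summable_increments:
  fixes v :: "nat \<Rightarrow> 'a::banach"
  assumes "\<And>m. norm (v (Suc m) - v m) \<le> K * (1 / 2) ^ m"
  shows "convergent v"
proof -
  have "summable (\<lambda>m. K * (1 / 2 :: real) ^ m)" by (intro summable_mult summable_geometric) simp
  then have "summable (\<lambda>m. v (Suc m) - v m)"
    by (rule summable_comparison_test[rotated]) (use assms in auto)
  then have "convergent (\<lambda>m. \<Sum>i<m. v (Suc i) - v i)" by (simp add: summable_iff_convergent)
  then have "convergent (\<lambda>m. v m - v 0)" by (simp add: sum_lessThan_telescope)
  then have "convergent (\<lambda>m. (v m - v 0) + v 0)" by (rule convergent_add) (rule convergent_const)
  then show ?thesis by simp
qed

text \<open>Completeness of the weighted \<open>L\<^sup>2\<close> space of vector fields: a rapidly converging subsequence converges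
almost everywhere, and by Fatou's lemma the pointwise limit is also the limit in norm.\<close>

lemma weighted_L2_complete:
  fixes U :: "(real ^ 'n) set" and W :: "real ^ 'n \<Rightarrow> real ^ 'n ^ 'n"
  assumes U: "open U" and W: "elliptic_loc U W"
    and g: "\<And>k. g k \<in> borel_measurable (lebesgue_on U)"
    and cauchy: "\<And>e. e > 0 \<Longrightarrow> \<exists>N. \<forall>j\<ge>N. \<forall>k\<ge>N.
        (\<integral>\<^sup>+x\<in>U. ennreal (normA_sq W x (g j x - g k x)) \<partial>lebesgue) < e"
  shows "\<exists>G \<in> borel_measurable (lebesgue_on U).
    (\<lambda>k. \<integral>\<^sup>+x\<in>U. ennreal (normA_sq W x (g k x - G x)) \<partial>lebesgue) \<longlonglongrightarrow> 0"
proof -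
  let ?M = "lebesgue_on U"
  have Um: "U \<in> sets lebesgue" using U by auto
  note Wm = elliptic_loc_measurable[OF U W]
  have qm: "(\<lambda>x. normA_sq W x (H x)) \<in> borel_measurable ?M" if "H \<in> borel_measurable ?M" for H
    by (rule borel_measurable_normA_sq[OF Wm that])
  have qm_diff: "(\<lambda>x. normA_sq W x (g j x - g k x)) \<in> borel_measurable ?M" for j k
    by (rule qm) (intro borel_measurable_diff g)
  define I where "I j k = (\<integral>\<^sup>+x. ennreal (normA_sq W x (g j x - g k x)) \<partial>?M)" for j k
  have cauchy': "\<exists>N. \<forall>j\<ge>N. \<forall>k\<ge>N. I j k < e" if "e > 0" for e
    using cauchy[OF that] unfolding I_def nn_integral_on[OF Um] .
  \<comment> \<open>squared increments below \<open>8\<^sup>-\<^sup>m\<close> remain summable after multiplication by \<open>4\<^sup>m\<close>, so that almost everywhere the increments decay like \<open>2\<^sup>-\<^sup>m\<close>\<close>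
  have "\<forall>m. \<exists>N. \<forall>j\<ge>N. \<forall>k\<ge>N. I j k < ennreal ((1 / 8) ^ m)"
    using cauchy' by simp
  from choice[OF this] obtain N where N: "\<And>m j k. j \<ge> N m \<Longrightarrow> k \<ge> N m \<Longrightarrow> I j k < ennreal ((1 / 8) ^ m)" by blast
  define r where "r m = (\<Sum>i\<le>m. N i) + m" for m
  have rN: "N m \<le> r m" for m
    unfolding r_def using member_le_sum[of m "{..m}" N] by simp
  have rS: "r m \<le> r (Suc m)" for m unfolding r_def by simp
  have rm: "m \<le> r m" for m unfolding r_def by simp
  have I8: "I (r (Suc m)) (r m) < ennreal ((1 / 8) ^ m)" for m
    by (rule N) (use rN[of m] rS[of m] in auto)
  define q where "q m x = 4 ^ m * normA_sq W x (g (r (Suc m)) x - g (r m) x)" for m x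
  have qmm: "q m \<in> borel_measurable ?M" for m
    unfolding q_def by (intro borel_measurable_times borel_measurable_const qm_diff)
  note [measurable] = qmm
  have "(\<integral>\<^sup>+x. (\<Sum>m. ennreal (q m x)) \<partial>?M) = (\<Sum>m. \<integral>\<^sup>+x. ennreal (q m x) \<partial>?M)"
    by (rule nn_integral_suminf) measurable
  also have "\<dots> \<le> (\<Sum>m. ennreal ((1 / 2) ^ m))"
  proof (rule suminf_le)
    fix m
    have "(\<integral>\<^sup>+x. ennreal (q m x) \<partial>?M) = ennreal (4 ^ m) * I (r (Suc m)) (r m)"
      unfolding q_def I_def by (subst nn_integral_cmult[symmetric]) (auto intro!: nn_integral_cong qm_diff measurable_compose[OF _ measurable_ennreal] simp: ennreal_mult')
    also have "\<dots> \<le> ennreal (4 ^ m) * ennreal ((1 / 8) ^ m)"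
      using I8[of m] by (intro mult_left_mono) auto
    also have "\<dots> = ennreal ((1 / 2) ^ m)"
      by (simp add: ennreal_mult'[symmetric] power_mult_distrib[symmetric])
    finally show "(\<integral>\<^sup>+x. ennreal (q m x) \<partial>?M) \<le> ennreal ((1 / 2) ^ m)" .
  qed auto
  also have "\<dots> = ennreal 2"
    by (subst suminf_ennreal2) (auto simp: suminf_geometric)
  also have "\<dots> < \<infinity>" by simp
  finally have fin: "(\<integral>\<^sup>+x. (\<Sum>m. ennreal (q m x)) \<partial>?M) < \<infinity>" .
  have "AE x in ?M. (\<Sum>m. ennreal (q m x)) \<noteq> \<infinity>"
    by (rule nn_integral_PInf_AE) (use fin in auto)
  then have conv: "AE x in ?M. convergent (\<lambda>m. g (r m) x)"
  proof (rule AE_mp, intro AE_I2 impI)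
    fix x assume x: "x \<in> space ?M" and f: "(\<Sum>m. ennreal (q m x)) \<noteq> \<infinity>"
    have xU: "x \<in> U" using x by simp
    then have "compact {x} \<and> {x} \<subseteq> U" by simp
    then obtain c where c: "c > 0" "\<And>\<xi>. c * (norm \<xi>)\<^sup>2 \<le> normA_sq W x \<xi>"
      using W unfolding elliptic_loc_def by (metis singletonI)
    obtain S where S: "S \<ge> 0" "(\<Sum>m. ennreal (q m x)) = ennreal S"
      using f by (cases "\<Sum>m. ennreal (q m x)") auto
    define K where "K = sqrt (S / c)"
    have "norm (g (r (Suc m)) x - g (r m) x) \<le> K * (1 / 2) ^ m" for m
    proof -
      let ?d = "g (r (Suc m)) x - g (r m) x"
      have "ennreal (q m x) \<le> ennreal S"
        unfolding S(2)[symmetric] using sum_le_suminf[of "\<lambda>m. ennreal (q m x)" "{m}"] by simp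
      then have "q m x \<le> S" using S(1) by simp
      then have qS: "4 ^ m * normA_sq W x ?d \<le> S" by (simp add: q_def)
      have "4 ^ m * (c * (norm ?d)\<^sup>2) \<le> 4 ^ m * normA_sq W x ?d"
        by (rule mult_left_mono[OF c(2)]) simp
      then have "4 ^ m * (c * (norm ?d)\<^sup>2) \<le> S" using qS by (rule order_trans)
      moreover have "(2 ^ m * norm ?d)\<^sup>2 = 4 ^ m * (norm ?d)\<^sup>2"
        by (simp add: power_mult_distrib power2_eq_square[of "2 ^ m"] flip: power_mult_distrib[of 2 2])
      ultimately have "(2 ^ m * norm ?d)\<^sup>2 \<le> S / c"
        using c(1) by (simp add: pos_le_divide_eq mult.commute mult.left_commute)
      then have "2 ^ m * norm ?d \<le> K" unfolding K_def by (rule real_le_rsqrt)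
      then show ?thesis by (simp add: power_one_over field_simps)
    qed
    then show "convergent (\<lambda>m. g (r m) x)" by (rule convergent_of_summable_increments)
  qed
  define G where "G x = lim (\<lambda>m. g (r m) x)" for x
  have Gm: "G \<in> borel_measurable ?M" unfolding G_def by (rule borel_measurable_lim_metric[OF g])
  have Glim: "AE x in ?M. (\<lambda>m. g (r m) x) \<longlonglongrightarrow> G x"
    using conv by (rule eventually_mono) (simp add: G_def convergent_LIMSEQ_iff)
  have bound: "(\<integral>\<^sup>+x. ennreal (normA_sq W x (g k x - G x)) \<partial>?M) \<le> e" if k: "\<forall>j\<ge>n. I k j < e" for k n e
  proof -
    have "(\<integral>\<^sup>+x. ennreal (normA_sq W x (g k x - G x)) \<partial>?M)
        = (\<integral>\<^sup>+x. liminf (\<lambda>m. ennreal (normA_sq W x (g k x - g (r (m + n)) x))) \<partial>?M)"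
    proof (rule nn_integral_cong_AE, rule eventually_mono[OF Glim])
      fix x assume "(\<lambda>m. g (r m) x) \<longlonglongrightarrow> G x"
      then have "(\<lambda>m. g (r (m + n)) x) \<longlonglongrightarrow> G x" by (rule LIMSEQ_ignore_initial_segment)
      then have "(\<lambda>m. ennreal (normA_sq W x (g k x - g (r (m + n)) x))) \<longlonglongrightarrow> ennreal (normA_sq W x (g k x - G x))"
        unfolding normA_sq_expand by (intro tendsto_ennrealI tendsto_intros)
      then show "ennreal (normA_sq W x (g k x - G x)) = liminf (\<lambda>m. ennreal (normA_sq W x (g k x - g (r (m + n)) x)))"
        by (rule lim_imp_Liminf[OF trivial_limit_sequentially, symmetric])
    qed
    also have "\<dots> \<le> liminf (\<lambda>m. \<integral>\<^sup>+x. ennreal (normA_sq W x (g k x - g (r (m + n)) x)) \<partial>?M)"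
      by (rule nn_integral_liminf) (intro measurable_compose[OF _ measurable_ennreal] qm_diff)
    also have "\<dots> \<le> liminf (\<lambda>m::nat. e)"
    proof (intro Liminf_mono always_eventually allI)
      fix m
      have "n \<le> r (m + n)" using rm[of "m + n"] by simp
      then show "(\<integral>\<^sup>+x. ennreal (normA_sq W x (g k x - g (r (m + n)) x)) \<partial>?M) \<le> e"
        using k unfolding I_def by (simp add: less_imp_le)
    qed
    also have "\<dots> = e" by (simp add: Liminf_const)
    finally show ?thesis .
  qed
  have "(\<lambda>k. \<integral>\<^sup>+x. ennreal (normA_sq W x (g k x - G x)) \<partial>?M) \<longlonglongrightarrow> 0"
  proof (rule order_tendstoI)
    fix e :: ennreal assume "0 < e"
    then obtain e' where e': "0 < e'" "e' < e" using dense by blast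
    obtain n where n: "\<forall>j\<ge>n. \<forall>k\<ge>n. I j k < e'" using cauchy'[OF e'(1)] by blast
    have "(\<integral>\<^sup>+x. ennreal (normA_sq W x (g k x - G x)) \<partial>?M) < e" if "k \<ge> n" for k
    proof -
      have "\<forall>j\<ge>n. I k j < e'" using n that by blast
      then show ?thesis using bound[of n k e'] e'(2) by simp
    qed
    then show "\<forall>\<^sub>F k in sequentially. (\<integral>\<^sup>+x. ennreal (normA_sq W x (g k x - G x)) \<partial>?M) < e"
      unfolding eventually_sequentially by blast
  qed simp
  then show ?thesis using Gm unfolding nn_integral_on[OF Um] by blast
qed

text \<open>The inequality passes to the completion. The gradients of an approximating sequence converge in
the weighted norm, and the limit is a weak gradient of \<open>u\<close>, hence equal to \<open>Du\<close> almost everywhere.\<close>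

theorem completion_ineq:
  fixes U :: "(real ^ 'n) set" and W :: "real ^ 'n \<Rightarrow> real ^ 'n ^ 'n"
  assumes U: "open U" and W: "elliptic_loc U W" and R: "continuous_on U R"
    and ineq: "\<And>s g. s \<in> Cc_lipschitz U \<Longrightarrow> weak_gradient U s g \<Longrightarrow>
      weighted_ineq U W R s g"
    and s: "\<And>k. s k \<in> Cc_lipschitz U" "\<And>k. weak_gradient U (s k) (g k)"
    and cauchy: "\<And>e. e > 0 \<Longrightarrow> \<exists>N. \<forall>j\<ge>N. \<forall>k\<ge>N.
        (\<integral>\<^sup>+x\<in>U. ennreal (normA_sq W x (g j x - g k x)) \<partial>lebesgue) < e"
    and slim: "\<And>C. compact C \<Longrightarrow> C \<subseteq> U \<Longrightarrow> (\<lambda>k. \<integral>\<^sup>+x\<in>C. ennreal ((s k x - u x)\<^sup>2) \<partial>lebesgue) \<longlonglongrightarrow> 0"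
    and Du: "weak_gradient U u Du"
  shows "weighted_ineq U W R u Du"
proof -
  have Um: "U \<in> sets lebesgue" using U by auto
  have lu: "locally_integrable U u" "locally_integrable U Du" using Du by (auto simp: weak_gradient_def)
  have ls: "locally_integrable U (s k)" "locally_integrable U (g k)" for k using s(2)[of k] by (auto simp: weak_gradient_def)
  note um = locally_integrable_measurable_on[OF U lu(1)] locally_integrable_measurable_on[OF U lu(2)]
  note sm = locally_integrable_measurable_on[OF U ls(1)] locally_integrable_measurable_on[OF U ls(2)]
  obtain G where G: "G \<in> borel_measurable (lebesgue_on U)"
    "(\<lambda>k. \<integral>\<^sup>+x\<in>U. ennreal (normA_sq W x (g k x - G x)) \<partial>lebesgue) \<longlonglongrightarrow> 0"
    using weighted_L2_complete[OF U W sm(2) cauchy] by blast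
  have L2C: "(\<lambda>k. \<integral>\<^sup>+x\<in>C. ennreal ((norm (g k x - G x))\<^sup>2) \<partial>lebesgue) \<longlonglongrightarrow> 0" if C: "compact C" "C \<subseteq> U" for C
  proof -
    obtain c where c: "c > 0" "\<And>x \<xi>. x \<in> C \<Longrightarrow> c * (norm \<xi>)\<^sup>2 \<le> normA_sq W x \<xi>"
      using W C by (auto simp: elliptic_loc_def dest!: spec[where x = C])
    have Cm: "C \<in> sets lebesgue" by (rule compact_sets_lebesgue[OF C(1)])
    have "(\<lambda>k. ennreal (1 / c) * (\<integral>\<^sup>+x\<in>U. ennreal (normA_sq W x (g k x - G x)) \<partial>lebesgue)) \<longlonglongrightarrow> ennreal (1 / c) * 0"
      using G(2) by (rule ennreal_tendsto_cmult[rotated]) simp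
    then have lim0: "(\<lambda>k. ennreal (1 / c) * (\<integral>\<^sup>+x\<in>U. ennreal (normA_sq W x (g k x - G x)) \<partial>lebesgue)) \<longlonglongrightarrow> 0" by simp
    show ?thesis
    proof (rule tendsto_sandwich[OF _ _ tendsto_const lim0])
      have "(\<integral>\<^sup>+x\<in>C. ennreal ((norm (g k x - G x))\<^sup>2) \<partial>lebesgue)
        \<le> ennreal (1 / c) * (\<integral>\<^sup>+x\<in>U. ennreal (normA_sq W x (g k x - G x)) \<partial>lebesgue)" for k
      proof -
        have gG: "(\<lambda>x. g k x - G x) \<in> borel_measurable (lebesgue_on U)" using sm(2)[of k] G(1) by measurable
        have m: "(\<lambda>x. normA_sq W x (g k x - G x)) \<in> borel_measurable (lebesgue_on U)"
          by (rule borel_measurable_normA_sq[OF elliptic_loc_measurable[OF U W] gG])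
        have "(\<integral>\<^sup>+x\<in>C. ennreal ((norm (g k x - G x))\<^sup>2) \<partial>lebesgue)
          \<le> (\<integral>\<^sup>+x\<in>U. ennreal (1 / c) * ennreal (normA_sq W x (g k x - G x)) \<partial>lebesgue)"
        proof (rule nn_integral_mono)
          fix x
          show "ennreal ((norm (g k x - G x))\<^sup>2) * indicator C x
            \<le> ennreal (1 / c) * ennreal (normA_sq W x (g k x - G x)) * indicator U x"
          proof (cases "x \<in> C")
            case True
            then have "(norm (g k x - G x))\<^sup>2 \<le> 1 / c * normA_sq W x (g k x - G x)"
              using c(2)[OF True, of "g k x - G x"] c(1) by (simp add: field_simps)
            then have "ennreal ((norm (g k x - G x))\<^sup>2) \<le> ennreal (1 / c) * ennreal (normA_sq W x (g k x - G x))"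
              using c(1) by (simp add: ennreal_mult'[symmetric] ennreal_leI)
            then show ?thesis using True C(2) by (simp add: subset_iff)
          qed simp
        qed
        also have "\<dots> = ennreal (1 / c) * (\<integral>\<^sup>+x\<in>U. ennreal (normA_sq W x (g k x - G x)) \<partial>lebesgue)"
          unfolding nn_integral_on[OF Um] by (rule nn_integral_cmult) (use m in measurable)
        finally show ?thesis .
      qed
      then show "\<forall>\<^sub>F k in sequentially. (\<integral>\<^sup>+x\<in>C. ennreal ((norm (g k x - G x))\<^sup>2) \<partial>lebesgue)
        \<le> ennreal (1 / c) * (\<integral>\<^sup>+x\<in>U. ennreal (normA_sq W x (g k x - G x)) \<partial>lebesgue)" by simp
    qed simp
  qed
  have lG: "locally_integrable U G"
    unfolding locally_integrable_def
  proof (intro allI impI)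
    fix C assume "compact C \<and> C \<subseteq> U"
    then have C: "compact C" "C \<subseteq> U" by auto
    have Cm: "C \<in> sets lebesgue" by (rule compact_sets_lebesgue[OF C(1)])
    have "\<forall>\<^sub>F k in sequentially. (\<integral>\<^sup>+x\<in>C. ennreal ((norm (g k x - G x))\<^sup>2) \<partial>lebesgue) < 1"
      using L2C[OF C] by (rule order_tendstoD) simp
    then obtain k where k: "(\<integral>\<^sup>+x\<in>C. ennreal ((norm (g k x - G x))\<^sup>2) \<partial>lebesgue) < 1"
      using eventually_happens'[OF sequentially_bot] by blast
    have gGm: "(\<lambda>x. g k x - G x) \<in> borel_measurable (lebesgue_on C)"
      by (rule measurable_restrict_mono[OF _ C(2)]) (use sm(2)[of k] G(1) in measurable)
    have i1: "integrable (lebesgue_on C) (\<lambda>x. g k x - G x)"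
    proof (rule integrableI_bounded[OF gGm])
      have "(\<integral>\<^sup>+x. ennreal (norm (g k x - G x)) \<partial>lebesgue_on C) \<le> (\<integral>\<^sup>+x. 1 + ennreal ((norm (g k x - G x))\<^sup>2) \<partial>lebesgue_on C)"
      proof (rule nn_integral_mono)
        fix x
        have "a \<le> 1 + a\<^sup>2" for a :: real
        proof -
          have "(a - 1 / 2)\<^sup>2 = a\<^sup>2 - a + 1 / 4"
            by (simp add: power2_diff power_divide)
          then show ?thesis using zero_le_power2[of "a - 1 / 2"] by linarith
        qed
        then have "ennreal (norm (g k x - G x)) \<le> ennreal (1 + (norm (g k x - G x))\<^sup>2)" by (rule ennreal_leI)
        then show "ennreal (norm (g k x - G x)) \<le> 1 + ennreal ((norm (g k x - G x))\<^sup>2)" by simp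
      qed
      also have "\<dots> = emeasure (lebesgue_on C) C + (\<integral>\<^sup>+x. ennreal ((norm (g k x - G x))\<^sup>2) \<partial>lebesgue_on C)"
        using gGm by (subst nn_integral_add) auto
      also have "\<dots> < \<infinity>"
        using Cm emeasure_compact_finite[OF C(1)] order_less_trans[OF k, of \<infinity>]
        by (simp add: emeasure_restrict_space nn_integral_on[OF Cm] del: emeasure_completion)
      finally show "(\<integral>\<^sup>+x. ennreal (norm (g k x - G x)) \<partial>lebesgue_on C) < \<infinity>" .
    qed
    have i2: "integrable (lebesgue_on C) (g k)"
      using ls(2)[of k] C unfolding integrable_lebesgue_on_iff_set_integrable[OF Cm] locally_integrable_def by blast
    have "integrable (lebesgue_on C) (\<lambda>x. g k x - (g k x - G x))"
      by (rule Bochner_Integration.integrable_diff[OF i2 i1])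
    then show "set_integrable lebesgue C G"
      unfolding integrable_lebesgue_on_iff_set_integrable[OF Cm, symmetric] by simp
  qed
  have wG: "weak_gradient U u G"
    unfolding weak_gradient_def
  proof (intro conjI ballI allI lu(1) lG)
    fix \<phi> i assume \<phi>: "\<phi> \<in> Cc_smooth U"
    obtain C where C: "compact C" "C \<subseteq> U" "\<And>x. x \<notin> C \<Longrightarrow> \<phi> x = 0" "\<And>x. x \<notin> C \<Longrightarrow> grad \<phi> x = 0"
      by (rule compact_support_CcE[OF \<phi>]) blast
    have c1: "continuous_on U (\<lambda>x. grad \<phi> x $ i)"
      using Cc_smooth_continuous(2)[OF \<phi>, of U] by (intro continuous_intros)
    have "(\<lambda>k. LINT x:U|lebesgue. s k x * grad \<phi> x $ i) \<longlonglongrightarrow> (LINT x:U|lebesgue. u x * grad \<phi> x $ i)"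
      by (rule L2_limit_test_function[OF U ls(1) lu(1) C(1,2) c1 _ slim[OF C(1,2)]]) (simp add: C(4))
    moreover have "(\<lambda>k. LINT x:U|lebesgue. g k x $ i * \<phi> x) \<longlonglongrightarrow> (LINT x:U|lebesgue. G x $ i * \<phi> x)"
    proof (rule L2_limit_test_function[OF U locally_integrable_component[OF ls(2)] locally_integrable_component[OF lG] C(1,2) Cc_smooth_continuous(1)[OF \<phi>] C(3)])
      show "(\<lambda>k. \<integral>\<^sup>+x\<in>C. ennreal ((g k x $ i - G x $ i)\<^sup>2) \<partial>lebesgue) \<longlonglongrightarrow> 0"
      proof (rule tendsto_sandwich[OF _ _ tendsto_const L2C[OF C(1,2)]])
        have "(g k x $ i - G x $ i)\<^sup>2 \<le> (norm (g k x - G x))\<^sup>2" for k x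
          using component_le_norm_cart[of "g k x - G x" i] by (intro power2_le_iff_abs_le[THEN iffD2]) auto
        then have "(\<integral>\<^sup>+x\<in>C. ennreal ((g k x $ i - G x $ i)\<^sup>2) \<partial>lebesgue) \<le> (\<integral>\<^sup>+x\<in>C. ennreal ((norm (g k x - G x))\<^sup>2) \<partial>lebesgue)" for k
          by (intro nn_integral_mono mult_right_mono ennreal_leI) auto
        then show "\<forall>\<^sub>F k in sequentially. (\<integral>\<^sup>+x\<in>C. ennreal ((g k x $ i - G x $ i)\<^sup>2) \<partial>lebesgue)
            \<le> (\<integral>\<^sup>+x\<in>C. ennreal ((norm (g k x - G x))\<^sup>2) \<partial>lebesgue)" by simp
      qed simp
    qed
    then have "(\<lambda>k. - (LINT x:U|lebesgue. g k x $ i * \<phi> x)) \<longlonglongrightarrow> - (LINT x:U|lebesgue. G x $ i * \<phi> x)"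
      by (rule tendsto_minus)
    moreover have "(LINT x:U|lebesgue. s k x * grad \<phi> x $ i) = - (LINT x:U|lebesgue. g k x $ i * \<phi> x)" for k
      using s(2)[of k] \<phi> by (simp add: weak_gradient_def)
    ultimately show "(LINT x:U|lebesgue. u x * grad \<phi> x $ i) = - (LINT x:U|lebesgue. G x $ i * \<phi> x)"
      by (simp add: LIMSEQ_unique)
  qed
  have ae: "AE x in lebesgue. x \<in> U \<longrightarrow> G x = Du x"
    by (rule weak_gradient_unique[OF U wG Du])
  have eq: "(\<integral>\<^sup>+x\<in>U. ennreal (normA_sq W x (g k x - G x)) \<partial>lebesgue) = (\<integral>\<^sup>+x\<in>U. ennreal (normA_sq W x (g k x - Du x)) \<partial>lebesgue)" for k
    by (rule nn_integral_cong_AE, rule eventually_mono[OF ae]) (auto simp: indicator_def)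
  show ?thesis
    by (rule limit_ineq[OF U W R sm(1) um(1) sm(2) um(2) slim G(2)[unfolded eq] ineq[OF s]])
qed

section \<open>Box dimension and the volume of tubes\<close>

text \<open>A bounded set lies in a ball whose radius is its diameter. This loses the factor \<open>2\<^sup>n\<close> but, unlike
the sharp comparison, does not use the isodiametric inequality.\<close>

lemma emeasure_le_hausdorff_measure:
  fixes S :: "(real ^ 'n) set"
  assumes S: "S \<in> sets lebesgue"
  shows "ennreal ((1 / 2) ^ CARD('n)) * emeasure lebesgue S \<le> hausdorff_measure CARD('n) S"
proof -
  let ?n = "CARD('n)"
  have "ennreal ((1 / 2) ^ ?n) * emeasure lebesgue S
    \<le> (\<Sum>i. ennreal (unit_ball_vol (real ?n) * (diameter (V i) / 2) ^ ?n))"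
    if V: "S \<subseteq> (\<Union>i. V i)" "\<And>i. bounded (V i)" for V :: "nat \<Rightarrow> (real ^ 'n) set"
  proof -
    define B where "B i = (if V i = {} then {} else cball (SOME x. x \<in> V i) (diameter (V i)))" for i
    have VB: "V i \<subseteq> B i" for i
    proof (cases "V i = {}")
      case False
      then have "(SOME x. x \<in> V i) \<in> V i" by (simp add: some_in_eq)
      then show ?thesis using False diameter_bounded_bound[OF V(2)[of i]] by (auto simp: B_def)
    qed simp
    have Bm: "B i \<in> sets lebesgue" for i by (simp add: B_def)
    have Bv: "emeasure lebesgue (B i) \<le> ennreal (2 ^ ?n) * ennreal (unit_ball_vol (real ?n) * (diameter (V i) / 2) ^ ?n)" for i
    proof (cases "V i = {}")
      case False
      have d: "0 \<le> diameter (V i)" by (rule diameter_ge_0[OF V(2)])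
      have "emeasure lebesgue (B i) = ennreal (unit_ball_vol (real ?n) * diameter (V i) ^ ?n)"
        using False emeasure_cball[OF d, of "SOME x. x \<in> V i"] by (simp add: B_def)
      also have "unit_ball_vol (real ?n) * diameter (V i) ^ ?n = 2 ^ ?n * (unit_ball_vol (real ?n) * (diameter (V i) / 2) ^ ?n)"
        by (simp add: power_divide)
      also have "ennreal \<dots> = ennreal (2 ^ ?n) * ennreal (unit_ball_vol (real ?n) * (diameter (V i) / 2) ^ ?n)"
        by (rule ennreal_mult') simp
      finally show ?thesis by simp
    qed (simp add: B_def)
    have "(\<Union>i. V i) \<subseteq> (\<Union>i. B i)" using VB by (intro UN_mono) auto
    then have "S \<subseteq> (\<Union>i. B i)" using V(1) by (rule order_trans[rotated])
    then have "emeasure lebesgue S \<le> emeasure lebesgue (\<Union>i. B i)"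
      by (rule emeasure_mono) (use Bm in auto)
    also have "\<dots> \<le> (\<Sum>i. emeasure lebesgue (B i))"
      by (rule emeasure_subadditive_countably) (use Bm in auto)
    also have "\<dots> \<le> (\<Sum>i. ennreal (2 ^ ?n) * ennreal (unit_ball_vol (real ?n) * (diameter (V i) / 2) ^ ?n))"
      by (rule suminf_le) (use Bv in auto)
    also have "\<dots> = ennreal (2 ^ ?n) * (\<Sum>i. ennreal (unit_ball_vol (real ?n) * (diameter (V i) / 2) ^ ?n))"
      by (rule ennreal_suminf_cmult)
    finally have "ennreal ((1 / 2) ^ ?n) * emeasure lebesgue S
      \<le> ennreal ((1 / 2) ^ ?n) * (ennreal (2 ^ ?n) * (\<Sum>i. ennreal (unit_ball_vol (real ?n) * (diameter (V i) / 2) ^ ?n)))"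
      by (rule mult_left_mono) simp
    also have "\<dots> = (ennreal ((1 / 2) ^ ?n) * ennreal (2 ^ ?n)) * (\<Sum>i. ennreal (unit_ball_vol (real ?n) * (diameter (V i) / 2) ^ ?n))"
      by (simp only: mult.assoc)
    also have "ennreal ((1 / 2) ^ ?n) * ennreal (2 ^ ?n) = 1"
      by (simp add: ennreal_mult'[symmetric] power_mult_distrib[symmetric])
    finally show ?thesis by simp
  qed
  then have "ennreal ((1 / 2) ^ ?n) * emeasure lebesgue S
    \<le> (INF V\<in>{V :: nat \<Rightarrow> (real ^ 'n) set. S \<subseteq> (\<Union>i. V i) \<and> (\<forall>i. bounded (V i) \<and> diameter (V i) \<le> 1)}.
       \<Sum>i. ennreal (unit_ball_vol (real ?n) * (diameter (V i) / 2) ^ ?n))"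
    by (intro INF_greatest) simp
  also have "\<dots> \<le> hausdorff_measure ?n S"
    unfolding hausdorff_measure_def by (rule SUP_upper) simp
  finally show ?thesis .
qed

text \<open>If the box dimension is below \<open>n - 2\<close>, the tubes of radius \<open>r\<close> have volume \<open>O(r\<^sup>p)\<close> for some
\<open>p > 2\<close>.\<close>

lemma lebesgue_tube_decay:
  fixes \<Omega> K :: "(real ^ 'n) set"
  assumes \<Omega>: "open \<Omega>" and dim: "has_box_dim \<Omega> K d" and d: "d < real CARD('n) - 2"
  shows "\<exists>p>2. \<exists>r0>0. \<forall>r. 0 < r \<and> r < r0 \<longrightarrow>
    emeasure lebesgue {x \<in> \<Omega>. infdist x K < r} \<le> ennreal (2 ^ CARD('n) * r powr p)"
proof -
  let ?n = "CARD('n)"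
  define l where "l = real ?n - d"
  define p where "p = (l + 2) / 2"
  have p: "2 < p" "p < l" using d by (auto simp: p_def l_def)
  define H where "H r = hausdorff_measure ?n {x \<in> \<Omega>. infdist x K < r}" for r
  have "\<forall>\<^sub>F r in at_right 0. p < ln (enn2real (H r)) / ln r"
    using dim p(2) unfolding has_box_dim_def H_def l_def by (intro order_tendstoD(1)) auto
  then obtain b where b: "b > 0" "\<And>r. 0 < r \<Longrightarrow> r < b \<Longrightarrow> p < ln (enn2real (H r)) / ln r"
    by (auto simp: eventually_at_right[of 0 1])
  have "emeasure lebesgue {x \<in> \<Omega>. infdist x K < r} \<le> ennreal (2 ^ ?n * r powr p)" if r: "0 < r" "r < min b 1" for r
  proof -
    have lnr: "ln r < 0" using r by simp
    define h where "h = enn2real (H r)"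
    have r1: "p < ln h / ln r" using b(2)[of r] r by (simp add: h_def)
    \<comment> \<open>if the tube had measure zero or infinity, then \<open>h = 0\<close> and the quotient would be zero, as \<open>ln 0 = 0\<close>\<close>
    have "h \<noteq> 0" using r1 p by auto
    then have h0: "h > 0" unfolding h_def using enn2real_nonneg[of "H r"] by linarith
    have "ln h < p * ln r" using r1 lnr by (simp add: neg_less_divide_eq)
    also have "p * ln r = ln (r powr p)" using r by (simp add: ln_powr)
    finally have hr: "h < r powr p" using h0 r by (subst (asm) ln_less_cancel_iff) auto
    have "H r \<noteq> \<infinity>" using h0 by (auto simp: h_def)
    then have Hh: "H r = ennreal h" by (simp add: h_def less_top)
    have m: "{x \<in> \<Omega>. infdist x K < r} \<in> sets lebesgue"
    proof -
      have "open {x. infdist x K < r}" by (intro open_Collect_less continuous_intros)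
      then have "open (\<Omega> \<inter> {x. infdist x K < r})" using \<Omega> by (rule open_Int[rotated])
      then show ?thesis by (simp add: Int_def)
    qed
    have "emeasure lebesgue {x \<in> \<Omega>. infdist x K < r}
      = ennreal (2 ^ ?n) * (ennreal ((1 / 2) ^ ?n) * emeasure lebesgue {x \<in> \<Omega>. infdist x K < r})"
      by (simp add: mult.assoc[symmetric] ennreal_mult'[symmetric] power_mult_distrib[symmetric])
    also have "\<dots> \<le> ennreal (2 ^ ?n) * H r"
      unfolding H_def by (rule mult_left_mono[OF emeasure_le_hausdorff_measure[OF m]]) simp
    also have "\<dots> = ennreal (2 ^ ?n * h)" unfolding Hh by (simp add: ennreal_mult')
    also have "\<dots> \<le> ennreal (2 ^ ?n * r powr p)" using hr by (intro ennreal_leI) simp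
    finally show ?thesis .
  qed
  then show ?thesis using p(1) b(1) by (intro exI[of _ p] conjI exI[of _ "min b 1"] allI impI) auto
qed

section \<open>Cut-off functions and approximation off a small set\<close>

lemma conv_lipschitz:
  fixes f :: "real ^ 'n \<Rightarrow> real"
  assumes f: "integrable lborel f" "L-lipschitz_on UNIV f" and \<rho>: "mollifier \<epsilon> \<rho>"
  shows "L-lipschitz_on UNIV (conv f \<rho>)"
proof (rule lipschitz_onI)
  fix x x' :: "real ^ 'n"
  define h where "h = x - x'"
  have i: "integrable lborel (\<lambda>y. f y * \<rho> (x - y))" "integrable lborel (\<lambda>y. f y * \<rho> (x' - y))"
    by (rule conv_integrable[OF f(1) mollifierD(1)[OF \<rho>]])+
  have xh: "x - (h + y) = x' - y" for y by (simp add: h_def)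
  have e1: "conv f \<rho> x = (LINT y|lborel. f (h + y) * \<rho> (x' - y))"
    unfolding conv_def using integral_lborel_translate(2)[OF i(1), of h] unfolding xh by simp
  have e2: "integrable lborel (\<lambda>y. f (h + y) * \<rho> (x' - y))"
    using integral_lborel_translate(1)[OF i(1), of h] unfolding xh .
  have eq: "conv f \<rho> x - conv f \<rho> x' = (LINT y|lborel. f (h + y) * \<rho> (x' - y) - f y * \<rho> (x' - y))"
    unfolding e1 conv_def[of f \<rho> x'] by (rule Bochner_Integration.integral_diff[OF e2 i(2), symmetric])
  have "\<bar>LINT y|lborel. f (h + y) * \<rho> (x' - y) - f y * \<rho> (x' - y)\<bar> \<le> (LINT y|lborel. (L * norm h) * \<rho> (x' - y))"
  proof (rule integral_abs_bound[THEN order_trans], rule integral_mono)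
    show "integrable lborel (\<lambda>y. \<bar>f (h + y) * \<rho> (x' - y) - f y * \<rho> (x' - y)\<bar>)"
      by (intro integrable_abs Bochner_Integration.integrable_diff i(2) e2)
    show "integrable lborel (\<lambda>y. (L * norm h) * \<rho> (x' - y))"
      using mollifier_translate(1)[OF \<rho>, of x'] by simp
    fix y
    have "\<bar>f (h + y) - f y\<bar> \<le> L * norm h"
      using lipschitz_onD[OF f(2), of "h + y" y] by (simp add: dist_norm dist_real_def)
    then have "\<bar>f (h + y) - f y\<bar> * \<rho> (x' - y) \<le> L * norm h * \<rho> (x' - y)"
      using mollifierD(2)[OF \<rho>] by (rule mult_right_mono)
    then show "\<bar>f (h + y) * \<rho> (x' - y) - f y * \<rho> (x' - y)\<bar> \<le> L * norm h * \<rho> (x' - y)"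
      using mollifierD(2)[OF \<rho>, of "x' - y"] by (simp add: left_diff_distrib[symmetric] abs_mult)
  qed
  then have "\<bar>conv f \<rho> x - conv f \<rho> x'\<bar> \<le> L * norm h"
    unfolding eq integral_mult_right_zero mollifier_translate(2)[OF \<rho>, of x'] mult_1_right .
  then show "dist (conv f \<rho> x) (conv f \<rho> x') \<le> L * dist x x'" by (simp add: dist_real_def h_def dist_norm)
qed (rule lipschitz_on_nonneg[OF f(2)])

lemma lipschitz_norm_grad_le:
  fixes f :: "real ^ 'n \<Rightarrow> real"
  assumes lip: "L-lipschitz_on UNIV f" and diff: "f differentiable (at x)"
  shows "norm (grad f x) \<le> L"
proof -
  define h where "h = grad f x"
  have L: "L \<ge> 0" by (rule lipschitz_on_nonneg[OF lip])
  have "((\<lambda>s. f (x + s *\<^sub>R h)) has_derivative (\<lambda>s. grad f x \<bullet> (s *\<^sub>R h))) (at 0)"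
  proof (rule has_derivative_compose[of _ "\<lambda>s. s *\<^sub>R h" 0 UNIV f])
    show "((\<lambda>s. x + s *\<^sub>R h) has_derivative (\<lambda>s. s *\<^sub>R h)) (at 0)"
      by (auto intro!: derivative_eq_intros)
    show "(f has_derivative (\<lambda>k. grad f x \<bullet> k)) (at (x + 0 *\<^sub>R h))"
      using has_derivative_grad[OF diff] by simp
  qed
  then have "((\<lambda>s. f (x + s *\<^sub>R h)) has_field_derivative (h \<bullet> h)) (at 0)"
    by (simp add: has_field_derivative_def h_def mult_commute_abs)
  then have "(\<lambda>s. (f (x + s *\<^sub>R h) - f x) / s) \<midarrow>0\<rightarrow> h \<bullet> h"
    by (simp add: DERIV_def)
  moreover have "(f (x + s *\<^sub>R h) - f x) / s \<le> L * norm h" for s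
  proof (cases "s = 0")
    case False
    have "\<bar>f (x + s *\<^sub>R h) - f x\<bar> \<le> L * (\<bar>s\<bar> * norm h)"
      using lipschitz_onD[OF lip, of "x + s *\<^sub>R h" x] by (simp add: dist_norm dist_real_def)
    then have "\<bar>(f (x + s *\<^sub>R h) - f x) / s\<bar> \<le> L * norm h"
      using False by (simp add: abs_divide field_simps)
    then show ?thesis by linarith
  qed (use L in simp)
  ultimately have "h \<bullet> h \<le> L * norm h"
    by (intro tendsto_upperbound[of _ _ "at (0::real)"]) auto
  then have "norm h * norm h \<le> L * norm h" by (simp add: dot_square_norm power2_eq_square)
  then have "norm h \<le> L"
    using L by (cases "h = 0") auto
  then show ?thesis by (simp add: h_def)
qed

text \<open>Cut-off functions that vanish near \<open>K\<close>, with gradient bounded by \<open>1 / r\<close>. A Lipschitz cut-off is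
mollified at scale \<open>r / 2\<close>, which preserves its Lipschitz constant.\<close>

lemma cutoff_exists:
  fixes K :: "(real ^ 'n) set"
  assumes K: "compact K" "K \<noteq> {}" and r: "r > 0"
  shows "\<exists>\<eta> :: real ^ 'n \<Rightarrow> real. C1_on UNIV \<eta> \<and> (\<forall>x. 0 \<le> \<eta> x \<and> \<eta> x \<le> 1) \<and> (\<forall>x. norm (grad \<eta> x) \<le> 1 / r) \<and>
    (\<forall>x. infdist x K \<le> r / 2 \<longrightarrow> \<eta> x = 0) \<and> (\<forall>x. 3 * r \<le> infdist x K \<longrightarrow> \<eta> x = 1 \<and> grad \<eta> x = 0)"
proof -
  define \<kappa> where "\<kappa> x = max 0 (min 1 (2 - infdist x K / r))" for x
  have lip: "(1 / r)-lipschitz_on UNIV \<kappa>"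
  proof (rule lipschitz_onI)
    fix x y
    have "\<bar>infdist x K - infdist y K\<bar> / r \<le> dist x y / r"
      using infdist_triangle_abs[of x K y] r by (intro divide_right_mono) auto
    then have "\<bar>infdist x K / r - infdist y K / r\<bar> \<le> dist x y / r"
      using r by (simp add: diff_divide_distrib[symmetric] abs_divide)
    then show "dist (\<kappa> x) (\<kappa> y) \<le> 1 / r * dist x y"
      unfolding \<kappa>_def dist_real_def by (auto simp: max_def min_def abs_if split: if_splits)
  qed (use r in simp)
  have k1: "\<kappa> x = 1" if "infdist x K \<le> r" for x
  proof -
    have "infdist x K / r \<le> 1" using that r by simp
    then show ?thesis by (simp add: \<kappa>_def)
  qed
  have k0: "\<kappa> x = 0" if "2 * r \<le> infdist x K" for x
  proof -
    have "2 \<le> infdist x K / r" using that r by (simp add: pos_le_divide_eq)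
    then show ?thesis by (simp add: \<kappa>_def)
  qed
  have cpt: "compact {x. infdist x K \<le> 2 * r}" using compact_infdist_le[OF K(2,1), of "2 * r"] r by simp
  have int: "integrable lborel \<kappa>"
    by (rule integrable_continuous_compact_support[OF lipschitz_on_continuous_on[OF lip] cpt]) (auto simp: k0)
  obtain \<rho> :: "real ^ 'n \<Rightarrow> real" where \<rho>: "mollifier (r / 2) \<rho>"
    using mollifier_exists[of "r / 2"] r by auto
  let ?c = "conv \<kappa> \<rho>"
  have c1: "?c x = 1" if "infdist x K \<le> r / 2" for x
  proof -
    have "\<bar>?c x - 1\<bar> \<le> 0"
    proof (rule conv_near_const[OF int \<rho>])
      fix y assume "dist y x \<le> r / 2"
      then have "infdist y K \<le> r" using infdist_triangle_abs[of y K x] that by linarith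
      then show "\<bar>\<kappa> y - 1\<bar> \<le> 0" using k1 by simp
    qed
    then show ?thesis by simp
  qed
  have c0: "?c x = 0" if "5 / 2 * r \<le> infdist x K" for x
  proof -
    have "\<bar>?c x - 0\<bar> \<le> 0"
    proof (rule conv_near_const[OF int \<rho>])
      fix y assume "dist y x \<le> r / 2"
      then have "2 * r \<le> infdist y K" using infdist_triangle_abs[of y K x] that by linarith
      then show "\<bar>\<kappa> y - 0\<bar> \<le> 0" using k0 by simp
    qed
    then show ?thesis by simp
  qed
  have c01: "0 \<le> ?c x \<and> ?c x \<le> 1" for x
  proof -
    have "\<bar>?c x - 1 / 2\<bar> \<le> 1 / 2"
    proof (rule conv_near_const[OF int \<rho>])
      fix y
      have "0 \<le> \<kappa> y" "\<kappa> y \<le> 1" by (auto simp: \<kappa>_def)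
      then show "\<bar>\<kappa> y - 1 / 2\<bar> \<le> 1 / 2" by (simp only: abs_le_iff) linarith
    qed
    then show ?thesis by (simp only: abs_le_iff) linarith
  qed
  have cs: "C1_on UNIV ?c" by (rule smooth_on_imp_C1_on[OF conv_smooth[OF int mollifierD(1)[OF \<rho>]]])
  have cd: "?c differentiable (at x)" for x using cs by (simp add: C1_on_def)
  have cg: "norm (grad ?c x) \<le> 1 / r" for x
    by (rule lipschitz_norm_grad_le[OF conv_lipschitz[OF int lip \<rho>] cd])
  have cg0: "grad ?c x = 0" if "3 * r \<le> infdist x K" for x
  proof (rule grad_eq_0_outside(1))
    show "closed {x. infdist x K \<le> 5 / 2 * r}" by (intro closed_Collect_le continuous_intros)
    show "?c y = 0" if "y \<notin> {x. infdist x K \<le> 5 / 2 * r}" for y using c0[of y] that by simp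
    show "x \<notin> {x. infdist x K \<le> 5 / 2 * r}" using that r by simp
  qed
  define \<eta> where "\<eta> x = 1 - ?c x" for x
  have \<eta>d: "(\<eta> has_derivative (\<lambda>h. (- grad ?c x) \<bullet> h)) (at x)" for x
    unfolding \<eta>_def by (auto intro!: derivative_eq_intros has_derivative_grad[OF cd])
  have \<eta>g: "grad \<eta> x = - grad ?c x" for x by (rule grad_eqI[OF \<eta>d])
  have "C1_on UNIV \<eta>"
    unfolding C1_on_def
  proof (intro conjI ballI)
    show "\<eta> differentiable (at x)" for x using \<eta>d by (rule has_derivative_imp_differentiable)
    have "grad \<eta> = (\<lambda>x. - grad ?c x)" using \<eta>g by auto
    then show "continuous_on UNIV (grad \<eta>)" using cs by (auto simp: C1_on_def intro: continuous_on_minus)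
  qed
  moreover have "\<eta> x = 1 \<and> grad \<eta> x = 0" if "3 * r \<le> infdist x K" for x
    using that r c0[of x] cg0[of x] by (simp add: \<eta>_def \<eta>g)
  ultimately show ?thesis
    using c01 cg c1 by (intro exI[of _ \<eta>]) (simp add: \<eta>g, simp add: \<eta>_def)
qed

text \<open>A measurable set that is contained in all tubes around \<open>K\<close> is a null set, as
their volumes tend to zero. For empty \<open>K\<close> the distance is zero everywhere by convention, and every tube is the whole of \<open>\<Omega>\<close>.\<close>

lemma tube_null:
  fixes \<Omega> K :: "(real ^ 'n) set"
  assumes p: "p > 2" and r0: "r0 > 0" 
    and decay: "\<And>r. 0 < r \<Longrightarrow> r < r0 \<Longrightarrow> emeasure lebesgue {x \<in> \<Omega>. infdist x K < r} \<le> ennreal (2 ^ CARD('n) * r powr p)"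
    and S: "S \<in> sets lebesgue" "\<And>x. x \<in> S \<Longrightarrow> x \<in> \<Omega> \<and> infdist x K = 0" and \<Omega>: "open \<Omega>"
  shows "S \<in> null_sets lebesgue"
proof -
  have le: "emeasure lebesgue S \<le> ennreal (2 ^ CARD('n) * r powr p)" if r: "0 < r" "r < r0" for r
  proof -
    have "open {x. infdist x K < r}" by (intro open_Collect_less continuous_intros)
    then have "open (\<Omega> \<inter> {x. infdist x K < r})" using \<Omega> by (rule open_Int[rotated])
    then have "{x \<in> \<Omega>. infdist x K < r} \<in> sets lebesgue" by (simp add: Int_def)
    then have "emeasure lebesgue S \<le> emeasure lebesgue {x \<in> \<Omega>. infdist x K < r}"
      by (rule emeasure_mono[rotated]) (use S(2) r in auto)
    also have "\<dots> \<le> ennreal (2 ^ CARD('n) * r powr p)" by (rule decay[OF r])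
    finally show ?thesis .
  qed
  have "((\<lambda>r. 2 ^ CARD('n) * r powr p) \<longlongrightarrow> 2 ^ CARD('n) * 0 powr p) (at_right 0)"
    using p by (intro tendsto_intros) (auto intro: eventually_at_rightI[of 0 1])
  then have "((\<lambda>r. ennreal (2 ^ CARD('n) * r powr p)) \<longlongrightarrow> ennreal (2 ^ CARD('n) * 0 powr p)) (at_right 0)"
    by (rule tendsto_ennrealI)
  then have "emeasure lebesgue S \<le> ennreal (2 ^ CARD('n) * 0 powr p)"
    by (rule tendsto_lowerbound) (use le r0 in \<open>auto intro!: eventually_at_rightI[of 0 r0]\<close>)
  then show ?thesis using S(1) by (intro null_setsI) simp_all
qed

text \<open>The set \<open>K\<close> has zero capacity: cutting off a function near \<open>K\<close> at scale \<open>r\<close> changes its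
gradient by a field whose square is \<open>O(r\<^sup>-\<^sup>2)\<close>, supported on a tube of volume \<open>O(r\<^sup>p)\<close>, and \<open>p > 2\<close>.\<close>

lemma cutoff_approx:
  fixes \<Omega> K :: "(real ^ 'n) set"
  assumes \<Omega>: "open \<Omega>" and K: "compact K" "K \<noteq> {}" "K \<subseteq> \<Omega>"
    and p: "p > 2" and r0: "r0 > 0"
    and decay: "\<And>r. 0 < r \<Longrightarrow> r < r0 \<Longrightarrow> emeasure lebesgue {x \<in> \<Omega>. infdist x K < r} \<le> ennreal (2 ^ CARD('n) * r powr p)"
    and \<phi>: "\<phi> \<in> C1c \<Omega>" and e: "e > 0"
  shows "\<exists>f\<in>C1c (\<Omega> - K). (\<integral>\<^sup>+x\<in>\<Omega>. ennreal ((f x - \<phi> x)\<^sup>2 + (norm (grad f x - grad \<phi> x))\<^sup>2) \<partial>lebesgue) \<le> ennreal e"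
proof -
  obtain C where C: "compact C" "C \<subseteq> \<Omega>" "\<And>x. x \<notin> C \<Longrightarrow> \<phi> x = 0"
    using C1cD(4)[OF \<phi>] by (auto simp: compact_support_in_def)
  obtain M1 where M1: "\<And>x. norm (grad \<phi> x) \<le> M1" "M1 \<ge> 0" using C1c_bounded_grad[OF \<phi>] by blast
  have "compact (\<phi> ` C)"
    by (rule compact_continuous_image[OF continuous_on_subset[OF C1cD(3)[OF \<phi>] subset_UNIV] C(1)])
  then obtain M2 where M2: "M2 > 0" "\<And>x. x \<in> C \<Longrightarrow> \<bar>\<phi> x\<bar> \<le> M2"
    by (metis bounded_pos compact_imp_bounded imageI real_norm_def)
  have M2': "\<bar>\<phi> x\<bar> \<le> M2" for x using M2 C(3)[of x] by (cases "x \<in> C") auto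
  define M where "M = max M1 M2"
  have M: "M > 0" "\<And>x. norm (grad \<phi> x) \<le> M" "\<And>x. \<bar>\<phi> x\<bar> \<le> M"
    using M1(1) M2(1) M2' unfolding M_def by (auto simp: less_max_iff_disj le_max_iff_disj)
  define c where "c = 5 * M\<^sup>2 * (2 ^ CARD('n) * 3 powr p)"
  have c: "c > 0" using M(1) by (simp add: c_def)
  \<comment> \<open>the error is at most \<open>c r\<^sup>p\<^sup>-\<^sup>2\<close>; this choice of \<open>r\<close> makes it at most \<open>e\<close>\<close>
  define r where "r = min (min 1 (r0 / 4)) ((e / c) powr (1 / (p - 2)))"
  have r: "0 < r" "r \<le> 1" "3 * r < r0" using r0 e c by (auto simp: r_def min_def)
  have "r powr (p - 2) \<le> ((e / c) powr (1 / (p - 2))) powr (p - 2)"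
    using r(1) p by (intro powr_mono2) (auto simp: r_def)
  also have "\<dots> = e / c" using p e c by (simp add: powr_powr)
  finally have rp: "c * r powr (p - 2) \<le> e" using c by (simp add: pos_le_divide_eq mult.commute)
  obtain \<eta> :: "real ^ 'n \<Rightarrow> real" where \<eta>: "C1_on UNIV \<eta>" "\<And>x. 0 \<le> \<eta> x \<and> \<eta> x \<le> 1" "\<And>x. norm (grad \<eta> x) \<le> 1 / r"
    "\<And>x. infdist x K \<le> r / 2 \<Longrightarrow> \<eta> x = 0" "\<And>x. 3 * r \<le> infdist x K \<Longrightarrow> \<eta> x = 1 \<and> grad \<eta> x = 0"
    using cutoff_exists[OF K(1,2) r(1)] by auto
  define f where "f x = \<phi> x * \<eta> x" for x
  have f1: "f \<in> C1c \<Omega>" unfolding f_def by (rule C1c_mult(1)[OF \<Omega> \<phi> C1_on_subset[OF \<eta>(1) subset_UNIV]])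
  have gf: "grad f x = \<phi> x *\<^sub>R grad \<eta> x + \<eta> x *\<^sub>R grad \<phi> x" for x
    unfolding f_def by (rule grad_mult) (use C1cD(1)[OF \<phi>] \<eta>(1) in \<open>auto simp: C1_on_def\<close>)
  have "compact_support_in (\<Omega> - K) f"
    unfolding compact_support_in_def
  proof (intro exI conjI allI impI)
    show "compact (C \<inter> {x. r / 2 \<le> infdist x K})"
      by (intro compact_Int_closed C(1) closed_Collect_le continuous_intros)
    have "x \<notin> K" if "r / 2 \<le> infdist x K" for x
      using that r(1) infdist_le[of x K x] by auto
    then show "C \<inter> {x. r / 2 \<le> infdist x K} \<subseteq> \<Omega> - K" using C(2) by auto
    show "f x = 0" if "x \<notin> C \<inter> {x. r / 2 \<le> infdist x K}" for x
      using that C(3)[of x] \<eta>(4)[of x] by (auto simp: f_def)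
  qed
  then have f2: "f \<in> C1c (\<Omega> - K)" using f1 by (simp add: C1c_def)
  have bd: "(f x - \<phi> x)\<^sup>2 + (norm (grad f x - grad \<phi> x))\<^sup>2 \<le> 5 * M\<^sup>2 / r\<^sup>2" for x
  proof -
    have r2: "1 \<le> 1 / r" using r by simp
    have "\<bar>f x - \<phi> x\<bar> = \<bar>\<phi> x\<bar> * \<bar>\<eta> x - 1\<bar>"
      by (simp add: f_def abs_mult[symmetric] algebra_simps)
    also have "\<dots> \<le> M * 1" using M(3)[of x] \<eta>(2)[of x] by (intro mult_mono) auto
    also have "\<dots> \<le> M * (1 / r)" using M(1) r2 by (intro mult_left_mono) auto
    finally have "\<bar>f x - \<phi> x\<bar>\<^sup>2 \<le> (M * (1 / r))\<^sup>2" by (intro power_mono) auto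
    then have 1: "(f x - \<phi> x)\<^sup>2 \<le> M\<^sup>2 / r\<^sup>2" by (simp add: power_divide)
    have "grad f x - grad \<phi> x = \<phi> x *\<^sub>R grad \<eta> x + (\<eta> x - 1) *\<^sub>R grad \<phi> x"
      by (simp add: gf scaleR_left_diff_distrib)
    then have "norm (grad f x - grad \<phi> x) \<le> \<bar>\<phi> x\<bar> * norm (grad \<eta> x) + \<bar>\<eta> x - 1\<bar> * norm (grad \<phi> x)"
      by (metis norm_scaleR norm_triangle_ineq)
    also have "\<dots> \<le> M * (1 / r) + 1 * M"
      using M(1) M(2)[of x] M(3)[of x] \<eta>(2)[of x] \<eta>(3)[of x] r(1) by (intro add_mono mult_mono) auto
    also have "\<dots> \<le> M * (1 / r) + M * (1 / r)" using mult_left_mono[OF r2, of M] M(1) by simp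
    finally have "(norm (grad f x - grad \<phi> x))\<^sup>2 \<le> (2 * (M * (1 / r)))\<^sup>2" by (intro power_mono) auto
    then have 2: "(norm (grad f x - grad \<phi> x))\<^sup>2 \<le> 4 * M\<^sup>2 / r\<^sup>2" by (simp add: power_divide power_mult_distrib)
    have "5 * M\<^sup>2 / r\<^sup>2 = M\<^sup>2 / r\<^sup>2 + 4 * M\<^sup>2 / r\<^sup>2" by (simp add: add_divide_distrib[symmetric])
    then show ?thesis using 1 2 by linarith
  qed
  have far: "(f x - \<phi> x)\<^sup>2 + (norm (grad f x - grad \<phi> x))\<^sup>2 = 0" if "3 * r \<le> infdist x K" for x
    using \<eta>(5)[OF that] gf[of x] by (simp add: f_def)
  let ?T = "{x \<in> \<Omega>. infdist x K < 3 * r}"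
  have Tm: "?T \<in> sets lebesgue"
  proof -
    have "open {x. infdist x K < 3 * r}" by (intro open_Collect_less continuous_intros)
    then have "open (\<Omega> \<inter> {x. infdist x K < 3 * r})" using \<Omega> by (rule open_Int[rotated])
    then show ?thesis by (simp add: Int_def)
  qed
  have "(\<integral>\<^sup>+x\<in>\<Omega>. ennreal ((f x - \<phi> x)\<^sup>2 + (norm (grad f x - grad \<phi> x))\<^sup>2) \<partial>lebesgue)
    \<le> (\<integral>\<^sup>+x. ennreal (5 * M\<^sup>2 / r\<^sup>2) * indicator ?T x \<partial>lebesgue)"
  proof (rule nn_integral_mono)
    fix x
    show "ennreal ((f x - \<phi> x)\<^sup>2 + (norm (grad f x - grad \<phi> x))\<^sup>2) * indicator \<Omega> x \<le> ennreal (5 * M\<^sup>2 / r\<^sup>2) * indicator ?T x"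
    proof (cases "infdist x K < 3 * r")
      case True
      have eq: "indicator \<Omega> x = (indicator ?T x :: ennreal)" using True by (simp add: indicator_def)
      show ?thesis unfolding eq by (rule mult_right_mono[OF ennreal_leI[OF bd]]) simp
    next
      case False
      then show ?thesis using far[of x] by simp
    qed
  qed
  also have "\<dots> = ennreal (5 * M\<^sup>2 / r\<^sup>2) * emeasure lebesgue ?T"
    using Tm by (rule nn_integral_cmult_indicator)
  also have "\<dots> \<le> ennreal (5 * M\<^sup>2 / r\<^sup>2) * ennreal (2 ^ CARD('n) * (3 * r) powr p)"
    by (rule mult_left_mono[OF decay]) (use r in auto)
  also have "\<dots> = ennreal (5 * M\<^sup>2 / r\<^sup>2 * (2 ^ CARD('n) * (3 * r) powr p))"
    by (rule ennreal_mult[symmetric]) auto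
  also have "5 * M\<^sup>2 / r\<^sup>2 * (2 ^ CARD('n) * (3 * r) powr p) = c * r powr (p - 2)"
    using r(1) by (simp add: c_def powr_mult powr_diff)
  also have "ennreal (c * r powr (p - 2)) \<le> ennreal e" using rp by (rule ennreal_leI)
  finally show ?thesis using f2 by blast
qed

text \<open>The inequality passes from functions supported off \<open>K\<close> to the Sobolev space on the whole domain:
approximating test functions can be cut off near \<open>K\<close> with an arbitrarily small error.\<close>

theorem H10_ineq:
  fixes \<Omega> K :: "(real ^ 'n) set" and A :: "real ^ 'n \<Rightarrow> real ^ 'n ^ 'n"
  assumes \<Omega>: "open \<Omega>" and K: "compact K" "K \<noteq> {}" "K \<subseteq> \<Omega>"
    and p: "p > 2" and r0: "r0 > 0"
    and decay: "\<And>r. 0 < r \<Longrightarrow> r < r0 \<Longrightarrow> emeasure lebesgue {x \<in> \<Omega>. infdist x K < r} \<le> ennreal (2 ^ CARD('n) * r powr p)"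
    and A: "elliptic_loc (\<Omega> - K) A" and bound: "\<And>x \<xi>. x \<in> \<Omega> \<Longrightarrow> normA_sq A x \<xi> \<le> \<Lambda> * (norm \<xi>)\<^sup>2" "\<Lambda> \<ge> 0"
    and R: "continuous_on (\<Omega> - K) R"
    and ineq: "\<And>f. f \<in> C1c (\<Omega> - K) \<Longrightarrow> weighted_ineq (\<Omega> - K) A R f (grad f)"
    and u: "u \<in> H10 \<Omega>" and Du: "weak_gradient \<Omega> u Du"
  shows "weighted_ineq (\<Omega> - K) A R u Du"
proof -
  let ?U = "\<Omega> - K"
  have U: "open ?U" using \<Omega> K(1) by (simp add: compact_imp_closed open_Diff)
  have Um: "?U \<in> sets lebesgue" using U by auto
  have \<Omega>m: "\<Omega> \<in> sets lebesgue" using \<Omega> by auto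
  obtain G \<phi> where G: "weak_gradient \<Omega> u G" and \<phi>: "\<And>k. \<phi> k \<in> Cc_smooth \<Omega>"
    and lim: "(\<lambda>k. \<integral>\<^sup>+x\<in>\<Omega>. ennreal ((\<phi> k x - u x)\<^sup>2 + (norm (grad (\<phi> k) x - G x))\<^sup>2) \<partial>lebesgue) \<longlonglongrightarrow> 0"
    using u unfolding H10_def by blast
  have \<phi>C: "\<phi> k \<in> C1c \<Omega>" for k using \<phi> Cc_smooth_subset_C1c by blast
  have "\<forall>k. \<exists>f. f \<in> C1c ?U \<and> (\<integral>\<^sup>+x\<in>\<Omega>. ennreal ((f x - \<phi> k x)\<^sup>2 + (norm (grad f x - grad (\<phi> k) x))\<^sup>2) \<partial>lebesgue) \<le> ennreal (inverse (real (Suc k)))"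
  proof
    fix k
    have "inverse (real (Suc k)) > 0" by simp
    from cutoff_approx[OF \<Omega> K p r0 decay \<phi>C this]
    show "\<exists>f. f \<in> C1c ?U \<and> (\<integral>\<^sup>+x\<in>\<Omega>. ennreal ((f x - \<phi> k x)\<^sup>2 + (norm (grad f x - grad (\<phi> k) x))\<^sup>2) \<partial>lebesgue) \<le> ennreal (inverse (real (Suc k)))"
      by blast
  qed
  from choice[OF this] obtain f where f: "\<And>k. f k \<in> C1c ?U"
    "\<And>k. (\<integral>\<^sup>+x\<in>\<Omega>. ennreal ((f k x - \<phi> k x)\<^sup>2 + (norm (grad (f k) x - grad (\<phi> k) x))\<^sup>2) \<partial>lebesgue) \<le> ennreal (inverse (real (Suc k)))"
    by blast
  have lu: "locally_integrable \<Omega> u" "locally_integrable \<Omega> G" "locally_integrable \<Omega> Du"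
    using G Du by (auto simp: weak_gradient_def)
  note um = locally_integrable_measurable_on[OF \<Omega> lu(1)] locally_integrable_measurable_on[OF \<Omega> lu(2)]
  have cm: "h \<in> borel_measurable (lebesgue_on \<Omega>)" if "continuous_on UNIV h" for h :: "real ^ 'n \<Rightarrow> 'b::topological_space"
    using continuous_on_subset[OF that subset_UNIV] \<Omega>m by (rule continuous_imp_measurable_on_sets_lebesgue)
  have fm: "f k \<in> borel_measurable (lebesgue_on \<Omega>)" "grad (f k) \<in> borel_measurable (lebesgue_on \<Omega>)" for k
    using cm[OF C1cD(3)[OF f(1)]] cm[OF C1cD(2)[OF f(1)]] .
  have \<phi>m: "\<phi> k \<in> borel_measurable (lebesgue_on \<Omega>)" "grad (\<phi> k) \<in> borel_measurable (lebesgue_on \<Omega>)" for k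
    using cm[OF C1cD(3)[OF \<phi>C]] cm[OF C1cD(2)[OF \<phi>C]] .
  define E where "E k = (\<integral>\<^sup>+x\<in>\<Omega>. ennreal ((f k x - u x)\<^sup>2 + (norm (grad (f k) x - G x))\<^sup>2) \<partial>lebesgue)" for k
  define E1 where "E1 k = (\<integral>\<^sup>+x\<in>\<Omega>. ennreal ((f k x - \<phi> k x)\<^sup>2 + (norm (grad (f k) x - grad (\<phi> k) x))\<^sup>2) \<partial>lebesgue)" for k
  define E2 where "E2 k = (\<integral>\<^sup>+x\<in>\<Omega>. ennreal ((\<phi> k x - u x)\<^sup>2 + (norm (grad (\<phi> k) x - G x))\<^sup>2) \<partial>lebesgue)" for k
  have sq: "(a + b)\<^sup>2 \<le> 2 * a\<^sup>2 + 2 * b\<^sup>2" for a b :: real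
    using sum_squares_bound[of a b] by (simp add: power2_sum)
  have EE: "E k \<le> 2 * E1 k + 2 * E2 k" for k
  proof -
    note [measurable] = fm[of k] \<phi>m[of k] um
    have "E k \<le> (\<integral>\<^sup>+x. 2 * ennreal ((f k x - \<phi> k x)\<^sup>2 + (norm (grad (f k) x - grad (\<phi> k) x))\<^sup>2)
        + 2 * ennreal ((\<phi> k x - u x)\<^sup>2 + (norm (grad (\<phi> k) x - G x))\<^sup>2) \<partial>lebesgue_on \<Omega>)"
      unfolding E_def nn_integral_on[OF \<Omega>m]
    proof (rule nn_integral_mono)
      fix x
      have 1: "(f k x - u x)\<^sup>2 \<le> 2 * (f k x - \<phi> k x)\<^sup>2 + 2 * (\<phi> k x - u x)\<^sup>2"
        using sq[of "f k x - \<phi> k x" "\<phi> k x - u x"] by simp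
      have "norm (grad (f k) x - G x) \<le> norm (grad (f k) x - grad (\<phi> k) x) + norm (grad (\<phi> k) x - G x)"
        by norm
      then have "(norm (grad (f k) x - G x))\<^sup>2 \<le> (norm (grad (f k) x - grad (\<phi> k) x) + norm (grad (\<phi> k) x - G x))\<^sup>2"
        by (intro power_mono) auto
      also note sq
      finally have 2: "(norm (grad (f k) x - G x))\<^sup>2 \<le> 2 * (norm (grad (f k) x - grad (\<phi> k) x))\<^sup>2 + 2 * (norm (grad (\<phi> k) x - G x))\<^sup>2" .
      have "ennreal ((f k x - u x)\<^sup>2 + (norm (grad (f k) x - G x))\<^sup>2)
        \<le> ennreal (2 * ((f k x - \<phi> k x)\<^sup>2 + (norm (grad (f k) x - grad (\<phi> k) x))\<^sup>2) + 2 * ((\<phi> k x - u x)\<^sup>2 + (norm (grad (\<phi> k) x - G x))\<^sup>2))"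
        using add_mono[OF 1 2] by (intro ennreal_leI) (simp only: distrib_left add_ac)
      also have "\<dots> = ennreal (2 * ((f k x - \<phi> k x)\<^sup>2 + (norm (grad (f k) x - grad (\<phi> k) x))\<^sup>2))
        + ennreal (2 * ((\<phi> k x - u x)\<^sup>2 + (norm (grad (\<phi> k) x - G x))\<^sup>2))"
        by (rule ennreal_plus) simp_all
      also have "\<dots> = 2 * ennreal ((f k x - \<phi> k x)\<^sup>2 + (norm (grad (f k) x - grad (\<phi> k) x))\<^sup>2)
        + 2 * ennreal ((\<phi> k x - u x)\<^sup>2 + (norm (grad (\<phi> k) x - G x))\<^sup>2)"
        unfolding ennreal_mult'[of 2, simplified] by simp
      finally show "ennreal ((f k x - u x)\<^sup>2 + (norm (grad (f k) x - G x))\<^sup>2) \<le> \<dots>" .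
    qed
    also have "\<dots> = 2 * E1 k + 2 * E2 k"
      unfolding E1_def E2_def nn_integral_on[OF \<Omega>m]
      by (subst nn_integral_add) (simp_all add: nn_integral_cmult del: ennreal_plus)
    finally show ?thesis .
  qed
  have E10: "E1 \<longlonglongrightarrow> 0"
  proof (rule tendsto_sandwich[OF _ _ tendsto_const])
    show "\<forall>\<^sub>F k in sequentially. E1 k \<le> ennreal (inverse (real (Suc k)))"
      using f(2) unfolding E1_def by simp
    show "(\<lambda>k. ennreal (inverse (real (Suc k)))) \<longlonglongrightarrow> 0"
      using tendsto_ennrealI[OF LIMSEQ_inverse_real_of_nat] by simp
  qed simp
  have E0: "E \<longlonglongrightarrow> 0"
  proof (rule tendsto_sandwich[OF _ _ tendsto_const])
    have "(\<lambda>k. 2 * E1 k + 2 * E2 k) \<longlonglongrightarrow> 2 * 0 + 2 * 0"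
      using lim E10 unfolding E2_def[abs_def, symmetric] by (intro tendsto_add ennreal_tendsto_cmult) auto
    then show "(\<lambda>k. 2 * E1 k + 2 * E2 k) \<longlonglongrightarrow> 0" by simp
  qed (use EE in auto)
  have UO: "?U \<subseteq> \<Omega>" by blast
  note restr = measurable_restrict_mono[OF _ UO]
  have slim: "(\<lambda>k. \<integral>\<^sup>+x\<in>C. ennreal ((f k x - u x)\<^sup>2) \<partial>lebesgue) \<longlonglongrightarrow> 0" if "compact C" "C \<subseteq> ?U" for C
  proof (rule tendsto_sandwich[OF _ _ tendsto_const E0])
    have "(\<integral>\<^sup>+x\<in>C. ennreal ((f k x - u x)\<^sup>2) \<partial>lebesgue) \<le> E k" for k
      unfolding E_def using that(2) by (intro nn_integral_mono mult_mono ennreal_leI) (auto simp: indicator_def)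
    then show "\<forall>\<^sub>F k in sequentially. (\<integral>\<^sup>+x\<in>C. ennreal ((f k x - u x)\<^sup>2) \<partial>lebesgue) \<le> E k" by simp
  qed simp
  have glim: "(\<lambda>k. \<integral>\<^sup>+x\<in>?U. ennreal (normA_sq A x (grad (f k) x - G x)) \<partial>lebesgue) \<longlonglongrightarrow> 0"
  proof (rule tendsto_sandwich[OF _ _ tendsto_const])
    show "(\<lambda>k. ennreal \<Lambda> * E k) \<longlonglongrightarrow> 0"
      using ennreal_tendsto_cmult[OF _ E0, of "ennreal \<Lambda>"] by simp
    have "(\<integral>\<^sup>+x\<in>?U. ennreal (normA_sq A x (grad (f k) x - G x)) \<partial>lebesgue) \<le> ennreal \<Lambda> * E k" for k
    proof -
      note [measurable] = fm[of k] um
      have "(\<integral>\<^sup>+x\<in>?U. ennreal (normA_sq A x (grad (f k) x - G x)) \<partial>lebesgue)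
        \<le> (\<integral>\<^sup>+x\<in>\<Omega>. ennreal \<Lambda> * ennreal ((f k x - u x)\<^sup>2 + (norm (grad (f k) x - G x))\<^sup>2) \<partial>lebesgue)"
      proof (rule nn_integral_mono)
        fix x
        show "ennreal (normA_sq A x (grad (f k) x - G x)) * indicator ?U x
          \<le> ennreal \<Lambda> * ennreal ((f k x - u x)\<^sup>2 + (norm (grad (f k) x - G x))\<^sup>2) * indicator \<Omega> x"
        proof (cases "x \<in> ?U")
          case True
          have "normA_sq A x (grad (f k) x - G x) \<le> \<Lambda> * (norm (grad (f k) x - G x))\<^sup>2" using True bound(1) by blast
          also have "\<dots> \<le> \<Lambda> * ((f k x - u x)\<^sup>2 + (norm (grad (f k) x - G x))\<^sup>2)" using bound(2) by (intro mult_left_mono) auto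
          finally have "ennreal (normA_sq A x (grad (f k) x - G x)) \<le> ennreal (\<Lambda> * ((f k x - u x)\<^sup>2 + (norm (grad (f k) x - G x))\<^sup>2))"
            by (rule ennreal_leI)
          also have "\<dots> = ennreal \<Lambda> * ennreal ((f k x - u x)\<^sup>2 + (norm (grad (f k) x - G x))\<^sup>2)" by (rule ennreal_mult) (use bound(2) in auto)
          finally show ?thesis using True by simp
        qed simp
      qed
      also have "\<dots> = ennreal \<Lambda> * E k"
        unfolding E_def nn_integral_on[OF \<Omega>m] by (rule nn_integral_cmult) measurable
      finally show ?thesis .
    qed
    then show "\<forall>\<^sub>F k in sequentially. (\<integral>\<^sup>+x\<in>?U. ennreal (normA_sq A x (grad (f k) x - G x)) \<partial>lebesgue) \<le> ennreal \<Lambda> * E k" by simp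
  qed simp
  have eq: "(\<integral>\<^sup>+x\<in>?U. ennreal (normA_sq A x (G x)) \<partial>lebesgue)
      = (\<integral>\<^sup>+x\<in>?U. ennreal (normA_sq A x (Du x)) \<partial>lebesgue)"
    by (rule nn_integral_cong_AE, rule eventually_mono[OF weak_gradient_unique[OF \<Omega> G Du]])
      (auto simp: indicator_def)
  have "weighted_ineq ?U A R u G"
    by (rule limit_ineq[OF U A R restr[OF fm(1)] restr[OF um(1)] restr[OF fm(2)] restr[OF um(2)] slim glim ineq[OF f(1)]])
  then show ?thesis unfolding weighted_ineq_def eq .
qed

section \<open>The equation satisfied by the weight\<close>

lemma C1c_add:
  assumes f: "f \<in> C1c U" and g: "g \<in> C1c U"
  shows "(\<lambda>x. f x + g x) \<in> C1c U"
proof -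
  obtain C D where C: "compact C" "C \<subseteq> U" "\<And>x. x \<notin> C \<Longrightarrow> f x = 0"
    and D: "compact D" "D \<subseteq> U" "\<And>x. x \<notin> D \<Longrightarrow> g x = 0"
    using C1cD(4)[OF f] C1cD(4)[OF g] by (auto simp: compact_support_in_def)
  have gr: "grad (\<lambda>x. f x + g x) x = grad f x + grad g x" for x
    by (rule grad_add) (rule C1cD(1)[OF f] C1cD(1)[OF g])+
  have "grad (\<lambda>x. f x + g x) = (\<lambda>x. grad f x + grad g x)" using gr by auto
  then have "C1_on UNIV (\<lambda>x. f x + g x)"
    unfolding C1_on_def using C1cD(1,2)[OF f] C1cD(1,2)[OF g]
    by (auto intro: differentiable_add continuous_on_add)
  moreover have "compact_support_in U (\<lambda>x. f x + g x)"
    unfolding compact_support_in_def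
    by (rule exI[of _ "C \<union> D"]) (use C D in \<open>auto intro: compact_Un\<close>)
  ultimately show ?thesis by (simp add: C1c_def)
qed

lemma C1c_zero: "(\<lambda>x. 0) \<in> C1c U"
proof -
  have "grad (\<lambda>x :: real ^ 'n. 0 :: real) = (\<lambda>x. 0)" by auto
  then show ?thesis by (auto simp: C1c_def C1_on_def compact_support_in_def intro: exI[of _ "{}"])
qed

lemma C1c_sum:
  assumes "finite I" "\<And>i. i \<in> I \<Longrightarrow> f i \<in> C1c U"
  shows "(\<lambda>x. \<Sum>i\<in>I. f i x) \<in> C1c U"
  using assms by (induction I rule: finite_induct) (auto intro: C1c_zero C1c_add)

lemma C1_on_add:
  assumes "C1_on U f" "C1_on U g"
  shows "C1_on U (\<lambda>x. f x + g x)"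
proof -
  have "continuous_on U (\<lambda>x. grad f x + grad g x)"
    using assms by (intro continuous_intros) (auto simp: C1_on_def)
  moreover have "grad (\<lambda>x. f x + g x) x = grad f x + grad g x" if "x \<in> U" for x
    by (rule grad_add) (use assms that in \<open>auto simp: C1_on_def\<close>)
  ultimately have "continuous_on U (grad (\<lambda>x. f x + g x))" by (simp cong: continuous_on_cong)
  then show ?thesis using assms by (auto simp: C1_on_def intro: differentiable_add)
qed

lemma C1_on_zero: "C1_on U (\<lambda>x. 0)"
proof -
  have "grad (\<lambda>x :: real ^ 'n. 0 :: real) = (\<lambda>x. 0)" by auto
  then show ?thesis by (auto simp: C1_on_def)
qed

lemma C1_on_sum:
  assumes "finite I" "\<And>i. i \<in> I \<Longrightarrow> C1_on U (f i)"
  shows "C1_on U (\<lambda>x. \<Sum>i\<in>I. f i x)"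
  using assms by (induction I rule: finite_induct) (auto intro: C1_on_zero C1_on_add)

lemma Cc_smooth_grad_C1c:
  assumes "\<phi> \<in> Cc_smooth U"
  shows "(\<lambda>x. grad \<phi> x $ i) \<in> C1c U"
proof -
  obtain C where C: "compact C" "C \<subseteq> U" "\<forall>x. x \<notin> C \<longrightarrow> grad \<phi> x = 0"
    by (rule compact_support_CcE[OF assms]) blast
  have "smooth_on UNIV (\<lambda>x. grad \<phi> x $ i)"
    using assms by (auto simp: Cc_smooth_def intro: smooth_on_grad)
  then have "C1_on UNIV (\<lambda>x. grad \<phi> x $ i)" by (rule smooth_on_imp_C1_on)
  moreover have "compact_support_in U (\<lambda>x. grad \<phi> x $ i)"
    unfolding compact_support_in_def using C by (intro exI[of _ C]) simp
  ultimately show ?thesis by (simp add: C1c_def)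
qed

text \<open>A compact set off the support is covered by finitely many open null sets.\<close>

lemma integral_off_measure_support:
  fixes \<mu> :: "(real ^ 'n) measure"
  assumes sets: "sets \<mu> = sets (restrict_space borel \<Omega>)" and \<Omega>: "open \<Omega>"
    and \<phi>: "\<phi> \<in> Cc_smooth (\<Omega> - measure_support \<mu>)"
  shows "(LINT x|\<mu>. \<phi> x) = 0"
proof -
  have sp: "space \<mu> = \<Omega>" using sets_eq_imp_space_eq[OF sets] by (simp add: space_restrict_space)
  obtain C where C: "compact C" "C \<subseteq> \<Omega> - measure_support \<mu>" "\<forall>x. x \<notin> C \<longrightarrow> \<phi> x = 0"
    by (rule compact_support_CcE[OF \<phi>]) blast
  have "\<forall>x\<in>C. \<exists>V. open V \<and> x \<in> V \<and> emeasure \<mu> (V \<inter> \<Omega>) = 0"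
  proof
    fix x assume "x \<in> C"
    then have "x \<in> \<Omega>" "x \<notin> measure_support \<mu>" using C(2) by auto
    then show "\<exists>V. open V \<and> x \<in> V \<and> emeasure \<mu> (V \<inter> \<Omega>) = 0"
      unfolding measure_support_def sp by (auto simp: not_gr_zero)
  qed
  from bchoice[OF this] obtain V where V: "\<And>x. x \<in> C \<Longrightarrow> open (V x) \<and> x \<in> V x \<and> emeasure \<mu> (V x \<inter> \<Omega>) = 0" by blast
  have op: "open (V x)" if "x \<in> C" for x using V[OF that] by simp
  have cov: "C \<subseteq> (\<Union>x\<in>C. V x)" using V by blast
  obtain D where D: "D \<subseteq> C" "finite D" "C \<subseteq> (\<Union>x\<in>D. V x)"
    by (rule compactE_image[OF C(1) op cov])
  have "V x \<inter> \<Omega> \<in> null_sets \<mu>" if "x \<in> D" for x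
  proof (rule null_setsI)
    have xC: "x \<in> C" using that D(1) by blast
    show "emeasure \<mu> (V x \<inter> \<Omega>) = 0" using V[OF xC] by simp
    show "V x \<inter> \<Omega> \<in> sets \<mu>"
      unfolding sets sets_restrict_space Int_commute[of "V x"] by (rule imageI) (simp add: op[OF xC])
  qed
  then have N: "(\<Union>x\<in>D. V x \<inter> \<Omega>) \<in> null_sets \<mu>"
    using D(2) by (intro null_sets_UN') (auto simp: countable_finite)
  have "AE x in \<mu>. \<phi> x = 0"
  proof (rule AE_I'[OF N])
    show "{x \<in> space \<mu>. \<phi> x \<noteq> 0} \<subseteq> (\<Union>x\<in>D. V x \<inter> \<Omega>)" using C(3) D(3) sp by blast
  qed
  then show ?thesis by (rule integral_eq_zero_AE)
qed

text \<open>If \<open>e\<close> is smooth on \<open>U\<close> and solves \<open>div (A \<nabla> e) = 0\<close> in the sense of distributions, the equation holds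
almost everywhere on \<open>U\<close> by the fundamental lemma, and may be tested against functions that
are only continuously differentiable.\<close>

lemma weight_equation:
  fixes \<Omega> U :: "(real ^ 'n) set" and A :: "real ^ 'n \<Rightarrow> real ^ 'n ^ 'n"
  assumes \<Omega>: "open \<Omega>" and U: "open U" "U \<subseteq> \<Omega>"
    and A: "\<And>i j. C1_on U (\<lambda>x. A x $ i $ j)" and sym: "\<And>x. x \<in> U \<Longrightarrow> transpose (A x) = A x"
    and e: "smooth_on U e"
    and eq: "\<And>\<phi>. \<phi> \<in> Cc_smooth U \<Longrightarrow> (LINT x:\<Omega>|lebesgue. e x * L_op A \<phi> x) = 0"
    and w: "w \<in> C1c U"
  shows "(LINT x:U|lebesgue. (A x *v grad e x) \<bullet> grad w x) = 0"
proof -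
  have e1: "C1_on U e" by (rule smooth_on_imp_C1_on[OF e])
  define H where "H i x = (A x *v grad e x) $ i" for i x
  have H: "C1_on U (H i)" for i
  proof -
    have "C1_on U (\<lambda>x. \<Sum>j\<in>UNIV. A x $ i $ j * grad e x $ j)"
      by (intro C1_on_sum C1_on_mult A smooth_on_imp_C1_on[OF smooth_on_grad[OF e]] finite)
    then show ?thesis by (simp add: H_def[abs_def] matrix_vector_mult_def)
  qed
  \<comment> \<open>the divergence of \<open>A \<nabla> e\<close>\<close>
  define D where "D x = (\<Sum>i\<in>UNIV. grad (H i) x $ i)" for x
  have Dc: "continuous_on U D"
    unfolding D_def using H by (intro continuous_intros) (auto simp: C1_on_def)
  have int: "set_integrable lebesgue U (\<lambda>x. h x * grad \<psi> x $ i)" "set_integrable lebesgue U (\<lambda>x. grad h x $ i * \<psi> x)"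
    if \<psi>: "\<psi> \<in> C1c U" and h: "C1_on U h" for \<psi> h i
  proof -
    obtain C where C: "compact C" "C \<subseteq> U" "\<And>x. x \<notin> C \<Longrightarrow> \<psi> x = 0"
      using C1cD(4)[OF \<psi>] by (auto simp: compact_support_in_def)
    have off: "grad \<psi> x $ i = 0" if "x \<notin> C" for x
      using grad_eq_0_outside(1)[OF compact_imp_closed[OF C(1)] C(3) that] by simp
    have ch: "locally_integrable U h" "locally_integrable U (\<lambda>x. grad h x $ i)"
      using C1_on_continuous[OF h] h
      by (auto intro!: locally_integrable_continuous continuous_intros simp: C1_on_def)
    have c\<psi>: "continuous_on U \<psi>" "continuous_on U (\<lambda>x. grad \<psi> x $ i)"
      using continuous_on_subset[OF C1cD(3)[OF \<psi>] subset_UNIV] continuous_on_subset[OF C1cD(2)[OF \<psi>] subset_UNIV]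
      by (auto intro: continuous_intros)
    show "set_integrable lebesgue U (\<lambda>x. h x * grad \<psi> x $ i)"
      using integrable_locally_integrable_mult(2)[OF ch(1) c\<psi>(2) C(1,2) off] by (simp add: mult.commute)
    show "set_integrable lebesgue U (\<lambda>x. grad h x $ i * \<psi> x)"
      using integrable_locally_integrable_mult(2)[OF ch(2) c\<psi>(1) C] by (simp add: mult.commute)
  qed
  have Hgrad: "(LINT x:U|lebesgue. (A x *v grad e x) \<bullet> grad \<psi> x) = - (LINT x:U|lebesgue. D x * \<psi> x)" if \<psi>: "\<psi> \<in> C1c U" for \<psi>
  proof -
    have "(LINT x:U|lebesgue. (A x *v grad e x) \<bullet> grad \<psi> x) = (LINT x:U|lebesgue. (\<Sum>i\<in>UNIV. H i x * grad \<psi> x $ i))"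
      by (simp add: inner_vec_def H_def)
    also have "\<dots> = (\<Sum>i\<in>UNIV. (LINT x:U|lebesgue. H i x * grad \<psi> x $ i))"
      unfolding set_lebesgue_integral_def scaleR_sum_right
      by (rule Bochner_Integration.integral_sum) (use int(1)[OF \<psi> H] in \<open>simp add: set_integrable_def\<close>)
    also have "\<dots> = (\<Sum>i\<in>UNIV. - (LINT x:U|lebesgue. grad (H i) x $ i * \<psi> x))"
      by (rule sum.cong[OF refl]) (rule integral_by_parts_C1c[OF U(1) \<psi> H])
    also have "\<dots> = - (\<Sum>i\<in>UNIV. (LINT x:U|lebesgue. grad (H i) x $ i * \<psi> x))" by (rule sum_negf)
    also have "(\<Sum>i\<in>UNIV. (LINT x:U|lebesgue. grad (H i) x $ i * \<psi> x)) = (LINT x:U|lebesgue. (\<Sum>i\<in>UNIV. grad (H i) x $ i * \<psi> x))"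
      unfolding set_lebesgue_integral_def scaleR_sum_right
      by (rule Bochner_Integration.integral_sum[symmetric]) (use int(2)[OF \<psi> H] in \<open>simp add: set_integrable_def\<close>)
    finally show ?thesis by (simp add: D_def sum_distrib_right)
  qed
  have test: "(LINT x:U|lebesgue. (A x *v grad e x) \<bullet> grad \<phi> x) = 0" if \<phi>: "\<phi> \<in> Cc_smooth U" for \<phi>
  proof -
    obtain C where C: "compact C" "C \<subseteq> U" "\<forall>x. x \<notin> C \<longrightarrow> grad \<phi> x = 0"
      by (rule compact_support_CcE[OF \<phi>]) blast
    define F where "F i x = (\<Sum>j\<in>UNIV. grad \<phi> x $ j * A x $ i $ j)" for i x
    have Feq: "(A x *v grad \<phi> x) $ i = F i x" for i x
      by (simp add: F_def matrix_vector_mult_def mult.commute)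
    have F: "F i \<in> C1c U" for i
      unfolding F_def[abs_def] by (intro C1c_sum C1c_mult(1)[OF U(1) Cc_smooth_grad_C1c[OF \<phi>] A] finite)
    have L: "L_op A \<phi> x = - (\<Sum>i\<in>UNIV. grad (F i) x $ i)" for x
      unfolding L_op_def Feq by (simp add: grad_def)
    have Foff: "grad (F i) x = 0" if "x \<notin> C" for i x
      by (rule grad_eq_0_outside(1)[OF compact_imp_closed[OF C(1)] _ that]) (use C(3) in \<open>simp add: F_def\<close>)
    have vanish: "e x * L_op A \<phi> x = 0" if "x \<notin> U" for x
    proof -
      have "x \<notin> C" using that C(2) by blast
      then show ?thesis by (simp add: L Foff)
    qed
    have vanish': "e x * L_op A \<phi> x = 0" if "x \<notin> \<Omega>" for x
      using vanish[of x] that U(2) by blast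
    have "0 = (LINT x:U|lebesgue. e x * L_op A \<phi> x)"
      using eq[OF \<phi>] set_lebesgue_integral_eq_of_vanishing[of \<Omega> "\<lambda>x. e x * L_op A \<phi> x", OF vanish']
        set_lebesgue_integral_eq_of_vanishing[of U "\<lambda>x. e x * L_op A \<phi> x", OF vanish] by simp
    also have "\<dots> = (LINT x:U|lebesgue. - (\<Sum>i\<in>UNIV. e x * grad (F i) x $ i))"
      by (simp add: L sum_distrib_left)
    also have "\<dots> = - (LINT x:U|lebesgue. (\<Sum>i\<in>UNIV. e x * grad (F i) x $ i))"
      by (simp add: set_lebesgue_integral_def)
    also have "(LINT x:U|lebesgue. (\<Sum>i\<in>UNIV. e x * grad (F i) x $ i)) = (\<Sum>i\<in>UNIV. (LINT x:U|lebesgue. e x * grad (F i) x $ i))"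
      unfolding set_lebesgue_integral_def scaleR_sum_right
      by (rule Bochner_Integration.integral_sum) (use int(1)[OF F e1] in \<open>simp add: set_integrable_def\<close>)
    also have "\<dots> = (\<Sum>i\<in>UNIV. - (LINT x:U|lebesgue. grad e x $ i * F i x))"
      by (rule sum.cong[OF refl]) (rule integral_by_parts_C1c[OF U(1) F e1])
    also have "\<dots> = - (\<Sum>i\<in>UNIV. (LINT x:U|lebesgue. grad e x $ i * F i x))" by (rule sum_negf)
    also have "(\<Sum>i\<in>UNIV. (LINT x:U|lebesgue. grad e x $ i * F i x)) = (LINT x:U|lebesgue. (\<Sum>i\<in>UNIV. grad e x $ i * F i x))"
      unfolding set_lebesgue_integral_def scaleR_sum_right
      by (rule Bochner_Integration.integral_sum[symmetric]) (use int(2)[OF F e1] in \<open>simp add: set_integrable_def\<close>)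
    also have "\<dots> = (LINT x:U|lebesgue. (A x *v grad e x) \<bullet> grad \<phi> x)"
    proof (rule set_lebesgue_integral_cong)
      show "U \<in> sets lebesgue" using U(1) by auto
      show "\<forall>x. x \<in> U \<longrightarrow> (\<Sum>i\<in>UNIV. grad e x $ i * F i x) = (A x *v grad e x) \<bullet> grad \<phi> x"
      proof (intro allI impI)
        fix x assume x: "x \<in> U"
        have "(\<Sum>i\<in>UNIV. grad e x $ i * F i x) = grad e x \<bullet> (A x *v grad \<phi> x)"
          by (simp add: inner_vec_def Feq)
        also have "\<dots> = (transpose (A x) *v grad e x) \<bullet> grad \<phi> x"
          by (simp add: dot_lmul_matrix)
        finally show "(\<Sum>i\<in>UNIV. grad e x $ i * F i x) = (A x *v grad e x) \<bullet> grad \<phi> x"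
          using sym[OF x] by simp
      qed
    qed
    finally show ?thesis by simp
  qed
  have "AE x in lebesgue. x \<in> U \<longrightarrow> D x = 0"
  proof (rule fundamental_lemma[OF U(1) locally_integrable_continuous[OF Dc]])
    fix \<phi> assume \<phi>: "\<phi> \<in> Cc_smooth U"
    then have "\<phi> \<in> C1c U" using Cc_smooth_subset_C1c by blast
    then show "(LINT x:U|lebesgue. D x * \<phi> x) = 0" using Hgrad test[OF \<phi>] by simp
  qed
  then have "(LINT x:U|lebesgue. D x * w x) = 0"
    unfolding set_lebesgue_integral_def
    by (intro integral_eq_zero_AE) (auto elim!: eventually_mono simp: indicator_def)
  then show ?thesis using Hgrad[OF w] by simp
qed

section \<open>The ground state substitution\<close>

text \<open>The energy density of \<open>u = e\<^sup>b v\<close> in terms of \<open>v\<close>, with \<open>\<zeta> = \<nabla> e\<close> and \<open>\<xi> = \<nabla> v\<close>. The condition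
\<open>2 t + 2 b = 1\<close> is the choice for which the mixed term is \<open>b (A \<nabla> e) \<bullet> \<nabla> (v\<^sup>2)\<close>, without any
power of \<open>e\<close>.\<close>

lemma ground_state_pointwise:
  assumes e: "e > 0" and "2 * t + 2 * b = 1" and sym: "transpose (A x) = A x"
  shows "e powr (2 * t) * normA_sq A x (v *\<^sub>R (b * e powr (b - 1)) *\<^sub>R \<zeta> + e powr b *\<^sub>R \<xi>)
    = e * normA_sq A x \<xi> + b\<^sup>2 * (normA_sq A x \<zeta> * v\<^sup>2 / e) + b * ((A x *v \<zeta>) \<bullet> (v *\<^sub>R \<xi> + v *\<^sub>R \<xi>))"
proof -
  have s: "(A x *v \<xi>) \<bullet> \<zeta> = (A x *v \<zeta>) \<bullet> \<xi>"
    by (metis dot_lmul_matrix inner_commute sym transpose_matrix_vector)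
  define p where "p = v * (b * e powr (b - 1))"
  define q where "q = e powr b"
  have "normA_sq A x (p *\<^sub>R \<zeta> + q *\<^sub>R \<xi>)
    = p\<^sup>2 * normA_sq A x \<zeta> + 2 * (p * q) * ((A x *v \<zeta>) \<bullet> \<xi>) + q\<^sup>2 * normA_sq A x \<xi>"
    unfolding normA_sq_add normA_sq_scaleR by (simp add: matrix_vector_mult_scaleR s)
  moreover have "e powr (2 * t) * q\<^sup>2 = e"
    using e assms(2) by (simp add: q_def power2_eq_square powr_add[symmetric] algebra_simps)
  moreover have "e powr (2 * t) * (p * q) = v * b"
  proof -
    have "e powr (2 * t) * (p * q) = v * b * (e powr (2 * t) * (e powr (b - 1) * e powr b))"
      by (simp add: p_def q_def)
    also have "e powr (2 * t) * (e powr (b - 1) * e powr b) = e powr (2 * t + ((b - 1) + b))"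
      by (simp only: powr_add[symmetric])
    also have "2 * t + ((b - 1) + b) = 0" using assms(2) by simp
    finally show ?thesis using e by simp
  qed
  moreover have "e powr (2 * t) * p\<^sup>2 = v\<^sup>2 * b\<^sup>2 / e"
  proof -
    have "e powr (2 * t) * p\<^sup>2 = v\<^sup>2 * b\<^sup>2 * (e powr (2 * t) * (e powr (b - 1) * e powr (b - 1)))"
      by (simp add: p_def power2_eq_square)
    also have "e powr (2 * t) * (e powr (b - 1) * e powr (b - 1)) = e powr (2 * t + ((b - 1) + (b - 1)))"
      by (simp only: powr_add[symmetric])
    also have "2 * t + ((b - 1) + (b - 1)) = - 1" using assms(2) by simp
    finally show ?thesis using e by (simp add: powr_minus divide_inverse)
  qed
  ultimately have "e powr (2 * t) * normA_sq A x (p *\<^sub>R \<zeta> + q *\<^sub>R \<xi>)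
    = v\<^sup>2 * b\<^sup>2 / e * normA_sq A x \<zeta> + 2 * (v * b) * ((A x *v \<zeta>) \<bullet> \<xi>) + e * normA_sq A x \<xi>"
    by (simp add: distrib_left mult.assoc[symmetric] mult.commute[of _ 2])
  moreover have "v\<^sup>2 * b\<^sup>2 / e * y + 2 * (v * b) * s + e * r = e * r + b\<^sup>2 * (y * v\<^sup>2 / e) + b * (2 * v * s)" for y r s
    by (simp add: mult_ac add_ac)
  ultimately have X: "e powr (2 * t) * normA_sq A x (p *\<^sub>R \<zeta> + q *\<^sub>R \<xi>)
    = e * normA_sq A x \<xi> + b\<^sup>2 * (normA_sq A x \<zeta> * v\<^sup>2 / e) + b * (2 * v * ((A x *v \<zeta>) \<bullet> \<xi>))"
    by (simp only:)
  have i: "(A x *v \<zeta>) \<bullet> (v *\<^sub>R \<xi> + v *\<^sub>R \<xi>) = 2 * v * ((A x *v \<zeta>) \<bullet> \<xi>)"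
    by (simp only: inner_add_right inner_scaleR_right)
  show ?thesis unfolding i using X unfolding p_def q_def by (simp only: scaleR_scaleR)
qed

text \<open>The mixed term integrates to zero by the equation for the weight, and the term with
\<open>b\<^sup>2\<close> appears on both sides: the inequality at exponent \<open>t\<close> for \<open>e\<^sup>b v\<close> is the inequality at exponent
\<open>1/2\<close> for \<open>v\<close>.\<close>

lemma ground_state_equiv:
  fixes U :: "(real ^ 'n) set" and A :: "real ^ 'n \<Rightarrow> real ^ 'n ^ 'n"
  assumes U: "open U" and e: "C1_on U e" "\<And>x. x \<in> U \<Longrightarrow> e x > 0"
    and A: "continuous_on U A" "\<And>x. x \<in> U \<Longrightarrow> transpose (A x) = A x" "\<And>x \<xi>. x \<in> U \<Longrightarrow> 0 \<le> normA_sq A x \<xi>"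
    and V: "continuous_on U V" "\<And>x. x \<in> U \<Longrightarrow> 0 \<le> V x"
    and weq: "\<And>w. w \<in> C1c U \<Longrightarrow> (LINT x:U|lebesgue. (A x *v grad e x) \<bullet> grad w x) = 0"
    and v: "v \<in> C1c U" and tb: "2 * t + 2 * b = 1"
  shows "(\<integral>\<^sup>+x\<in>U. ennreal ((b\<^sup>2 * (normA_sq A x (grad e x) * e x powr (2 * t - 2)) + V x * e x powr (2 * t))
        * (v x * e x powr b)\<^sup>2) \<partial>lebesgue)
      \<le> (\<integral>\<^sup>+x\<in>U. ennreal (e x powr (2 * t) * normA_sq A x (grad (\<lambda>x. v x * e x powr b) x)) \<partial>lebesgue)
    \<longleftrightarrow> (\<integral>\<^sup>+x\<in>U. ennreal (V x * e x * (v x)\<^sup>2) \<partial>lebesgue) \<le> (\<integral>\<^sup>+x\<in>U. ennreal (e x * normA_sq A x (grad v x)) \<partial>lebesgue)"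
proof -
  let ?M = "lebesgue_on U"
  have Um: "U \<in> sets lebesgue" using U by auto
  obtain C where C: "compact C" "C \<subseteq> U" "\<And>x. x \<notin> C \<Longrightarrow> v x = 0"
    using C1cD(4)[OF v] by (auto simp: compact_support_in_def)
  have off: "grad v x = 0" if "x \<notin> C" for x
    by (rule grad_eq_0_outside(1)[OF compact_imp_closed[OF C(1)] C(3) that])
  have ec: "continuous_on U e" by (rule C1_on_continuous[OF e(1)])
  have gec: "continuous_on U (grad e)" using e(1) by (simp add: C1_on_def)
  have vc: "continuous_on U v" "continuous_on U (grad v)"
    using continuous_on_subset[OF C1cD(3)[OF v] subset_UNIV] continuous_on_subset[OF C1cD(2)[OF v] subset_UNIV] .
  have enz: "\<forall>x\<in>U. e x \<noteq> 0" using e(2) by force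
  define a where "a x = e x * normA_sq A x (grad v x)" for x
  define c where "c x = b\<^sup>2 * (normA_sq A x (grad e x) * (v x)\<^sup>2 / e x)" for x
  define p where "p x = V x * e x * (v x)\<^sup>2" for x
  define w where "w x = v x * v x" for x
  define z where "z x = (A x *v grad e x) \<bullet> grad w x" for x
  have w: "w \<in> C1c U" unfolding w_def
    by (rule C1c_mult(1)[OF U v]) (use v in \<open>auto simp: C1c_def intro: C1_on_subset\<close>)
  have gw: "grad w x = v x *\<^sub>R grad v x + v x *\<^sub>R grad v x" for x
    unfolding w_def by (rule grad_mult) (rule C1cD(1)[OF v])+
  have Avec: "continuous_on U (\<lambda>x. A x *v grad e x)"
  proof -
    have "continuous_on U (\<lambda>x. \<chi> i. \<Sum>j\<in>UNIV. A x $ i $ j * grad e x $ j)"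
      using A(1) gec by (intro continuous_on_vec_lambda continuous_intros)
    then show ?thesis by (simp add: matrix_vector_mult_def)
  qed
  have int: "integrable ?M h" if "continuous_on U h" "\<And>x. x \<notin> C \<Longrightarrow> h x = 0" for h :: "real ^ 'n \<Rightarrow> real"
  proof (rule integrable_lebesgue_on_of_lborel[OF Um])
    show "integrable lborel h" by (rule integrable_continuous_compact_support[OF that(1) C(1,2) that(2)])
    show "h x = 0" if "x \<notin> U" for x using that C(2) \<open>\<And>x. x \<notin> C \<Longrightarrow> h x = 0\<close> by blast
  qed
  have ia: "integrable ?M a"
    by (rule int) (auto simp: a_def[abs_def] off intro!: continuous_intros ec continuous_on_normA_sq A(1) vc)
  have ic: "integrable ?M c"
    by (rule int) (use enz in \<open>auto simp: c_def[abs_def] C(3) intro!: continuous_intros ec continuous_on_normA_sq A(1) vc gec\<close>)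
  have ip: "integrable ?M p"
    by (rule int) (auto simp: p_def[abs_def] C(3) intro!: continuous_intros ec V(1) vc)
  have iz: "integrable ?M z"
  proof (rule int)
    show "continuous_on U z"
      unfolding z_def[abs_def] by (intro continuous_on_inner Avec continuous_on_subset[OF C1cD(2)[OF w] subset_UNIV])
    show "z x = 0" if "x \<notin> C" for x using C(3)[OF that] by (simp add: z_def gw)
  qed
  have pos: "0 \<le> a x" "0 \<le> c x" "0 \<le> p x" if "x \<in> U" for x
    using that A(3) V(2) e(2)[OF that] by (simp_all add: a_def c_def p_def)
  have z0: "(LINT x|?M. z x) = 0"
    unfolding integral_lebesgue_on_eq_set_integral[OF Um] z_def by (rule weq[OF w])
  have pw1: "(b\<^sup>2 * (normA_sq A x (grad e x) * e x powr (2 * t - 2)) + V x * e x powr (2 * t)) * (v x * e x powr b)\<^sup>2 = c x + p x"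
    if x: "x \<in> U" for x
  proof -
    have ex: "e x > 0" by (rule e(2)[OF x])
    have 1: "e x powr (2 * t) * (e x powr b)\<^sup>2 = e x"
      using ex tb by (simp add: power2_eq_square powr_add[symmetric] add.assoc)
    have "e x powr (2 * t - 2) * (e x powr b)\<^sup>2 = e x powr (2 * t - 2 + (b + b))"
      by (simp only: power2_eq_square powr_add mult.assoc)
    also have "2 * t - 2 + (b + b) = - 1" using tb by simp
    finally have 2: "e x powr (2 * t - 2) * (e x powr b)\<^sup>2 = 1 / e x"
      using ex by (simp add: powr_minus divide_inverse)
    have "(b\<^sup>2 * (normA_sq A x (grad e x) * e x powr (2 * t - 2)) + V x * e x powr (2 * t)) * (v x * e x powr b)\<^sup>2
      = b\<^sup>2 * normA_sq A x (grad e x) * (v x)\<^sup>2 * (e x powr (2 * t - 2) * (e x powr b)\<^sup>2)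
        + V x * (v x)\<^sup>2 * (e x powr (2 * t) * (e x powr b)\<^sup>2)"
      by (simp add: power_mult_distrib algebra_simps)
    then show ?thesis unfolding 1 2 by (simp add: c_def p_def mult_ac)
  qed
  have pw2: "e x powr (2 * t) * normA_sq A x (grad (\<lambda>x. v x * e x powr b) x) = a x + c x + b * z x" if x: "x \<in> U" for x
  proof -
    have ex: "e x > 0" by (rule e(2)[OF x])
    have g: "grad (\<lambda>x. v x * e x powr b) x = v x *\<^sub>R (b * e x powr (b - 1)) *\<^sub>R grad e x + e x powr b *\<^sub>R grad v x"
    proof -
      have d: "e differentiable (at x)" using e(1) x by (simp add: C1_on_def)
      show ?thesis
        using C1c_mult(2)[OF U v C1_on_powr[OF e], of x b] x grad_powr(2)[OF d ex, of b] by simp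
    qed
    show ?thesis
      unfolding g ground_state_pointwise[where A = A and x = x, OF ex tb A(2)[OF x]] by (simp add: a_def c_def z_def gw)
  qed
  have nn: "(\<integral>\<^sup>+x. ennreal (h x) \<partial>?M) = ennreal (LINT x|?M. h x)" if "integrable ?M h" "\<And>x. x \<in> U \<Longrightarrow> 0 \<le> h x" for h
    by (rule nn_integral_eq_integral[OF that(1)]) (use that(2) in \<open>auto intro!: AE_I2\<close>)
  have L: "(\<integral>\<^sup>+x\<in>U. ennreal ((b\<^sup>2 * (normA_sq A x (grad e x) * e x powr (2 * t - 2)) + V x * e x powr (2 * t))
        * (v x * e x powr b)\<^sup>2) \<partial>lebesgue) = ennreal ((LINT x|?M. c x) + (LINT x|?M. p x))"
  proof -
    have "(\<integral>\<^sup>+x\<in>U. ennreal ((b\<^sup>2 * (normA_sq A x (grad e x) * e x powr (2 * t - 2)) + V x * e x powr (2 * t))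
        * (v x * e x powr b)\<^sup>2) \<partial>lebesgue) = (\<integral>\<^sup>+x. ennreal (c x + p x) \<partial>?M)"
      unfolding nn_integral_on[OF Um] by (rule nn_integral_cong) (simp add: pw1)
    also have "\<dots> = ennreal (LINT x|?M. c x + p x)"
      by (rule nn) (use ic ip pos in auto)
    also have "(LINT x|?M. c x + p x) = (LINT x|?M. c x) + (LINT x|?M. p x)"
      by (rule Bochner_Integration.integral_add[OF ic ip])
    finally show ?thesis .
  qed
  have ibz: "integrable ?M (\<lambda>x. b * z x)" using iz by simp
  have iac: "integrable ?M (\<lambda>x. a x + c x)" by (rule Bochner_Integration.integrable_add[OF ia ic])
  have R: "(\<integral>\<^sup>+x\<in>U. ennreal (e x powr (2 * t) * normA_sq A x (grad (\<lambda>x. v x * e x powr b) x)) \<partial>lebesgue)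
      = ennreal ((LINT x|?M. a x) + (LINT x|?M. c x))"
  proof -
    have "(\<integral>\<^sup>+x\<in>U. ennreal (e x powr (2 * t) * normA_sq A x (grad (\<lambda>x. v x * e x powr b) x)) \<partial>lebesgue)
      = (\<integral>\<^sup>+x. ennreal (a x + c x + b * z x) \<partial>?M)"
      unfolding nn_integral_on[OF Um] by (rule nn_integral_cong) (simp add: pw2)
    also have "\<dots> = ennreal (LINT x|?M. a x + c x + b * z x)"
    proof (rule nn[OF Bochner_Integration.integrable_add[OF iac ibz]])
      show "0 \<le> a x + c x + b * z x" if "x \<in> U" for x
        unfolding pw2[OF that, symmetric] using A(3)[OF that] by simp
    qed
    also have "(LINT x|?M. a x + c x + b * z x) = (LINT x|?M. a x + c x) + (LINT x|?M. b * z x)"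
      by (rule Bochner_Integration.integral_add[OF iac ibz])
    also have "(LINT x|?M. a x + c x) = (LINT x|?M. a x) + (LINT x|?M. c x)"
      by (rule Bochner_Integration.integral_add[OF ia ic])
    also have "(LINT x|?M. b * z x) = 0" using z0 by simp
    finally show ?thesis by simp
  qed
  have P: "(\<integral>\<^sup>+x\<in>U. ennreal (V x * e x * (v x)\<^sup>2) \<partial>lebesgue) = ennreal (LINT x|?M. p x)"
    unfolding nn_integral_on[OF Um] p_def[symmetric] by (rule nn[OF ip pos(3)])
  have Q: "(\<integral>\<^sup>+x\<in>U. ennreal (e x * normA_sq A x (grad v x)) \<partial>lebesgue) = ennreal (LINT x|?M. a x)"
    unfolding nn_integral_on[OF Um] a_def[symmetric] by (rule nn[OF ia pos(1)])
  have nnI: "0 \<le> (LINT x|?M. a x)" "0 \<le> (LINT x|?M. c x)"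
    using pos by (auto intro!: integral_nonneg_AE AE_I2)
  show ?thesis unfolding L R P Q using nnI by (simp add: ennreal_le_iff add.commute del: ennreal_plus)
qed

text \<open>Multiplication by a power of the weight is a bijection of the compactly supported continuously
differentiable functions, so the inequalities for all exponents are equivalent on that class.\<close>

lemma weighted_ineq_iff:
  fixes U :: "(real ^ 'n) set" and A :: "real ^ 'n \<Rightarrow> real ^ 'n ^ 'n"
  assumes U: "open U" and e: "C1_on U e" "\<And>x. x \<in> U \<Longrightarrow> e x > 0"
    and A: "continuous_on U A" "\<And>x. x \<in> U \<Longrightarrow> transpose (A x) = A x" "\<And>x \<xi>. x \<in> U \<Longrightarrow> 0 \<le> normA_sq A x \<xi>"
    and V: "continuous_on U V" "\<And>x. x \<in> U \<Longrightarrow> 0 \<le> V x"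
    and weq: "\<And>w. w \<in> C1c U \<Longrightarrow> (LINT x:U|lebesgue. (A x *v grad e x) \<bullet> grad w x) = 0"
  shows "(\<forall>f\<in>C1c U. (\<integral>\<^sup>+x\<in>U. ennreal (((t - 1 / 2)\<^sup>2 * (normA_sq A x (grad e x) * e x powr (2 * t - 2)) + V x * e x powr (2 * t))
        * (f x)\<^sup>2) \<partial>lebesgue)
      \<le> (\<integral>\<^sup>+x\<in>U. ennreal (e x powr (2 * t) * normA_sq A x (grad f x)) \<partial>lebesgue))
    \<longleftrightarrow> (\<forall>v\<in>C1c U. (\<integral>\<^sup>+x\<in>U. ennreal (V x * e x * (v x)\<^sup>2) \<partial>lebesgue)
      \<le> (\<integral>\<^sup>+x\<in>U. ennreal (e x * normA_sq A x (grad v x)) \<partial>lebesgue))"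
    (is "(\<forall>f\<in>C1c U. ?P f) \<longleftrightarrow> (\<forall>v\<in>C1c U. ?Q v)")
proof -
  define b where "b = 1 / 2 - t"
  have tb: "2 * t + 2 * b = 1" by (simp add: b_def)
  have b2: "(t - 1 / 2)\<^sup>2 = b\<^sup>2" by (simp add: b_def power2_commute)
  have mem: "(\<lambda>x. v x * e x powr a) \<in> C1c U" if "v \<in> C1c U" for v a
    by (rule C1c_mult(1)[OF U that C1_on_powr[OF e]])
  have eq: "?P (\<lambda>x. v x * e x powr b) \<longleftrightarrow> ?Q v" if "v \<in> C1c U" for v
    unfolding b2 by (rule ground_state_equiv[OF U e A V weq that tb])
  show ?thesis
  proof (intro iffI ballI)
    fix v assume P: "\<forall>f\<in>C1c U. ?P f" and v: "v \<in> C1c U"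
    have "?P (\<lambda>x. v x * e x powr b)" using P mem[OF v, of b] by (rule bspec)
    then show "?Q v" unfolding eq[OF v] .
  next
    fix f assume Q: "\<forall>v\<in>C1c U. ?Q v" and f: "f \<in> C1c U"
    define v where "v x = f x * e x powr (- b)" for x
    have v: "v \<in> C1c U" unfolding v_def by (rule mem[OF f])
    have vf: "v x * e x powr b = f x" for x
    proof (cases "x \<in> U")
      case True
      then show ?thesis using e(2)[OF True] by (simp add: v_def powr_minus)
    next
      case False
      then have "f x = 0" using C1cD(4)[OF f] by (auto simp: compact_support_in_def)
      then show ?thesis by (simp add: v_def)
    qed
    have "?Q v" using Q v by (rule bspec)
    then have "?P (\<lambda>x. v x * e x powr b)" unfolding eq[OF v] .
    then show "?P f" unfolding vf .
  qed
qed

section \<open>The equivalence\<close>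

lemma continuous_on_matrix:
  fixes A :: "'a::topological_space \<Rightarrow> real ^ 'n ^ 'm"
  assumes "\<And>i j. continuous_on S (\<lambda>x. A x $ i $ j)"
  shows "continuous_on S A"
proof -
  have "continuous_on S (\<lambda>x. \<chi> i. \<chi> j. A x $ i $ j)"
    by (intro continuous_on_vec_lambda assms)
  then show ?thesis by simp
qed

lemma nn_integral_linear_combination:
  assumes m: "F \<in> borel_measurable M" "G \<in> borel_measurable M"
    and nn: "\<And>x. x \<in> space M \<Longrightarrow> 0 \<le> F x" "\<And>x. x \<in> space M \<Longrightarrow> 0 \<le> G x" and c: "0 \<le> c"
  shows "ennreal c * (\<integral>\<^sup>+x. ennreal (F x) \<partial>M) + (\<integral>\<^sup>+x. ennreal (G x) \<partial>M) = (\<integral>\<^sup>+x. ennreal (c * F x + G x) \<partial>M)"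
proof -
  note [measurable] = m
  have "(\<integral>\<^sup>+x. ennreal (c * F x + G x) \<partial>M) = (\<integral>\<^sup>+x. ennreal c * ennreal (F x) + ennreal (G x) \<partial>M)"
    by (rule nn_integral_cong) (use nn c in \<open>simp add: ennreal_plus ennreal_mult\<close>)
  also have "\<dots> = (\<integral>\<^sup>+x. ennreal c * ennreal (F x) \<partial>M) + (\<integral>\<^sup>+x. ennreal (G x) \<partial>M)"
    by (rule nn_integral_add) measurable
  also have "(\<integral>\<^sup>+x. ennreal c * ennreal (F x) \<partial>M) = ennreal c * (\<integral>\<^sup>+x. ennreal (F x) \<partial>M)"
    by (rule nn_integral_cmult) measurable
  finally show ?thesis by simp
qed

lemma Cc_smooth_in_H10:
  fixes \<phi> :: "real ^ 'n \<Rightarrow> real"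
  assumes \<Omega>: "open \<Omega>" and \<phi>: "\<phi> \<in> Cc_smooth \<Omega>"
  shows "\<phi> \<in> H10 \<Omega>" "weak_gradient \<Omega> \<phi> (grad \<phi>)"
proof -
  have \<phi>1: "C1_on \<Omega> \<phi>"
    using \<phi> Cc_smooth_subset_C1c by (auto simp: C1c_def intro: C1_on_subset)
  show w: "weak_gradient \<Omega> \<phi> (grad \<phi>)" by (rule weak_gradient_C1_on[OF \<Omega> \<phi>1])
  have \<Omega>m: "\<Omega> \<in> sets lebesgue" using \<Omega> by auto
  obtain C where C: "compact C" "C \<subseteq> \<Omega>" "\<forall>x. x \<notin> C \<longrightarrow> \<phi> x = 0 \<and> grad \<phi> x = 0"
    by (rule compact_support_CcE[OF \<phi>]) blast
  have L2: "L2 \<Omega> h" if h: "continuous_on UNIV h" "\<And>x. x \<notin> C \<Longrightarrow> h x = 0" for h :: "real ^ 'n \<Rightarrow> 'b::{banach, second_countable_topology}"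
    unfolding L2_def
  proof
    have "h \<in> borel_measurable (lebesgue_on \<Omega>)"
      using continuous_on_subset[OF h(1) subset_UNIV] \<Omega>m by (rule continuous_imp_measurable_on_sets_lebesgue)
    then show "set_borel_measurable lebesgue \<Omega> h"
      unfolding set_borel_measurable_def using \<Omega>m by (subst (asm) borel_measurable_restrict_space_iff) auto
    have "integrable lborel (\<lambda>x. (norm (h x))\<^sup>2)"
      by (rule integrable_continuous_compact_support[OF _ C(1) subset_UNIV]) (use h in \<open>auto intro!: continuous_intros\<close>)
    then have "(\<integral>\<^sup>+x. ennreal ((norm (h x))\<^sup>2) \<partial>lebesgue) < \<infinity>"
      unfolding nn_integral_completion integrable_iff_bounded by simp
    moreover have "(\<integral>\<^sup>+x\<in>\<Omega>. ennreal ((norm (h x))\<^sup>2) \<partial>lebesgue) \<le> (\<integral>\<^sup>+x. ennreal ((norm (h x))\<^sup>2) \<partial>lebesgue)"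
      by (rule nn_integral_mono) (simp add: indicator_def)
    ultimately show "(\<integral>\<^sup>+x\<in>\<Omega>. ennreal ((norm (h x))\<^sup>2) \<partial>lebesgue) < \<infinity>" by (rule order_le_less_trans[rotated])
  qed
  have "L2 \<Omega> \<phi>" "L2 \<Omega> (grad \<phi>)"
    by (rule L2; use C(3) Cc_smooth_continuous[OF \<phi>] in simp)+
  then show "\<phi> \<in> H10 \<Omega>"
    unfolding H10_def using w \<phi> by (intro CollectI conjI exI[of _ "grad \<phi>"] exI[of _ "\<lambda>_. \<phi>"]) auto
qed

lemma C1c_in_X_space:
  fixes f :: "real ^ 'n \<Rightarrow> real"
  assumes U: "open (\<Omega> - K)" and f: "f \<in> C1c (\<Omega> - K)"
  shows "f \<in> X_space \<Omega> A E K t" "weak_gradient (\<Omega> - K) f (grad f)"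
proof -
  have "C1_on (\<Omega> - K) f" using f by (auto simp: C1c_def intro: C1_on_subset)
  then show w: "weak_gradient (\<Omega> - K) f (grad f)" by (rule weak_gradient_C1_on[OF U])
  have Um: "\<Omega> - K \<in> sets lebesgue" using U by auto
  have "f \<in> borel_measurable (lebesgue_on (\<Omega> - K))"
    using continuous_on_subset[OF C1cD(3)[OF f] subset_UNIV] Um by (rule continuous_imp_measurable_on_sets_lebesgue)
  then have "set_borel_measurable lebesgue (\<Omega> - K) f"
    unfolding set_borel_measurable_def using Um by (subst (asm) borel_measurable_restrict_space_iff) auto
  then show "f \<in> X_space \<Omega> A E K t"
    unfolding X_space_def using w C1c_lipschitz[OF f]
    by (intro CollectI conjI exI[of _ "\<lambda>_. f"] exI[of _ "\<lambda>_. grad f"]) (auto simp: X_norm_sq_def)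
qed

theorem theorem2p12:
  fixes \<Omega> K :: "(real ^ 'n) set"
    and A :: "real ^ 'n \<Rightarrow> real ^ 'n ^ 'n"
    and E :: "real ^ 'n \<Rightarrow> ereal"
    and V :: "real ^ 'n \<Rightarrow> real"
  assumes domain: "smooth_bounded_domain \<Omega>"
    and matrix: "elliptic_matrix \<Omega> A"
    and weight: "interior_weight \<Omega> A E K"
    and V_smooth: "smooth_on (\<Omega> - K) V"
    and V_nonneg: "\<forall>x\<in>\<Omega> - K. 0 \<le> V x"
  defines "e \<equiv> (\<lambda>x. real_of_ereal (E x))"
  defines "i \<equiv>
      (\<forall>u\<in>H10 \<Omega>. \<forall>Du. weak_gradient \<Omega> u Du \<longrightarrow>
        (\<integral>\<^sup>+x\<in>\<Omega>. ennreal (normA_sq A x (Du x)) \<partial>lebesgue)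
        \<ge> ennreal (1 / 4) *
              (\<integral>\<^sup>+x\<in>\<Omega>. ennreal (normA_sq A x (grad e x) / (e x)\<^sup>2 * (u x)\<^sup>2) \<partial>lebesgue)
            + (\<integral>\<^sup>+x\<in>\<Omega>. ennreal (V x * (u x)\<^sup>2) \<partial>lebesgue))"
  defines "ii \<equiv>
      (\<forall>t. t \<noteq> 1 / 2 \<longrightarrow>
        (\<forall>u\<in>X_space \<Omega> A E K t. \<forall>Du. weak_gradient (\<Omega> - K) u Du \<longrightarrow>
          (\<integral>\<^sup>+x\<in>\<Omega>. ennreal (e x powr (2 * t) * normA_sq A x (Du x)) \<partial>lebesgue)
          \<ge> ennreal ((t - 1 / 2)\<^sup>2) *
                (\<integral>\<^sup>+x\<in>\<Omega>. ennreal (normA_sq A x (grad e x) * e x powr (2 * t - 2) * (u x)\<^sup>2) \<partial>lebesgue)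
              + (\<integral>\<^sup>+x\<in>\<Omega>. ennreal (V x * e x powr (2 * t) * (u x)\<^sup>2) \<partial>lebesgue)))"
  defines "iii \<equiv>
      (\<forall>u\<in>X_space \<Omega> A E K (1 / 2). \<forall>Du. weak_gradient (\<Omega> - K) u Du \<longrightarrow>
        (\<integral>\<^sup>+x\<in>\<Omega>. ennreal (e x * normA_sq A x (Du x)) \<partial>lebesgue)
        \<ge> (\<integral>\<^sup>+x\<in>\<Omega>. ennreal (V x * e x * (u x)\<^sup>2) \<partial>lebesgue))"
  shows "(i \<longleftrightarrow> ii) \<and> (ii \<longleftrightarrow> iii)"
proof -
  let ?U = "\<Omega> - K"
  have \<Omega>: "open \<Omega>" "\<Omega> \<noteq> {}" "bounded \<Omega>" using domain by (auto simp: smooth_bounded_domain_def)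
  have \<Omega>m: "\<Omega> \<in> sets lebesgue" using \<Omega> by auto
  have Epos: "\<forall>x\<in>\<Omega>. E x > 0" and K: "compact K"
    and Efin: "\<forall>x\<in>closure \<Omega> - K. \<bar>E x\<bar> \<noteq> \<infinity>"
    and e_smooth: "smooth_on ?U e"
    using weight by (auto simp: interior_weight_def smooth_upto_def e_def)
  obtain \<mu> where \<mu>: "sets \<mu> = sets (restrict_space borel \<Omega>)" "distributional_L \<Omega> A e \<mu>" "K = measure_support \<mu>"
    using weight unfolding interior_weight_def e_def by blast
  obtain d where d: "has_box_dim \<Omega> K d" "d < real CARD('n) - 2"
    using weight unfolding interior_weight_def by blast
  have K\<Omega>: "K \<subseteq> \<Omega>"
    unfolding \<mu>(3) measure_support_def using sets_eq_imp_space_eq[OF \<mu>(1)] by (auto simp: space_restrict_space)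
  have U: "open ?U" using \<Omega>(1) K by (simp add: compact_imp_closed open_Diff)
  have Um: "?U \<in> sets lebesgue" using U by auto
  obtain p r0 where p: "p > 2" "r0 > 0" and decay: "\<And>r. 0 < r \<Longrightarrow> r < r0 \<Longrightarrow>
      emeasure lebesgue {x \<in> \<Omega>. infdist x K < r} \<le> ennreal (2 ^ CARD('n) * r powr p)"
    using lebesgue_tube_decay[OF \<Omega>(1) d] by blast
  have K0: "K \<in> null_sets lebesgue"
    by (rule tube_null[OF p decay compact_sets_lebesgue[OF K] _ \<Omega>(1)]) (use K\<Omega> in auto)
  \<comment> \<open>the distance to the empty set is zero by convention, so for empty \<open>K\<close> the tube estimate would make \<open>\<Omega>\<close> a null set\<close>
  have Kne: "K \<noteq> {}"
  proof
    assume "K = {}"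
    then have "infdist x K = 0" for x by (simp add: infdist_def)
    then have "\<Omega> \<in> null_sets lebesgue"
      by (intro tube_null[OF p decay \<Omega>m _ \<Omega>(1)]) auto
    then show False using open_not_negligible[OF \<Omega>(1,2)] by (simp add: negligible_iff_null_sets)
  qed
  have onU: "(\<integral>\<^sup>+x\<in>\<Omega>. F x \<partial>lebesgue) = (\<integral>\<^sup>+x\<in>?U. F x \<partial>lebesgue)" for F
    by (rule nn_integral_cong_AE, rule eventually_mono[OF AE_not_in[OF K0]]) (auto simp: indicator_def)
  have epos: "e x > 0" if "x \<in> ?U" for x
  proof -
    have "x \<in> closure \<Omega> - K" using that closure_subset[of \<Omega>] by blast
    with Efin have "\<bar>E x\<bar> \<noteq> \<infinity>" by (rule bspec)
    moreover have "E x > 0" using that Epos by blast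
    ultimately have "\<bar>E x\<bar> \<noteq> \<infinity>" "E x > 0" by auto
    then show ?thesis by (cases "E x") (auto simp: e_def)
  qed
  have e1: "C1_on ?U e" by (rule smooth_on_imp_C1_on[OF e_smooth])
  have ec: "continuous_on ?U e" by (rule C1_on_continuous[OF e1])
  have gec: "continuous_on ?U (grad e)" using e1 by (simp add: C1_on_def)
  have Asm: "smooth_on \<Omega> (\<lambda>x. A x $ i $ j)" "continuous_on (closure \<Omega>) (\<lambda>x. A x $ i $ j)" for i j
    using matrix by (auto simp: elliptic_matrix_def smooth_upto_def)
  have AC1: "C1_on ?U (\<lambda>x. A x $ i $ j)" for i j
    by (rule C1_on_subset[OF smooth_on_imp_C1_on[OF Asm(1)]]) blast
  have Acl: "continuous_on (closure \<Omega>) A" by (rule continuous_on_matrix[OF Asm(2)])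
  have Ac: "continuous_on ?U A" by (rule continuous_on_subset[OF Acl]) (use closure_subset in blast)
  have sym: "transpose (A x) = A x" if "x \<in> ?U" for x using matrix that by (auto simp: elliptic_matrix_def)
  obtain c where c: "c > 0" "\<And>x \<xi>. x \<in> \<Omega> \<Longrightarrow> c * (norm \<xi>)\<^sup>2 \<le> normA_sq A x \<xi>"
    using matrix unfolding elliptic_matrix_def by blast
  have Apos: "0 \<le> normA_sq A x \<xi>" if "x \<in> ?U" for x \<xi>
  proof -
    have "0 \<le> c * (norm \<xi>)\<^sup>2" using c(1) by simp
    also have "\<dots> \<le> normA_sq A x \<xi>" by (rule c(2)) (use that in blast)
    finally show ?thesis .
  qed
  obtain \<Lambda> where \<Lambda>: "\<Lambda> \<ge> 0" "\<And>x \<xi>. x \<in> \<Omega> \<Longrightarrow> normA_sq A x \<xi> \<le> \<Lambda> * (norm \<xi>)\<^sup>2"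
  proof -
    have "compact (A ` closure \<Omega>)"
      by (rule compact_continuous_image[OF Acl]) (use \<Omega>(3) in \<open>simp add: compact_closure\<close>)
    then obtain B where B: "\<And>x. x \<in> closure \<Omega> \<Longrightarrow> norm (A x) \<le> B"
      by (metis bounded_iff compact_imp_bounded imageI)
    have "normA_sq A x \<xi> \<le> real CARD('n) * \<bar>B\<bar> * (norm \<xi>)\<^sup>2" if "x \<in> \<Omega>" for x \<xi>
    proof -
      have "norm (A x) \<le> \<bar>B\<bar>" using B[of x] that closure_subset[of \<Omega>] by force
      then have "real CARD('n) * norm (A x) * (norm \<xi>)\<^sup>2 \<le> real CARD('n) * \<bar>B\<bar> * (norm \<xi>)\<^sup>2"
        by (intro mult_right_mono mult_left_mono) auto
      then show ?thesis using abs_normA_sq_le[of A x \<xi>] by linarith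
    qed
    then show thesis by (intro that[of "real CARD('n) * \<bar>B\<bar>"]) auto
  qed
  have Vc: "continuous_on ?U V" by (rule smooth_on_imp_continuous_on[OF V_smooth])
  have Vnn: "0 \<le> V x" if "x \<in> ?U" for x using V_nonneg that by blast
  have weq: "(LINT x:?U|lebesgue. (A x *v grad e x) \<bullet> grad w x) = 0" if w: "w \<in> C1c ?U" for w
  proof (rule weight_equation[OF \<Omega>(1) U _ AC1 sym e_smooth _ w])
    fix \<phi> assume \<phi>: "\<phi> \<in> Cc_smooth ?U"
    then have "\<phi> \<in> Cc_smooth \<Omega>" by (auto simp: Cc_smooth_def compact_support_in_def)
    then have "(LINT x:\<Omega>|lebesgue. e x * L_op A \<phi> x) = (LINT x|\<mu>. \<phi> x)"
      using \<mu>(2) by (simp add: distributional_L_def)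
    also have "\<dots> = 0"
      by (rule integral_off_measure_support[OF \<mu>(1) \<Omega>(1)]) (use \<phi> \<mu>(3) in simp)
    finally show "(LINT x:\<Omega>|lebesgue. e x * L_op A \<phi> x) = 0" .
  qed auto
  define R where "R t x = (t - 1 / 2)\<^sup>2 * (normA_sq A x (grad e x) * e x powr (2 * t - 2)) + V x * e x powr (2 * t)" for t x
  define W where "W t x = e x powr (2 * t) *\<^sub>R A x" for t x
  have enz: "\<forall>x\<in>?U. e x \<noteq> 0" using epos by force
  have epc: "continuous_on ?U (\<lambda>x. e x powr a)" for a
    by (rule C1_on_continuous[OF C1_on_powr[OF e1 epos]])
  have qc: "continuous_on ?U (\<lambda>x. normA_sq A x (grad e x))" by (rule continuous_on_normA_sq[OF Ac gec])
  have Rc: "continuous_on ?U (R t)" for t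
    unfolding R_def[abs_def] by (intro continuous_intros qc epc Vc)
  have Wq: "normA_sq (W t) x \<xi> = e x powr (2 * t) * normA_sq A x \<xi>" for t x \<xi>
    unfolding W_def by (rule normA_sq_weight)
  have W: "elliptic_loc ?U (W t)" for t
    unfolding elliptic_loc_def
  proof (intro conjI allI impI)
    show "continuous_on ?U (W t)" unfolding W_def[abs_def] by (intro continuous_on_scaleR epc Ac)
    fix C assume C: "compact C \<and> C \<subseteq> ?U"
    show "\<exists>c>0. \<forall>x\<in>C. \<forall>\<xi>. c * (norm \<xi>)\<^sup>2 \<le> normA_sq (W t) x \<xi>"
    proof (cases "C = {}")
      case False
      obtain y where y: "y \<in> C" "\<And>x. x \<in> C \<Longrightarrow> e y powr (2 * t) \<le> e x powr (2 * t)"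
        using continuous_attains_inf[of C "\<lambda>x. e x powr (2 * t)"] C False continuous_on_subset[OF epc] by blast
      have "e y > 0" using y(1) C epos by blast
      then have m: "e y powr (2 * t) * c > 0" using c(1) by simp
      have "e y powr (2 * t) * c * (norm \<xi>)\<^sup>2 \<le> normA_sq (W t) x \<xi>" if "x \<in> C" for x \<xi>
      proof -
        have "x \<in> \<Omega>" using that C by blast
        have "e y powr (2 * t) * (c * (norm \<xi>)\<^sup>2) \<le> e x powr (2 * t) * normA_sq A x \<xi>"
          using y(2)[OF that] c(2)[OF \<open>x \<in> \<Omega>\<close>, of \<xi>] c(1) by (intro mult_mono) auto
        then show ?thesis unfolding Wq by (simp add: mult.assoc)
      qed
      then show ?thesis using m by blast
    qed (auto intro: exI[of _ 1])
  qed
  \<comment> \<open>the inequality at exponent \<open>t\<close> on the common core of all the function spaces\<close>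
  define Q where "Q t \<longleftrightarrow> (\<forall>f\<in>C1c ?U. weighted_ineq ?U (W t) (R t) f (grad f))" for t
  have QQ: "Q t \<longleftrightarrow> Q t'" for t t'
  proof -
    have "Q t \<longleftrightarrow> (\<forall>v\<in>C1c ?U. (\<integral>\<^sup>+x\<in>?U. ennreal (V x * e x * (v x)\<^sup>2) \<partial>lebesgue)
      \<le> (\<integral>\<^sup>+x\<in>?U. ennreal (e x * normA_sq A x (grad v x)) \<partial>lebesgue))" for t
      unfolding Q_def weighted_ineq_def R_def Wq by (rule weighted_ineq_iff[OF U e1 epos Ac sym Apos Vc Vnn weq])
    then show ?thesis by simp
  qed
  \<comment> \<open>the inequality at exponent \<open>t\<close> on the completion\<close>
  define X where "X t \<longleftrightarrow> (\<forall>u\<in>X_space \<Omega> A E K t. \<forall>Du. weak_gradient ?U u Du \<longrightarrow>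
      weighted_ineq ?U (W t) (R t) u Du)" for t
  have XQ: "Q t" if "X t" for t
    unfolding Q_def using that C1c_in_X_space[OF U] unfolding X_def by blast
  have QX: "X t" if Q: "Q t" for t
    unfolding X_def
  proof (intro ballI allI impI)
    fix u Du assume u: "u \<in> X_space \<Omega> A E K t" and Du: "weak_gradient ?U u Du"
    obtain s g where sg: "(\<forall>k. s k \<in> Cc_lipschitz ?U \<and> weak_gradient ?U (s k) (g k)) \<and>
        (\<forall>\<epsilon>>0. \<exists>N. \<forall>j\<ge>N. \<forall>k\<ge>N. X_norm_sq \<Omega> A E t (\<lambda>x. g j x - g k x) < \<epsilon>) \<and>
        (\<forall>C. compact C \<and> C \<subseteq> ?U \<longrightarrow> (\<lambda>k. \<integral>\<^sup>+x\<in>C. ennreal ((s k x - u x)\<^sup>2) \<partial>lebesgue) \<longlonglongrightarrow> 0)"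
      using conjunct2[OF u[unfolded X_space_def mem_Collect_eq]] by (elim exE) (rule that)
    have s: "s k \<in> Cc_lipschitz ?U" "weak_gradient ?U (s k) (g k)" for k
      using sg by simp_all
    note cauchy = conjunct1[OF conjunct2[OF sg]]
    note slim = conjunct2[OF conjunct2[OF sg]]
    have Xn: "X_norm_sq \<Omega> A E t h = (\<integral>\<^sup>+x\<in>?U. ennreal (normA_sq (W t) x (h x)) \<partial>lebesgue)" for h
      unfolding X_norm_sq_def onU Wq e_def ..
    have lipineq: "weighted_ineq ?U (W t) (R t) s g"
      if "s \<in> Cc_lipschitz ?U" "weak_gradient ?U s g" for s g
    proof (rule mollify_ineq[OF U W Rc _ that])
      fix \<phi> assume "\<phi> \<in> Cc_smooth ?U"
      then have "\<phi> \<in> C1c ?U" using Cc_smooth_subset_C1c by blast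
      then show "weighted_ineq ?U (W t) (R t) \<phi> (grad \<phi>)"
        using Q unfolding Q_def by blast
    qed
    show "weighted_ineq ?U (W t) (R t) u Du"
    proof (rule completion_ineq[OF U W Rc lipineq s _ _ Du])
      show "\<exists>N. \<forall>j\<ge>N. \<forall>k\<ge>N. (\<integral>\<^sup>+x\<in>?U. ennreal (normA_sq (W t) x (g j x - g k x)) \<partial>lebesgue) < e" if "e > 0" for e
        using cauchy[unfolded Xn, rule_format, OF that] .
      show "(\<lambda>k. \<integral>\<^sup>+x\<in>C. ennreal ((s k x - u x)\<^sup>2) \<partial>lebesgue) \<longlonglongrightarrow> 0" if "compact C" "C \<subseteq> ?U" for C
        using slim[rule_format, OF conjI[OF that]] .
    qed
  qed
  \<comment> \<open>the two terms on the left of the inequality combine into one potential, and the null set \<open>K\<close> is dropped\<close>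
  have comb: "ennreal b * (\<integral>\<^sup>+x\<in>\<Omega>. ennreal (F x * (u x)\<^sup>2) \<partial>lebesgue) + (\<integral>\<^sup>+x\<in>\<Omega>. ennreal (G x * (u x)\<^sup>2) \<partial>lebesgue)
      = (\<integral>\<^sup>+x\<in>?U. ennreal ((b * F x + G x) * (u x)\<^sup>2) \<partial>lebesgue)"
    if "continuous_on ?U F" "continuous_on ?U G" "\<And>x. x \<in> ?U \<Longrightarrow> 0 \<le> F x" "\<And>x. x \<in> ?U \<Longrightarrow> 0 \<le> G x" "0 \<le> b"
      and u: "u \<in> borel_measurable (lebesgue_on ?U)" for F G u b
  proof -
    have [measurable]: "F \<in> borel_measurable (lebesgue_on ?U)" "G \<in> borel_measurable (lebesgue_on ?U)"
      using that(1,2) Um by (auto intro: continuous_imp_measurable_on_sets_lebesgue)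
    note [measurable] = u
    have "ennreal b * (\<integral>\<^sup>+x. ennreal (F x * (u x)\<^sup>2) \<partial>lebesgue_on ?U) + (\<integral>\<^sup>+x. ennreal (G x * (u x)\<^sup>2) \<partial>lebesgue_on ?U)
      = (\<integral>\<^sup>+x. ennreal (b * (F x * (u x)\<^sup>2) + G x * (u x)\<^sup>2) \<partial>lebesgue_on ?U)"
      by (rule nn_integral_linear_combination) (use that in auto)
    then show ?thesis unfolding onU nn_integral_on[OF Um] by (simp add: distrib_right mult.assoc)
  qed
  have um: "u \<in> borel_measurable (lebesgue_on ?U)" if "weak_gradient ?U u Du" for u Du
    by (rule locally_integrable_measurable_on[OF U]) (use that in \<open>simp add: weak_gradient_def\<close>)
  have ii_X: "ii \<longleftrightarrow> (\<forall>t. t \<noteq> 1 / 2 \<longrightarrow> X t)"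
  proof -
    have "ennreal ((t - 1 / 2)\<^sup>2) *
            (\<integral>\<^sup>+x\<in>\<Omega>. ennreal (normA_sq A x (grad e x) * e x powr (2 * t - 2) * (u x)\<^sup>2) \<partial>lebesgue)
          + (\<integral>\<^sup>+x\<in>\<Omega>. ennreal (V x * e x powr (2 * t) * (u x)\<^sup>2) \<partial>lebesgue)
        = (\<integral>\<^sup>+x\<in>?U. ennreal (R t x * (u x)\<^sup>2) \<partial>lebesgue)" if "weak_gradient ?U u Du" for t u Du
      unfolding R_def
      by (rule comb) (use Apos Vnn um[OF that] in \<open>auto intro!: continuous_on_mult qc epc Vc\<close>)
    then show ?thesis unfolding ii_def X_def weighted_ineq_def Wq onU[of "\<lambda>x. ennreal (e x powr (2 * _) * normA_sq A x (_ x))"] by auto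
  qed
  have iii_X: "iii \<longleftrightarrow> X (1 / 2)"
  proof -
    have 1: "(\<integral>\<^sup>+x\<in>\<Omega>. ennreal (V x * e x * (u x)\<^sup>2) \<partial>lebesgue) = (\<integral>\<^sup>+x\<in>?U. ennreal (R (1 / 2) x * (u x)\<^sup>2) \<partial>lebesgue)" for u
      unfolding onU nn_integral_on[OF Um]
      by (rule nn_integral_cong) (use epos in \<open>auto simp: R_def less_imp_le\<close>)
    have 2: "(\<integral>\<^sup>+x\<in>\<Omega>. ennreal (e x * normA_sq A x (Du x)) \<partial>lebesgue) = (\<integral>\<^sup>+x\<in>?U. ennreal (normA_sq (W (1 / 2)) x (Du x)) \<partial>lebesgue)" for Du
      unfolding onU nn_integral_on[OF Um] Wq
      by (rule nn_integral_cong) (use epos in \<open>auto simp: less_imp_le\<close>)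
    show ?thesis unfolding iii_def X_def weighted_ineq_def 1 2 ..
  qed
  have rhs_i: "ennreal (1 / 4) *
              (\<integral>\<^sup>+x\<in>\<Omega>. ennreal (normA_sq A x (grad e x) / (e x)\<^sup>2 * (u x)\<^sup>2) \<partial>lebesgue)
            + (\<integral>\<^sup>+x\<in>\<Omega>. ennreal (V x * (u x)\<^sup>2) \<partial>lebesgue)
      = (\<integral>\<^sup>+x\<in>?U. ennreal (R 0 x * (u x)\<^sup>2) \<partial>lebesgue)" if "u \<in> borel_measurable (lebesgue_on ?U)" for u
  proof -
    have "ennreal (1 / 4) *
              (\<integral>\<^sup>+x\<in>\<Omega>. ennreal (normA_sq A x (grad e x) / (e x)\<^sup>2 * (u x)\<^sup>2) \<partial>lebesgue)
            + (\<integral>\<^sup>+x\<in>\<Omega>. ennreal (V x * (u x)\<^sup>2) \<partial>lebesgue)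
      = (\<integral>\<^sup>+x\<in>?U. ennreal ((1 / 4 * (normA_sq A x (grad e x) / (e x)\<^sup>2) + V x) * (u x)\<^sup>2) \<partial>lebesgue)"
      by (rule comb) (use Apos Vnn that enz in \<open>auto intro!: continuous_intros qc ec Vc\<close>)
    also have "\<dots> = (\<integral>\<^sup>+x\<in>?U. ennreal (R 0 x * (u x)\<^sup>2) \<partial>lebesgue)"
      unfolding nn_integral_on[OF Um]
    proof (rule nn_integral_cong)
      fix x assume "x \<in> space (lebesgue_on ?U)"
      then have x: "e x > 0" using epos by simp
      have "R 0 x = 1 / 4 * (normA_sq A x (grad e x) / (e x)\<^sup>2) + V x"
      proof -
        have "e x powr (2 * 0 - 2) = inverse (e x powr 2)" by (simp add: powr_minus[symmetric])
        then have 1: "e x powr (2 * 0 - 2) = 1 / (e x)\<^sup>2" using x by (simp add: divide_inverse)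
        have 2: "e x powr (2 * 0) = 1" using x by simp
        have 3: "(0 - 1 / 2 :: real)\<^sup>2 = 1 / 4" by (simp add: power2_eq_square)
        show ?thesis unfolding R_def 1 2 3 by simp
      qed
      then show "ennreal ((1 / 4 * (normA_sq A x (grad e x) / (e x)\<^sup>2) + V x) * (u x)\<^sup>2) = ennreal (R 0 x * (u x)\<^sup>2)" by simp
    qed
    finally show ?thesis .
  qed
  have lhs_i: "(\<integral>\<^sup>+x\<in>?U. ennreal (normA_sq (W 0) x (G x)) \<partial>lebesgue) = (\<integral>\<^sup>+x\<in>?U. ennreal (normA_sq A x (G x)) \<partial>lebesgue)" for G
    unfolding nn_integral_on[OF Um] Wq
  proof (rule nn_integral_cong)
    fix x assume "x \<in> space (lebesgue_on ?U)"
    then have "e x > 0" using epos by simp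
    then show "ennreal (e x powr (2 * 0) * normA_sq A x (G x)) = ennreal (normA_sq A x (G x))" by simp
  qed
  have iQ: "Q 0" if i: i
    unfolding Q_def
  proof
    fix f assume f: "f \<in> C1c ?U"
    show "weighted_ineq ?U (W 0) (R 0) f (grad f)"
    proof (rule mollify_ineq[OF U W Rc _ C1c_lipschitz[OF f] C1c_in_X_space(2)[OF U f]])
      fix \<phi> assume \<phi>: "\<phi> \<in> Cc_smooth ?U"
      then have \<phi>\<Omega>: "\<phi> \<in> Cc_smooth \<Omega>" by (auto simp: Cc_smooth_def compact_support_in_def)
      have m: "\<phi> \<in> borel_measurable (lebesgue_on ?U)"
        using Cc_smooth_continuous(1)[OF \<phi>] Um by (rule continuous_imp_measurable_on_sets_lebesgue)
      show "weighted_ineq ?U (W 0) (R 0) \<phi> (grad \<phi>)"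
        using i[unfolded i_def, rule_format, OF Cc_smooth_in_H10[OF \<Omega>(1) \<phi>\<Omega>]]
        unfolding weighted_ineq_def rhs_i[OF m] lhs_i onU[of "\<lambda>x. ennreal (normA_sq A x (grad \<phi> x))"] .
    qed
  qed
  have Qi: i if Q: "Q 0"
    unfolding i_def
  proof (intro ballI allI impI)
    fix u Du assume u: "u \<in> H10 \<Omega>" and Du: "weak_gradient \<Omega> u Du"
    have "u \<in> borel_measurable (lebesgue_on \<Omega>)"
      by (rule locally_integrable_measurable_on[OF \<Omega>(1)]) (use Du in \<open>simp add: weak_gradient_def\<close>)
    then have m: "u \<in> borel_measurable (lebesgue_on ?U)" by (rule measurable_restrict_mono) blast
    have A: "elliptic_loc ?U A"
      unfolding elliptic_loc_def using Ac c by (auto intro!: exI[of _ c])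
    have "weighted_ineq ?U A (R 0) u Du"
    proof (rule H10_ineq[OF \<Omega>(1) K Kne K\<Omega> p decay A \<Lambda>(2,1) Rc _ u Du])
      fix f assume "f \<in> C1c ?U"
      then show "weighted_ineq ?U A (R 0) f (grad f)"
        using Q unfolding Q_def weighted_ineq_def lhs_i by blast
    qed
    then show "ennreal (1 / 4) *
              (\<integral>\<^sup>+x\<in>\<Omega>. ennreal (normA_sq A x (grad e x) / (e x)\<^sup>2 * (u x)\<^sup>2) \<partial>lebesgue)
            + (\<integral>\<^sup>+x\<in>\<Omega>. ennreal (V x * (u x)\<^sup>2) \<partial>lebesgue) \<le> (\<integral>\<^sup>+x\<in>\<Omega>. ennreal (normA_sq A x (Du x)) \<partial>lebesgue)"
      unfolding weighted_ineq_def rhs_i[OF m] onU[of "\<lambda>x. ennreal (normA_sq A x (Du x))"] .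
  qed
  have "ii \<Longrightarrow> Q 0" using ii_X XQ[of 0] by simp
  moreover have "Q 0 \<Longrightarrow> ii" using ii_X QX QQ by blast
  moreover have "iii \<Longrightarrow> Q 0" using iii_X XQ QQ by blast
  moreover have "Q 0 \<Longrightarrow> iii" using iii_X QX QQ by blast
  ultimately show ?thesis using iQ Qi by blast
qed

end
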